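(* Let $\Omega\subset\mathbb{R}^2$ be a bounded domain with Lipschitz boundary, let $1<q<2$, and let $h\colon\mathbb{R}\to[0,+\infty]$ be such that: $h$ is convex and $C^1$ on $(0,+\infty)$; $\lim_{t\to0+}h(t)=+\infty$ and $\liminf_{t\to\infty}h(t)/t>0$; and $h(t)=+\infty$ for $t\le 0$. Let $W(A):=|A|^q+h(\det A)$ for $A\in\mathbb{R}^{2\times2}$ and $I(u):=\int_\Omega W(\nabla u(x))\,dx$. Let $\lambda>0$ satisfy $h'(\lambda^2)>0$ and $$\frac{1}{2^{3-q}\,h'(\lambda^2)\,\lambda^{2-q}}\ >\ (q-1)^{(q-1)/2}q^{-q/2}.$$ Then there is a constant $c=c(\Omega,\lambda,q)>0$ such that for every $u\in\mathcal{A}_\lambda$ $$\int_\Omega\min\{|\nabla u-\lambda\mathbf{1}|^2,\,|\nabla u-\lambda\mathbf{1}|^q\}\,dx\ \le\ c\,\delta(u),$$ where $\delta(u):=I(u)-I(u_\lambda)$. Moreover, for every $u\in\mathcal{A}_\lambda$, $$\lambda\,h'(\lambda^2)\int_\Omega\frac{2\lambda^2(\operatorname{curl}u)^2}{3\big((\operatorname{curl}u)^2+\max\{4\lambda^2,(\operatorname{div}u)^2\}\big)^{3/2}}\,dx\ \le\ \delta(u).$$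
   Context: $|A|=(\operatorname{tr}(A^TA))^{1/2}$; $\mathbf{1}$ is the identity matrix; $u_\lambda(x):=\lambda x$. The admissible class is $\mathcal{A}_\lambda:=\{u\in W^{1,q}(\Omega,\mathbb{R}^2): u=u_\lambda \text{ on }\partial\Omega \text{ (in the sense of traces)},\ \det\nabla u>0\text{ a.e. in }\Omega\}$. With $(\nabla u)_{ij}=\partial_ju_i$, $\operatorname{curl}u:=(\nabla u)_{12}-(\nabla u)_{21}$ and $\operatorname{div}u:=\operatorname{tr}\nabla u$. The function $h$ is fixed throughout. *)

theory Defs
  imports "HOL-Analysis.Analysis"
begin

type_synonym plane = "real ^ 2"
type_synonym mat2 = "real ^ 2 ^ 2"

text \<open>The library norm on matrices is the Frobenius norm.\<close>

lemma norm_matrix_eq_sqrt_trace: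
  fixes A :: mat2
  shows "norm A = sqrt (trace (transpose A ** A))"
  by (simp add: norm_vec_def L2_set_def trace_def transpose_def matrix_matrix_mult_def
      sum_2 power2_eq_square algebra_simps)

definition lipschitz_boundary :: "plane set \<Rightarrow> bool" where
  "lipschitz_boundary \<Omega> \<longleftrightarrow>
     (\<forall>p \<in> frontier \<Omega>. \<exists>r > 0. \<exists>R :: plane \<Rightarrow> plane. \<exists>\<gamma> :: real \<Rightarrow> real. \<exists>L.
        orthogonal_transformation R \<and> L-lipschitz_on UNIV \<gamma> \<and>
        \<Omega> \<inter> ball p r = {x \<in> ball p r. \<gamma> (R x $ 1) < R x $ 2})"

definition bounded_lipschitz_domain :: "plane set \<Rightarrow> bool" where
  "bounded_lipschitz_domain \<Omega> \<longleftrightarrow>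
     open \<Omega> \<and> connected \<Omega> \<and> \<Omega> \<noteq> {} \<and> bounded \<Omega> \<and> lipschitz_boundary \<Omega>"

definition partial :: "2 \<Rightarrow> (plane \<Rightarrow> real) \<Rightarrow> plane \<Rightarrow> real" where
  "partial j f x = frechet_derivative f (at x) (axis j 1)"

primrec Ck :: "nat \<Rightarrow> (plane \<Rightarrow> real) \<Rightarrow> bool" where
  "Ck 0 f \<longleftrightarrow> continuous_on UNIV f"
| "Ck (Suc k) f \<longleftrightarrow> (\<forall>x. f differentiable at x) \<and> (\<forall>j. Ck k (partial j f))"

definition smooth :: "(plane \<Rightarrow> real) \<Rightarrow> bool" where
  "smooth f \<longleftrightarrow> (\<forall>k. Ck k f)"

definition test_functions :: "plane set \<Rightarrow> (plane \<Rightarrow> real) set" where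
  "test_functions \<Omega> =
     {\<phi>. smooth \<phi> \<and> (\<exists>K. compact K \<and> K \<subseteq> \<Omega> \<and> (\<forall>x. x \<notin> K \<longrightarrow> \<phi> x = 0))}"

definition loc_integrable :: "plane set \<Rightarrow> (plane \<Rightarrow> 'b::euclidean_space) \<Rightarrow> bool" where
  "loc_integrable \<Omega> f \<longleftrightarrow> f \<in> borel_measurable (lebesgue_on \<Omega>) \<and>
     (\<forall>K. compact K \<and> K \<subseteq> \<Omega> \<longrightarrow> set_integrable lebesgue K f)"

definition Lq :: "plane set \<Rightarrow> real \<Rightarrow> (plane \<Rightarrow> 'b::euclidean_space) set" where
  "Lq \<Omega> q = {f. f \<in> borel_measurable (lebesgue_on \<Omega>) \<and>
     (\<integral>\<^sup>+ x\<in>\<Omega>. ennreal (norm (f x) powr q) \<partial>lebesgue) < \<infinity>}"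

definition has_weak_gradient :: "plane set \<Rightarrow> (plane \<Rightarrow> plane) \<Rightarrow> (plane \<Rightarrow> mat2) \<Rightarrow> bool" where
  "has_weak_gradient \<Omega> u G \<longleftrightarrow> loc_integrable \<Omega> u \<and> loc_integrable \<Omega> G \<and>
     (\<forall>\<phi> \<in> test_functions \<Omega>. \<forall>i j.
        (LINT x:\<Omega>|lebesgue. u x $ i * partial j \<phi> x) =
        - (LINT x:\<Omega>|lebesgue. G x $ i $ j * \<phi> x))"

text \<open>Weak gradients are unique up to null sets, so the choice below only selects a representative.\<close>

definition weak_gradient :: "plane set \<Rightarrow> (plane \<Rightarrow> plane) \<Rightarrow> plane \<Rightarrow> mat2" where
  "weak_gradient \<Omega> u = (SOME G. has_weak_gradient \<Omega> u G)"

definition sobolev_W1 :: "plane set \<Rightarrow> real \<Rightarrow> (plane \<Rightarrow> plane) set" where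
  "sobolev_W1 \<Omega> q = {u. u \<in> Lq \<Omega> q \<and> (\<exists>G. has_weak_gradient \<Omega> u G \<and> G \<in> Lq \<Omega> q)}"

text \<open>One-dimensional Hausdorff measure, which is the arc-length measure on a Lipschitz boundary.
  The outer measure below is a metric outer measure, hence countably additive on Borel sets.\<close>

definition hausdorff1_pre :: "real \<Rightarrow> plane set \<Rightarrow> ennreal" where
  "hausdorff1_pre \<delta> A =
     (INF C \<in> {C :: nat \<Rightarrow> plane set. A \<subseteq> (\<Union>i. C i) \<and>
                 (\<forall>i. bounded (C i) \<and> diameter (C i) \<le> \<delta>)}.
        (\<Sum>i. ennreal (diameter (C i))))"

definition hausdorff1_outer :: "plane set \<Rightarrow> ennreal" where
  "hausdorff1_outer A = (SUP \<delta> \<in> {0<..}. hausdorff1_pre \<delta> A)"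

definition hausdorff1 :: "plane measure" where
  "hausdorff1 = measure_of UNIV (sets borel) hausdorff1_outer"

text \<open>The trace operator is the continuous extension of \<open>v \<mapsto> v|\<partial>\<Omega>\<close> from functions smooth up to
  the boundary (which are dense) to an operator \<open>W\<^bsup>1,q\<^esup>(\<Omega>) \<rightarrow> L\<^bsup>q\<^esup>(\<partial>\<Omega>)\<close>; the following predicate
  is its graph.\<close>

definition has_trace ::
  "plane set \<Rightarrow> real \<Rightarrow> (plane \<Rightarrow> plane) \<Rightarrow> (plane \<Rightarrow> plane) \<Rightarrow> bool" where
  "has_trace \<Omega> q u g \<longleftrightarrow>
     g \<in> borel_measurable (restrict_space borel (frontier \<Omega>)) \<and>
     (\<exists>v :: nat \<Rightarrow> plane \<Rightarrow> plane.
        (\<forall>k i. smooth (\<lambda>x. v k x $ i)) \<and>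
        (\<lambda>k. \<integral>\<^sup>+ x\<in>\<Omega>. ennreal (norm (v k x - u x) powr q) \<partial>lebesgue) \<longlonglongrightarrow> 0 \<and>
        (\<lambda>k. \<integral>\<^sup>+ x\<in>\<Omega>. ennreal (norm (jacobian (v k) (at x) - weak_gradient \<Omega> u x) powr q)
               \<partial>lebesgue) \<longlonglongrightarrow> 0 \<and>
        (\<lambda>k. \<integral>\<^sup>+ x\<in>frontier \<Omega>. ennreal (norm (v k x - g x) powr q) \<partial>hausdorff1) \<longlonglongrightarrow> 0)"

definition u_lin :: "real \<Rightarrow> plane \<Rightarrow> plane" where
  "u_lin lam x = lam *\<^sub>R x"

definition admissible :: "plane set \<Rightarrow> real \<Rightarrow> real \<Rightarrow> (plane \<Rightarrow> plane) set" where
  "admissible \<Omega> q lam = {u \<in> sobolev_W1 \<Omega> q. has_trace \<Omega> q u (u_lin lam) \<and>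
     (AE x in lebesgue_on \<Omega>. det (weak_gradient \<Omega> u x) > 0)}"

definition curl :: "plane set \<Rightarrow> (plane \<Rightarrow> plane) \<Rightarrow> plane \<Rightarrow> real" where
  "curl \<Omega> u x = weak_gradient \<Omega> u x $ 1 $ 2 - weak_gradient \<Omega> u x $ 2 $ 1"

definition divergence :: "plane set \<Rightarrow> (plane \<Rightarrow> plane) \<Rightarrow> plane \<Rightarrow> real" where
  "divergence \<Omega> u x = trace (weak_gradient \<Omega> u x)"

definition C1_on_pos :: "(real \<Rightarrow> real) \<Rightarrow> bool" where
  "C1_on_pos f \<longleftrightarrow> f differentiable_on {0<..} \<and> continuous_on {0<..} (deriv f)"

text \<open>The functions \<open>h\<close> take values in \<open>[0,\<infinity>]\<close>; being \<open>C\<^sup>1\<close> on \<open>(0,\<infinity>)\<close> includes being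
  finite there, so that convexity and derivatives refer to \<open>enn2real \<circ> h\<close>.\<close>

definition admissible_h :: "(real \<Rightarrow> ennreal) \<Rightarrow> bool" where
  "admissible_h h \<longleftrightarrow>
     (\<forall>t > 0. h t < \<infinity>) \<and>
     convex_on {0<..} (enn2real \<circ> h) \<and> C1_on_pos (enn2real \<circ> h) \<and>
     (h \<longlongrightarrow> \<infinity>) (at_right 0) \<and>
     Liminf at_top (\<lambda>t. h t / ennreal t) > 0 \<and>
     (\<forall>t \<le> 0. h t = \<infinity>)"

definition stored_energy :: "real \<Rightarrow> (real \<Rightarrow> ennreal) \<Rightarrow> mat2 \<Rightarrow> ennreal" where
  "stored_energy q h A = ennreal (norm A powr q) + h (det A)"

definition energy ::
  "plane set \<Rightarrow> real \<Rightarrow> (real \<Rightarrow> ennreal) \<Rightarrow> (plane \<Rightarrow> plane) \<Rightarrow> ennreal" where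
  "energy \<Omega> q h u = (\<integral>\<^sup>+ x\<in>\<Omega>. stored_energy q h (weak_gradient \<Omega> u x) \<partial>lebesgue)"

definition excess ::
  "plane set \<Rightarrow> real \<Rightarrow> (real \<Rightarrow> ennreal) \<Rightarrow> real \<Rightarrow> (plane \<Rightarrow> plane) \<Rightarrow> ereal" where
  "excess \<Omega> q h lam u =
     enn2ereal (energy \<Omega> q h u) - enn2ereal (energy \<Omega> q h (u_lin lam))"

end

theory Submission
  imports Defs
begin

text \<open>
  By convexity of \<open>h\<close> it suffices to bound \<open>|A|\<^bsup>q\<^esup> + k det A\<close>, \<open>k = h'(\<lambda>\<^sup>2)\<close>, from below on
  \<open>{det A > 0}\<close> by an affine function of \<open>tr A\<close> plus the claimed remainder, because \<open>\<integral> tr \<nabla>u\<close> is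
  determined by the boundary values. In terms of the sum \<open>s = sqrt ((div u)\<^sup>2 + (curl u)\<^sup>2)\<close> and the
  difference \<open>d\<close> of the singular values the energy is concave in \<open>d\<^sup>2 \<in> [0, s\<^sup>2]\<close>, so the tangent in
  \<open>s\<close> at \<open>2\<lambda>\<close> need only be compared with it for \<open>d = 0\<close> (convexity) and \<open>d = s\<close> (the hypothesis on
  \<open>\<lambda>\<close>); the gap \<open>s - div u\<close> yields the curl estimate.

  The identity \<open>\<integral> tr \<nabla>u = 2\<lambda>|\<Omega>|\<close> follows from \<open>|\<integral>\<^sub>\<Omega> \<partial>\<^sub>j w| \<le> 4 \<integral>\<^bsub>\<partial>\<Omega>\<^esub> |w| dH\<^sup>1\<close> for smooth \<open>w\<close>,
  which holds for every bounded open set: on each line parallel to the \<open>j\<close>-axis the integral is a sum of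
  boundary values over the endpoints of countably many intervals, and these sums are integrated by
  projecting small pieces of \<open>\<partial>\<Omega>\<close>. Lipschitz regularity only enters through \<open>H\<^sup>1(\<partial>\<Omega>) < \<infinity>\<close>.
\<close>

subsection \<open>The pointwise lower bound\<close>

text \<open>For q < 2 the integral of det \<nabla>u is not fixed by the boundary values, since maps
  in W^{1,q} may open cavities. So k det A cannot be integrated away as a null Lagrangian; only the
  trace plays that role. The price is a nonconvex function: k det A = k (s^2 - d^2) / 4 falls as the
  singular values separate, and |A|^q = ((s^2 + d^2) / 2)^(q/2) must compensate. Besides the
  conformal matrices d = 0, the critical ones have a vanishing singular value; they form the edge d
  = s of the region det A > 0, and there the smallness of k lets |A|^q win. Passing from s to tr A
  is harmless because s \<ge> tr A and the slope in s is positive; the gap is kept, as it measures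
  the deviation from symmetric matrices. On the boundary, the trace of u is accessible only through
  smooth approximants that converge in L^q of arc length. An inequality with the L^1 norm of the
  boundary values on its right-hand side survives this limit, which is why the integral identity is
  derived from such an inequality and not from a formula with normals.\<close>

lemma powr_le_tangent_at_1:
  fixes z p :: real
  assumes "0 \<le> z" "0 < p" "p \<le> 1"
  shows "z powr p \<le> 1 + p * (z - 1)"
proof (cases "z = 0")
  case False
  with Youngs_inequality_0[of p "1 - p" z 1] assms show ?thesis
    by (simp add: algebra_simps)
qed (use assms in auto)

text \<open>The concave inequality for the exponent 1/q, applied to \<open>x powr q\<close>.\<close>

lemma tangent_at_1_le_powr:
  fixes x q :: real
  assumes "0 \<le> x" "1 \<le> q"
  shows "1 + q * (x - 1) \<le> x powr q"
proof -
  have "(x powr q) powr (1 / q) \<le> 1 + (1 / q) * (x powr q - 1)"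
    by (rule powr_le_tangent_at_1) (use assms in auto)
  moreover have "(x powr q) powr (1 / q) = x"
    using assms by (simp add: powr_powr)
  ultimately have "x \<le> 1 + (1 / q) * (x powr q - 1)" by simp
  then have "q * x \<le> q * (1 + (1 / q) * (x powr q - 1))"
    using assms by (intro mult_left_mono) auto
  then show ?thesis using assms by (simp add: algebra_simps)
qed

text \<open>The tangent of \<open>y powr p\<close> at the mean w lies above the graph, and averaging
  it over u and v leaves \<open>w powr p\<close>. This tangent is the one at 1 rescaled by w, so w =
  0 is treated apart.\<close>

lemma powr_concave_combination:
  fixes u v t p :: real
  assumes "0 \<le> u" "0 \<le> v" "0 \<le> t" "t \<le> 1" "0 < p" "p \<le> 1"
  shows "(1 - t) * u powr p + t * v powr p \<le> ((1 - t) * u + t * v) powr p"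
proof -
  define w where "w = (1 - t) * u + t * v"
  have nn: "0 \<le> (1 - t) * u" "0 \<le> t * v" using assms by auto
  show ?thesis
  proof (cases "w = 0")
    case True
    then have "(1 - t) * u = 0" "t * v = 0" using nn unfolding w_def by linarith+
    then have z: "(1 - t) * u powr p = 0" "t * v powr p = 0" by auto
    show ?thesis unfolding z by simp
  next
    case False
    then have w: "w > 0" using nn w_def by linarith
    have *: "y powr p \<le> w powr p * (1 + p * (y / w - 1))" if "0 \<le> y" for y
    proof -
      have "y powr p = w powr p * (y / w) powr p"
        using w that by (simp add: powr_divide)
      also have "\<dots> \<le> w powr p * (1 + p * (y / w - 1))"
        using w that assms by (intro mult_left_mono powr_le_tangent_at_1) auto
      finally show ?thesis .
    qed
    have "(1 - t) * u powr p + t * v powr p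
      \<le> (1 - t) * (w powr p * (1 + p * (u / w - 1))) + t * (w powr p * (1 + p * (v / w - 1)))"
      using assms by (intro add_mono mult_left_mono *) auto
    also have "\<dots> = w powr p * (1 + p * (((1 - t) * u + t * v) / w - 1))"
      by (simp add: algebra_simps add_divide_distrib diff_divide_distrib)
    also have "\<dots> = w powr p" using w by (simp add: w_def[symmetric])
    finally show ?thesis by (simp add: w_def)
  qed
qed

text \<open>This is the inequality f(q) < 1/5 + 19\<theta>/50 for the threshold f(q) met in
  \<open>derivative_bound\<close>, squared and with (2q/\<theta>)^\<theta> replaced by its Bernoulli
  bound relative to the base 16. The only transcendental factor left is
  \<open>16 powr \<theta>\<close>.\<close>

lemma entropy_polynomial_bound:
  fixes \<theta> :: real
  assumes "0 < \<theta>" "\<theta> < 1"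
  shows "(16 powr \<theta>) * (1 + \<theta>) * (9 - 7 * \<theta>) < 256 * (1/5 + 19/50 * \<theta>)\<^sup>2"
proof -
  have sq: "(16::real) powr \<theta> = (4 powr \<theta>)\<^sup>2"
    by (simp add: powr_mult[symmetric] power2_eq_square)
  have f: "(4::real) powr \<theta> = 2 powr (2 * \<theta>)"
    by (simp add: powr_powr[symmetric])
  have pos: "0 \<le> (1 + \<theta>) * (9 - 7 * \<theta>)" using assms by simp
  show ?thesis
  proof (cases "\<theta> \<le> 1/2")
    case True
    \<comment> \<open>The chord of the convex function \<open>4 powr \<theta>\<close> over [0, 1/2];
      the other case uses the chord 4\<theta> over [1/2, 1]. A single chord over [0, 1] would be too
      coarse.\<close>
    have "(4::real) powr \<theta> \<le> 1 + 2 * \<theta>"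
      using powr_le_tangent_at_1[of 2 "2 * \<theta>"] assms True f by simp
    then have "(16::real) powr \<theta> \<le> (1 + 2 * \<theta>)\<^sup>2"
      unfolding sq by (intro power_mono) auto
    then have "16 powr \<theta> * ((1 + \<theta>) * (9 - 7 * \<theta>)) \<le> (1 + 2 * \<theta>)\<^sup>2 * ((1 + \<theta>) * (9 - 7 * \<theta>))"
      using pos by (rule mult_right_mono)
    moreover have "256 * (1/5 + 19/50 * \<theta>)\<^sup>2 - (1 + 2 * \<theta>)\<^sup>2 * ((1 + \<theta>) * (9 - 7 * \<theta>))
       = 31/25 + 114/125 * \<theta> - 21/625 * \<theta>\<^sup>2 + 20 * \<theta>^3 + 28 * \<theta>^4"
      by (simp add: algebra_simps power2_eq_square power3_eq_cube power4_eq_xxxx)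
    moreover have "\<theta>\<^sup>2 \<le> \<theta>" using assms by (simp add: power2_eq_square mult_left_le)
    moreover have "0 < \<theta>^3" "0 < \<theta>^4" using assms by auto
    ultimately show ?thesis using assms unfolding mult.assoc by linarith
  next
    case False
    have "(4::real) powr \<theta> = 2 * 2 powr (2 * \<theta> - 1)"
      unfolding f by (simp add: powr_diff)
    also have "\<dots> \<le> 2 * (1 + (2 * \<theta> - 1) * (2 - 1))"
      using assms False by (intro mult_left_mono powr_le_tangent_at_1) auto
    finally have "(16::real) powr \<theta> \<le> (4 * \<theta>)\<^sup>2"
      unfolding sq by (intro power_mono) auto
    then have 1: "16 powr \<theta> * ((1 + \<theta>) * (9 - 7 * \<theta>)) \<le> (4 * \<theta>)\<^sup>2 * ((1 + \<theta>) * (9 - 7 * \<theta>))"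
      using pos by (rule mult_right_mono)
    \<comment> \<open>On this interval the polynomial gap is smallest near 3/4. Expanding there
      leaves a quadratic with positive minimum once the cubic and quartic terms are absorbed into
      the coefficient 120.\<close>
    define v where "v = \<theta> - 3/4"
    have \<theta>: "\<theta> = v + 3/4" by (simp add: v_def)
    have 2: "256 * (1/5 + 19/50 * \<theta>)\<^sup>2 - (4 * \<theta>)\<^sup>2 * ((1 + \<theta>) * (9 - 7 * \<theta>))
       = 11551/10000 + 133616/10000 * v + v\<^sup>2 * (1989664/10000 + 304 * v + 112 * v\<^sup>2)"
      unfolding \<theta> by (simp add: field_simps power2_eq_square)
    have "v \<ge> - 1/4" using False v_def by simp
    then have "120 \<le> 1989664/10000 + 304 * v + 112 * v\<^sup>2"
      using zero_le_power2[of v] by linarith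
    then have "v\<^sup>2 * 120 \<le> v\<^sup>2 * (1989664/10000 + 304 * v + 112 * v\<^sup>2)"
      by (intro mult_left_mono) auto
    moreover have "0 < 11551/10000 + 133616/10000 * v + v\<^sup>2 * 120"
    proof -
      have "v\<^sup>2 * 120 + 133616/10000 * v = 120 * (v + 133616/2400000)\<^sup>2 - 120 * (133616/2400000)\<^sup>2"
        by (simp add: power2_eq_square field_simps)
      moreover have "120 * (133616/2400000)\<^sup>2 < (11551/10000::real)" by (simp add: power2_eq_square)
      ultimately show ?thesis using zero_le_power2[of "v + 133616/2400000"] by linarith
    qed
    ultimately show ?thesis using 1 2 unfolding mult.assoc by linarith
  qed
qed

text \<open>With \<open>\<theta> = q - 1\<close>, the smallness hypothesis on \<open>h'(\<lambda>\<^sup>2)\<close> reads \<open>K < f(q)\<close> for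
  \<open>K = h'(\<lambda>\<^sup>2) \<lambda>\<^bsup>2-q\<^esup> 2\<^bsup>-q/2\<^esup>\<close> and \<open>f(q)\<^sup>2 = (q/32) (2q/\<theta>)\<^bsup>\<theta>\<^esup>\<close>. The affine function
  \<open>1/5 + 19\<theta>/50\<close> is a convenient upper bound of \<open>f\<close> that still lies below the critical value of \<open>K\<close>.\<close>

lemma derivative_bound:
  fixes k lam q :: real
  assumes q: "1 < q" "q < 2" and k: "0 < k" and lam: "0 < lam"
    and bd: "1 / (2 powr (3 - q) * k * lam powr (2 - q)) > (q - 1) powr ((q - 1) / 2) * q powr (- q / 2)"
  shows "k * lam\<^sup>2 < (1/5 + 19/50 * (q - 1)) * (2 * lam\<^sup>2) powr (q / 2)"
proof -
  define \<theta> where "\<theta> = q - 1"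
  have th: "0 < \<theta>" "\<theta> < 1" "q = 1 + \<theta>" using q by (auto simp: \<theta>_def)
  define T where "T = \<theta> powr (\<theta> / 2) * q powr (- q / 2)"
  define B where "B = 1/5 + 19/50 * \<theta>"
  have T: "T > 0" using th by (auto simp: T_def)
  have B: "B > 0" using th by (auto simp: B_def)
  define X where "X = k * lam powr (2 - q)"
  have X: "X > 0" using k lam by (simp add: X_def)
  \<comment> \<open>\<open>X * 2 powr (- q / 2)\<close> is the normalized coefficient K and
    \<open>Y\<close> is 1/f(q). The hypothesis thus becomes K Y < 1, and it remains to show 1 < B
    Y.\<close>
  define Y where "Y = 8 * (2 powr (- q / 2)) * T"
  have Y: "Y > 0" using T by (simp add: Y_def)
  have X1: "2 powr (3 - q) * X * T < 1"
  proof -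
    have "T < 1 / (2 powr (3 - q) * X)"
      using bd unfolding T_def X_def \<theta>_def by (simp add: mult.assoc)
    then show ?thesis using X by (simp add: field_simps)
  qed
  have "2 powr (3 - q) = 8 * 2 powr (- q / 2) * 2 powr (- q / 2)"
  proof -
    have "2 powr (3 - q) = 2 powr (3 + (- q / 2) + (- q / 2))" by simp
    also have "\<dots> = 2 powr 3 * 2 powr (- q / 2) * 2 powr (- q / 2)" by (simp only: powr_add)
    finally show ?thesis by simp
  qed
  then have X2: "(X * 2 powr (- q / 2)) * Y < 1"
    using X1 by (simp add: Y_def mult_ac)
  have "1 < (B * Y)\<^sup>2"
  proof -
    have p1: "(2 powr (- q / 2))\<^sup>2 = 2 powr (- q)"
      by (simp add: power2_eq_square powr_add[symmetric])
    have p2: "T\<^sup>2 = \<theta> powr \<theta> * q powr (- q)"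
      
    proof -
      have "(z powr (c / 2))\<^sup>2 = z powr c" for z c :: real
        by (simp add: power2_eq_square powr_add[symmetric])
      from this[of \<theta> \<theta>] this[of q "- q"] show ?thesis
        by (simp add: T_def power_mult_distrib)
    qed
    have "(1 / (1 + \<theta>)) * q powr q * \<theta> powr (- \<theta>) * 2 powr \<theta> = (2 * q / \<theta>) powr \<theta>"
    proof -
      have "q powr q = q * q powr \<theta>" using th powr_add[of q 1 \<theta>] by simp
      moreover have "(2 * q / \<theta>) powr \<theta> = 2 powr \<theta> * q powr \<theta> / \<theta> powr \<theta>"
        using th by (simp only: powr_divide powr_mult)
      ultimately show ?thesis using th(1,3) by (simp add: powr_minus_divide)
    qed
    \<comment> \<open>A base is split off before Bernoulli's inequality is used, because 2q/\<theta>
      is unbounded as \<theta> tends to 0. With the base 16 the estimate is exact at \<theta> =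
      1/7.\<close>
    also have "\<dots> = 16 powr \<theta> * ((2 * q / \<theta>) / 16) powr \<theta>"
    proof -
      have "y powr \<theta> = 16 powr \<theta> * (y / 16) powr \<theta>" if "y \<ge> 0" for y
        using powr_mult[of 16 "y / 16" \<theta>] that by simp
      then show ?thesis by this (use th in auto)
    qed
    also have "\<dots> \<le> 16 powr \<theta> * (1 + \<theta> * ((2 * q / \<theta>) / 16 - 1))"
      using th by (intro mult_left_mono powr_le_tangent_at_1) auto
    also have "\<dots> = 16 powr \<theta> * (9 - 7 * \<theta>) / 8"
      using th by (simp add: field_simps)
    finally have "(1 + \<theta>) * ((1 / (1 + \<theta>)) * q powr q * \<theta> powr (- \<theta>) * 2 powr \<theta>)
        \<le> (1 + \<theta>) * (16 powr \<theta> * (9 - 7 * \<theta>) / 8)"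
      using th(1) by (intro mult_left_mono) auto
    then have "q powr q * \<theta> powr (- \<theta>) * 2 powr \<theta> \<le> 16 powr \<theta> * (1 + \<theta>) * (9 - 7 * \<theta>) / 8"
      using th(1) by (simp add: mult_ac)
    also have "\<dots> < 32 * B\<^sup>2"
      using entropy_polynomial_bound[OF th(1,2)] by (simp add: B_def)
    finally have main: "q powr q * \<theta> powr (- \<theta>) * 2 powr \<theta> < 32 * B\<^sup>2" .
    have "(B * Y)\<^sup>2 = 64 * B\<^sup>2 * 2 powr (- q) * (\<theta> powr \<theta> * q powr (- q))"
      unfolding Y_def power_mult_distrib p1 p2 by simp
    also have "\<dots> = 32 * B\<^sup>2 / (q powr q * \<theta> powr (- \<theta>) * 2 powr \<theta>)"
    proof -
      have "2 powr (- q) = 1 / (2 * 2 powr \<theta>)" 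
        unfolding powr_minus_divide th(3) powr_add by simp
      then show ?thesis by (simp add: powr_minus_divide)
    qed
    finally have "(B * Y)\<^sup>2 = 32 * B\<^sup>2 / (q powr q * \<theta> powr (- \<theta>) * 2 powr \<theta>)" .
    moreover have "0 < q powr q * \<theta> powr (- \<theta>) * 2 powr \<theta>" using th(1) q by simp
    ultimately show ?thesis using main by (simp only: less_divide_eq_1_pos)
  qed
  then have "1 < B * Y" using B Y by (intro power2_less_imp_less[of 1 "B * Y"]) auto
  then have "X * 2 powr (- q / 2) < B"
    using X2 Y by (metis mult_less_cancel_right_pos order_less_trans)
  then have "X * 2 powr (- q / 2) * (2 * lam\<^sup>2) powr (q / 2) < B * (2 * lam\<^sup>2) powr (q / 2)"
    using lam by (intro mult_strict_right_mono) auto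
  moreover have "X * 2 powr (- q / 2) * (2 * lam\<^sup>2) powr (q / 2) = k * lam\<^sup>2"
  proof -
    have "(lam\<^sup>2) powr (q / 2) = lam powr q"
      using lam by (simp add: powr_powr flip: powr_numeral)
    moreover have "lam powr (2 - q) * lam powr q = lam\<^sup>2"
      using lam by (simp add: powr_add[symmetric])
    moreover have "2 powr (- q / 2) * 2 powr (q / 2) = (1::real)"
      by (simp add: powr_add[symmetric])
    ultimately show ?thesis by (simp add: X_def powr_mult mult_ac)
  qed
  ultimately show ?thesis by (simp add: B_def \<theta>_def)
qed

text \<open>The case of a vanishing singular value, rescaled, at the extreme value of \<open>K\<close>: the right-hand
  side is \<open>y\<^bsup>q\<^esup>\<close> with \<open>y = \<surd>2 x\<close>, and its tangent at \<open>y = 6/5\<close> dominates the left-hand side.\<close>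

lemma collapsed_energy_bound_max:
  fixes q x :: real
  assumes q: "1 < q" "q < 2" and x: "0 \<le> x"
  shows "1 - q - (1/5 + 19/50 * (q - 1)) + (q + 2 * (1/5 + 19/50 * (q - 1))) * x \<le> 2 powr (q / 2) * x powr q"
proof -
  define \<theta> where "\<theta> = q - 1"
  have th: "0 < \<theta>" "\<theta> < 1" "q = 1 + \<theta>" using q by (auto simp: \<theta>_def)
  define B where "B = 1/5 + 19/50 * \<theta>"
  define b where "b = (6/5::real)"
  define w where "w = sqrt 2 * x / b"
  have w: "w \<ge> 0" using x by (simp add: w_def b_def)
  have r2: "sqrt 2 > 1414/1000" by (intro real_less_rsqrt) (simp add: power2_eq_square)
  have s2: "sqrt 2 powr q = 2 powr (q / 2)"
    by (simp add: powr_half_sqrt[symmetric] powr_powr)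
  have "b powr q * (1 + q * (w - 1)) \<le> b powr q * w powr q"
    using w q by (intro mult_left_mono tangent_at_1_le_powr) auto
  also have "\<dots> = (b * w) powr q" using w by (intro powr_mult[symmetric])
  also have "\<dots> = 2 powr (q / 2) * x powr q"
    using x s2 by (simp add: w_def b_def powr_mult)
  finally have 1: "b powr q * (1 + q * (w - 1)) \<le> 2 powr (q / 2) * x powr q" .
  have bq: "b powr q = b * b powr \<theta>" using th by (simp add: powr_add b_def)
  have up: "b powr \<theta> \<le> 1 + \<theta> / 5"
    using powr_le_tangent_at_1[of b \<theta>] th by (simp add: b_def)
  \<comment> \<open>The number 1/6 is 1 - 1/b, a lower bound for the logarithm of b.\<close>
  have lo: "1 + \<theta> / 6 \<le> b powr \<theta>"
  proof -
    have "1/6 \<le> ln b" using ln_ge_iff ln_le_minus_one[of "1/b"] by (simp add: b_def ln_div)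
    then have "1 + \<theta> * (1/6) \<le> 1 + \<theta> * ln b"
      using th by (intro add_left_mono mult_left_mono) auto
    also have "\<dots> \<le> exp (\<theta> * ln b)" using exp_ge_add_one_self by (simp add: add.commute)
    finally show ?thesis by (simp add: powr_def b_def)
  qed
  have "b powr q * (1 + q * (w - 1)) = q * sqrt 2 * b powr \<theta> * x - \<theta> * b * b powr \<theta>"
  proof -
    have "b * P * (1 + q * (w - 1)) = q * sqrt 2 * P * x - (q - 1) * b * P" for P
      unfolding w_def by (simp add: b_def field_simps)
    then show ?thesis unfolding bq by (simp add: \<theta>_def)
  qed
  moreover have "\<theta> * b * b powr \<theta> \<le> \<theta> * b * (1 + \<theta> / 5)"
    using up th by (intro mult_left_mono) (auto simp: b_def)
  moreover have "\<theta> * b * (1 + \<theta> / 5) \<le> \<theta> + B"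
  proof -
    have "\<theta> * \<theta> \<le> \<theta>" using th by (simp add: mult_left_le)
    moreover have "\<theta> * b * (1 + \<theta> / 5) = 6/5 * \<theta> + 6/25 * (\<theta> * \<theta>)"
      by (simp add: b_def field_simps)
    ultimately show ?thesis using th unfolding B_def by linarith
  qed
  moreover have "(q + 2 * B) * x \<le> q * sqrt 2 * b powr \<theta> * x"
  proof (rule mult_right_mono)
    \<comment> \<open>The difference is a quadratic in \<theta> whose minimum, attained near
      234/1000, is only just positive; this limits how large the affine bound \<open>B\<close> may
      be.\<close>
    have "q + 2 * B \<le> q * (1414/1000) * (1 + \<theta> / 6)"
      using zero_le_power2[of "\<theta> - 234/1000"] th unfolding B_def th(3)
      by (simp add: algebra_simps power2_eq_square)
    also have "\<dots> \<le> q * sqrt 2 * b powr \<theta>"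
      using r2 lo q th by (intro mult_mono) auto
    finally show "q + 2 * B \<le> q * sqrt 2 * b powr \<theta>" .
  qed (use x in auto)
  ultimately have "1 - q - B + (q + 2 * B) * x \<le> 2 powr (q / 2) * x powr q"
    using 1 th(3) by linarith
  then show ?thesis by (simp add: B_def \<theta>_def)
qed

text \<open>The comparison for a vanishing singular value at K = 0. There is room here:
  \<open>x powr q\<close> already dominates the tangent and the factor \<open>2 powr (q / 2)\<close>
  exceeds 1. Interpolation with the extreme value of K later turns this room into a strict gap for
  every smaller K. Up to \<open>x0\<close> the tangent is at most -(q - 1)/2, which provides the
  constant part of the gap; beyond \<open>x0\<close> the surplus \<open>a * x powr q\<close>
  provides it.\<close>

lemma collapsed_energy_gap:
  fixes q :: real
  assumes q: "1 < q"
  shows "\<exists>e>0. \<forall>x\<ge>0. e * (1 + x powr q) \<le> 2 powr (q / 2) * x powr q - 1 - q * (x - 1)"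
proof -
  define a where "a = (2::real) powr (q / 2) - 1"
  define x0 where "x0 = (q - 1) / (2 * q)"
  define e where "e = min (a / 2) (min ((q - 1) / 2) (a / 2 * x0 powr q))"
  have a: "a > 0" unfolding a_def using q by simp
  have x0: "x0 > 0" using q by (simp add: x0_def)
  have e: "e > 0" "e \<le> a / 2" "e \<le> (q - 1) / 2" "e \<le> a / 2 * x0 powr q"
  proof -
    show "e > 0" using a q x0 by (simp add: e_def)
    show "e \<le> a / 2" "e \<le> (q - 1) / 2" "e \<le> a / 2 * x0 powr q" unfolding e_def by linarith+
  qed
  have "e * (1 + x powr q) \<le> 2 powr (q / 2) * x powr q - 1 - q * (x - 1)" if x: "x \<ge> 0" for x
  proof -
    have e23: "2 * e \<le> q - 1" using e(3) by simp
    have eq: "2 powr (q / 2) * x powr q = x powr q + a * x powr q" by (simp add: a_def algebra_simps)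
    have e1: "e * x powr q \<le> a * x powr q / 2" using mult_right_mono[OF e(2), of "x powr q"] by simp
    have tan: "1 + q * (x - 1) \<le> x powr q" using tangent_at_1_le_powr[of x q] q x by simp
    show ?thesis
    proof (cases "x \<le> x0")
      case True
      then have "q * x \<le> q * x0" using q by (intro mult_left_mono) auto
      moreover have "q * x0 = (q - 1) / 2" using q by (simp add: x0_def)
      ultimately have "2 * (q * x) \<le> q - 1" by simp
      moreover have "0 \<le> a * x powr q" using a by simp
      ultimately show ?thesis unfolding eq distrib_left right_diff_distrib
        using e23 e1 powr_ge_zero[of x q] by linarith
    next
      case False
      then have "x0 powr q \<le> x powr q" using x0 q by (intro powr_mono2) auto
      then have "a / 2 * x0 powr q \<le> a * x powr q / 2" using a by simp
      then show ?thesis unfolding eq distrib_left using e(4) e1 tan by linarith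
    qed
  qed
  then show ?thesis using e by blast
qed

text \<open>Here s is the sum and D the squared difference of the singular values, so |A|^2 = (s^2 +
  D)/2 and det A = (s^2 - D)/4. The affine term is the tangent in s at s = 2 lam of the energy with
  D = 0. The quantity (s - 2 lam)^2 + D is twice the squared distance of the pair of singular values
  from (lam, lam).\<close>

lemma singular_value_coercivity:
  fixes k lam q :: real
  defines "C \<equiv> (2 * lam\<^sup>2) powr (q / 2)"
  assumes q: "1 < q" "q < 2" and k: "0 < k" and lam: "0 < lam"
    and bd: "k * lam\<^sup>2 < (1/5 + 19/50 * (q - 1)) * C"
  shows "\<exists>c>0. \<forall>s D. 0 \<le> s \<longrightarrow> 0 \<le> D \<longrightarrow> D \<le> s\<^sup>2 \<longrightarrow>
     C + k * lam\<^sup>2 + (q * C / (2 * lam) + k * lam) * (s - 2 * lam)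
       + c * min ((s - 2 * lam)\<^sup>2 + D) (((s - 2 * lam)\<^sup>2 + D) powr (q / 2))
     \<le> ((s\<^sup>2 + D) / 2) powr (q / 2) + k * (s\<^sup>2 - D) / 4"
proof -
  define B where "B = 1/5 + 19/50 * (q - 1)"
  define m where "m = q * C / (2 * lam) + k * lam"
  \<comment> \<open>Dividing by \<open>C\<close> and setting x = s/(2 lam) leaves \<open>K\<close>
    as the only parameter besides q.\<close>
  define K where "K = k * lam\<^sup>2 / C"
  have B: "B > 0" unfolding B_def using q by (intro add_pos_pos mult_pos_pos) auto
  have C: "C > 0" using lam by (simp add: C_def)
  have K: "0 < K" "K < B" using k lam C bd by (auto simp: K_def B_def field_simps)
  obtain e where e: "e > 0"
    "\<And>x. x \<ge> 0 \<Longrightarrow> e * (1 + x powr q) \<le> 2 powr (q / 2) * x powr q - 1 - q * (x - 1)"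
    using collapsed_energy_gap[OF q(1)] by blast
  have lampow: "(2 * lam) powr q = C * 2 powr (q / 2)"
  proof -
    have "C * 2 powr (q / 2) = (4 * lam\<^sup>2) powr (q / 2)"
      by (simp add: C_def powr_mult[symmetric])
    also have "4 * lam\<^sup>2 = (2 * lam) powr 2" using lam by (simp add: power2_eq_square)
    finally show ?thesis by (simp add: powr_powr)
  qed
  have sq: "(s\<^sup>2) powr (q / 2) = s powr q" if "s \<ge> 0" for s :: real
  proof -
    have "s\<^sup>2 = s powr 2" using that by simp
    then show ?thesis by (simp only: powr_powr) simp
  qed
  have \<psi>0: "C + k * lam\<^sup>2 + m * (s - 2 * lam) + k / 4 * (s - 2 * lam)\<^sup>2
     \<le> (s\<^sup>2 / 2) powr (q / 2) + k * s\<^sup>2 / 4" if s: "s \<ge> 0" for s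
  proof -
    define x where "x = s / (2 * lam)"
    have x: "x \<ge> 0" "s = 2 * lam * x" using s lam by (auto simp: x_def)
    have "s\<^sup>2 / 2 = (2 * lam\<^sup>2) * x\<^sup>2" using x by (simp add: power2_eq_square)
    then have "(s\<^sup>2 / 2) powr (q / 2) = C * x powr q"
      using x by (simp add: C_def powr_mult sq)
    moreover have "C * (1 + q * (x - 1)) \<le> C * x powr q"
      using C x q by (intro mult_left_mono tangent_at_1_le_powr) auto
    moreover have "C + k * lam\<^sup>2 + m * (s - 2 * lam) + k / 4 * (s - 2 * lam)\<^sup>2 = C * (1 + q * (x - 1)) + k * s\<^sup>2 / 4"
      using lam unfolding x(2) m_def by (simp add: field_simps power2_eq_square)
    ultimately show ?thesis by simp
  qed
  define e1 where "e1 = C * (1 - K / B) * e * min 1 (1 / (2 * lam) powr q)"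
  have e1: "e1 > 0" using C K B e lam by (auto simp: e1_def)
  have \<psi>1: "C + k * lam\<^sup>2 + m * (s - 2 * lam) + e1 * (1 + s powr q) \<le> s powr q" if s: "s \<ge> 0" for s
  proof -
    define x where "x = s / (2 * lam)"
    have x: "x \<ge> 0" "s = 2 * lam * x" using s lam by (auto simp: x_def)
    define Z where "Z = 2 powr (q / 2) * x powr q"
    have Z: "1 - q - B + (q + 2 * B) * x \<le> Z"
      using collapsed_energy_bound_max[OF q x(1)] by (simp add: B_def Z_def)
    \<comment> \<open>The tangent depends affinely on \<open>K\<close>, while \<open>Z\<close> does
      not contain it. So the case \<open>K\<close> is the convex combination, with weight
      \<open>K / B\<close>, of the extreme case \<open>B\<close> and the case 0, and only the latter
      carries the gap \<open>e\<close>.\<close>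
    have "K / B * (1 - q - B + (q + 2 * B) * x) + (1 - K / B) * (1 + q * (x - 1) + e * (1 + x powr q))
      \<le> K / B * Z + (1 - K / B) * Z"
      using Z e(2)[OF x(1)] K B by (intro add_mono mult_left_mono) (auto simp: Z_def)
    also have "\<dots> = Z" by (simp add: algebra_simps)
    finally have 0: "K / B * (1 - q - B + (q + 2 * B) * x) + (1 - K / B) * (1 + q * (x - 1) + e * (1 + x powr q)) \<le> Z" .
    have 1: "1 + K + (q + 2 * K) * (x - 1) + (1 - K / B) * e * (1 + x powr q) \<le> Z"
    proof -
      have r: "K / B * B = K" using B by simp
      have *: "r * (1 - q - B + (q + 2 * B) * x) + (1 - r) * (1 + q * (x - 1) + y)
        = 1 + r * B + (q + 2 * (r * B)) * (x - 1) + (1 - r) * y" for r y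
        by (simp add: algebra_simps)
      show ?thesis using 0 unfolding * r by (simp only: mult.assoc)
    qed
    have "C * (1 + K + (q + 2 * K) * (x - 1) + (1 - K / B) * e * (1 + x powr q)) \<le> C * Z"
      using C 1 by (intro mult_left_mono) auto
    moreover have "C * Z = s powr q"
      using x lam lampow by (simp add: Z_def powr_mult)
    moreover have "C * (1 + K + (q + 2 * K) * (x - 1)) = C + k * lam\<^sup>2 + m * (s - 2 * lam)"
      using lam C unfolding x(2) m_def K_def by (simp add: field_simps power2_eq_square)
    moreover have "e1 * (1 + s powr q) \<le> C * (1 - K / B) * e * (1 + x powr q)"
    proof -
      have xs: "x powr q = s powr q / (2 * lam) powr q" using s lam by (simp add: x_def powr_divide)
      have "min 1 (1 / (2 * lam) powr q) * (1 + s powr q) \<le> 1 + x powr q"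
      proof -
        have "min 1 (1 / (2 * lam) powr q) * s powr q \<le> 1 / (2 * lam) powr q * s powr q"
          by (intro mult_right_mono) auto
        then show ?thesis by (simp add: xs distrib_left)
      qed
      moreover have "0 \<le> C * (1 - K / B) * e" using C K B e by auto
      ultimately have "C * (1 - K / B) * e * (min 1 (1 / (2 * lam) powr q) * (1 + s powr q)) \<le> C * (1 - K / B) * e * (1 + x powr q)"
        by (rule mult_left_mono)
      then show ?thesis by (simp add: e1_def mult.assoc)
    qed
    ultimately show ?thesis by (simp add: algebra_simps)
  qed
  \<comment> \<open>Beyond \<open>R\<close>, s - 2 lam is at least s/2 and s is at least 1, so (s -
    2 lam)^2 controls \<open>s powr q\<close> up to the factor 1/4. Below \<open>R\<close> all terms
    are at most \<open>2 * R\<^sup>2\<close>, and the constant part of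
    \<open>e1 * (1 + s powr q)\<close> suffices. The two bounds in \<open>c\<close> belong to these
    two ranges.\<close>
  define R where "R = 4 * lam + 1"
  have R: "R \<ge> 1" "R > 2 * lam" using lam by (auto simp: R_def)
  define c where "c = min (k / 32) (e1 / (2 * R\<^sup>2))"
  have c: "c > 0" "c \<le> k / 32" "c \<le> e1 / (2 * R\<^sup>2)" using k e1 R by (auto simp: c_def)
  have c2: "c * (2 * R\<^sup>2) \<le> e1" using c(3) R by (simp add: field_simps)
  have "c * 2 \<le> c * (2 * R\<^sup>2)" using c R by (simp add: one_le_power)
  then have c3: "2 * c \<le> e1" using c2 by linarith
  show ?thesis
  proof (intro exI[of _ c] conjI allI impI)
    fix s D :: real assume s: "0 \<le> s" and D: "0 \<le> D" "D \<le> s\<^sup>2"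
    define z where "z = (s - 2 * lam)\<^sup>2 + D"
    define M where "M = min z (z powr (q / 2))"
    obtain t where t: "0 \<le> t" "t \<le> 1" "D = t * s\<^sup>2"
    proof (cases "s = 0")
      case True
      then show ?thesis using D that[of 0] by auto
    next
      case False
      then show ?thesis using D s that[of "D / s\<^sup>2"] by (auto simp: divide_le_eq)
    qed
    \<comment> \<open>The energy is concave in \<open>D\<close>, so only \<open>D = 0\<close> and \<open>D = s\<^sup>2\<close> matter.\<close>
    have "(1 - t) * (s\<^sup>2 / 2) powr (q / 2) + t * (s\<^sup>2) powr (q / 2)
      \<le> ((1 - t) * (s\<^sup>2 / 2) + t * s\<^sup>2) powr (q / 2)"
      using t q by (intro powr_concave_combination) auto
    also have "(1 - t) * (s\<^sup>2 / 2) + t * s\<^sup>2 = (s\<^sup>2 + D) / 2"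
      unfolding t(3) by (simp add: field_simps)
    finally have conc: "(1 - t) * (s\<^sup>2 / 2) powr (q / 2) + t * s powr q \<le> ((s\<^sup>2 + D) / 2) powr (q / 2)"
      by (simp add: sq s)
    define L where "L = C + k * lam\<^sup>2 + m * (s - 2 * lam)"
    have "(1 - t) * (L + k / 4 * (s - 2 * lam)\<^sup>2) + t * (L + e1 * (1 + s powr q))
        \<le> (1 - t) * ((s\<^sup>2 / 2) powr (q / 2) + k * s\<^sup>2 / 4) + t * s powr q"
      unfolding L_def using t s by (intro add_mono mult_left_mono \<psi>0 \<psi>1) auto
    also have "\<dots> \<le> ((s\<^sup>2 + D) / 2) powr (q / 2) + k * (s\<^sup>2 - D) / 4"
      using conc unfolding t(3) by (simp add: algebra_simps)
    finally have main: "L + ((1 - t) * (k / 4 * (s - 2 * lam)\<^sup>2) + t * (e1 * (1 + s powr q)))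
        \<le> ((s\<^sup>2 + D) / 2) powr (q / 2) + k * (s\<^sup>2 - D) / 4"
      by (simp add: algebra_simps)
    have "c * M \<le> (1 - t) * (k / 4 * (s - 2 * lam)\<^sup>2) + t * (e1 * (1 + s powr q))"
    proof (cases "s \<le> R")
      case True
      have "(s - 2 * lam)\<^sup>2 \<le> R\<^sup>2"
        using True s R lam by (intro abs_le_square_iff[THEN iffD1]) auto
      moreover have "s\<^sup>2 \<le> R\<^sup>2" using True s by (intro power_mono) auto
      ultimately have "c * ((s - 2 * lam)\<^sup>2 + s\<^sup>2) \<le> c * (2 * R\<^sup>2)"
        using c by (intro mult_left_mono) auto
      also have "\<dots> \<le> e1 * (1 + s powr q)" using c2 e1 by (simp add: distrib_left add_increasing2)
      finally have 1: "c * ((s - 2 * lam)\<^sup>2 + s\<^sup>2) \<le> e1 * (1 + s powr q)" .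
      have 2: "c * (s - 2 * lam)\<^sup>2 \<le> k / 4 * (s - 2 * lam)\<^sup>2"
        using c k by (intro mult_right_mono) auto
      have "c * M \<le> c * z" using c by (intro mult_left_mono) (auto simp: M_def)
      also have "\<dots> = (1 - t) * (c * (s - 2 * lam)\<^sup>2) + t * (c * ((s - 2 * lam)\<^sup>2 + s\<^sup>2))"
        unfolding z_def t(3) by (simp add: algebra_simps)
      also have "\<dots> \<le> (1 - t) * (k / 4 * (s - 2 * lam)\<^sup>2) + t * (e1 * (1 + s powr q))"
        using t 1 2 by (intro add_mono mult_left_mono) auto
      finally show ?thesis .
    next
      case False
      then have s1: "s \<ge> 4 * lam" "s \<ge> 1" using lam by (auto simp: R_def)
      have "(s - 2 * lam)\<^sup>2 \<le> s\<^sup>2"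
        using s1 lam by (intro abs_le_square_iff[THEN iffD1]) auto
      then have z: "0 \<le> z" "z \<le> 2 * s\<^sup>2" using D by (auto simp: z_def)
      have "M \<le> z powr (q / 2)" by (simp add: M_def)
      also have "\<dots> \<le> (2 * s\<^sup>2) powr (q / 2)" using z q by (intro powr_mono2) auto
      also have "\<dots> = 2 powr (q / 2) * s powr q" using s by (simp add: powr_mult sq)
      also have "\<dots> \<le> 2 * s powr q"
        using q powr_mono[of "q / 2" 1 2] by (intro mult_right_mono) auto
      finally have M: "M \<le> 2 * s powr q" .
      have "(s / 2)\<^sup>2 \<le> (s - 2 * lam)\<^sup>2" using s1 lam by (intro power_mono) auto
      moreover have "s powr q \<le> s\<^sup>2" using powr_mono[of q 2 s] q s1 by simp
      ultimately have "s powr q / 4 \<le> (s - 2 * lam)\<^sup>2" by (simp add: power_divide)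
      then have "k / 4 * (s powr q / 4) \<le> k / 4 * (s - 2 * lam)\<^sup>2"
        using k by (intro mult_left_mono) auto
      moreover have "2 * c * s powr q \<le> k / 16 * s powr q" using c by (intro mult_right_mono) auto
      ultimately have 2: "2 * c * s powr q \<le> k / 4 * (s - 2 * lam)\<^sup>2" by simp
      have "2 * c * s powr q \<le> e1 * s powr q" using c3 by (intro mult_right_mono) auto
      then have 1: "2 * c * s powr q \<le> e1 * (1 + s powr q)" using e1 by (simp add: distrib_left)
      have "c * M \<le> c * (2 * s powr q)" using M c by (intro mult_left_mono) auto
      also have "\<dots> = (1 - t) * (2 * c * s powr q) + t * (2 * c * s powr q)"
        by (simp add: algebra_simps)
      also have "\<dots> \<le> (1 - t) * (k / 4 * (s - 2 * lam)\<^sup>2) + t * (e1 * (1 + s powr q))"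
        using t 1 2 by (intro add_mono mult_left_mono) auto
      finally show ?thesis .
    qed
    then show "C + k * lam\<^sup>2 + (q * C / (2 * lam) + k * lam) * (s - 2 * lam)
       + c * min ((s - 2 * lam)\<^sup>2 + D) (((s - 2 * lam)\<^sup>2 + D) powr (q / 2))
     \<le> ((s\<^sup>2 + D) / 2) powr (q / 2) + k * (s\<^sup>2 - D) / 4"
      using main unfolding L_def m_def M_def z_def by linarith
  qed (use c in auto)
qed

text \<open>For X \<le> 1 the minimum at X is X itself; for X > 1 the slope of the concave power
  beyond X is at most 1. It allows the contribution of the rotation to the distance from lam 1 to be
  split off linearly.\<close>

lemma min_powr_subadditive:
  fixes X Y p :: real
  assumes "0 \<le> X" "0 \<le> Y" "0 < p" "p \<le> 1"
  shows "min (X + Y) ((X + Y) powr p) \<le> min X (X powr p) + Y"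
proof (cases "X \<le> 1")
  case True
  then have "X \<le> X powr p" using assms powr_mono'[of p 1 X] by (cases "X = 0") auto
  then show ?thesis by auto
next
  case False
  then have X: "X > 1" by simp
  have "(X + Y) powr p = X powr p * ((X + Y) / X) powr p" using X assms by (simp add: powr_divide)
  also have "\<dots> \<le> X powr p * (1 + p * ((X + Y) / X - 1))"
    using X assms by (intro mult_left_mono powr_le_tangent_at_1) auto
  also have "\<dots> = X powr p + p * (X powr p / X) * Y" using X by (simp add: field_simps)
  also have "\<dots> \<le> X powr p + Y"
  proof -
    have "X powr p \<le> X" using X assms powr_mono[of p 1 X] by simp
    then have "p * (X powr p / X) \<le> 1" using X assms by (intro mult_le_one) auto
    then have "p * (X powr p / X) * Y \<le> 1 * Y" using assms by (intro mult_right_mono) auto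
    then show ?thesis by simp
  qed
  finally have "(X + Y) powr p \<le> X powr p + Y" .
  moreover have "X powr p \<le> X" using X assms powr_mono[of p 1 X] by simp
  ultimately show ?thesis by auto
qed

section \<open>From singular values to matrices\<close>

lemma norm_mat2_sq: "(norm (A :: mat2))\<^sup>2 = (A$1$1)\<^sup>2 + (A$1$2)\<^sup>2 + (A$2$1)\<^sup>2 + (A$2$2)\<^sup>2"
  by (simp add: norm_vec_def L2_set_def sum_2 real_sqrt_pow2)

text \<open>Writing the bound for singular values in terms of the trace leaves the extra term m (s -
  tr A) \<ge> 0. It pays for the rotational part of the distance in the first estimate and, because
  m > k lam, for the curl in the second.\<close>

lemma stored_energy_lower_bound:
  fixes k lam q :: real
  defines "C \<equiv> (2 * lam\<^sup>2) powr (q / 2)"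
  defines "m \<equiv> q * C / (2 * lam) + k * lam"
  assumes q: "1 < q" "q < 2" and k: "0 < k" and lam: "0 < lam"
    and bd: "k * lam\<^sup>2 < (1/5 + 19/50 * (q - 1)) * C"
  shows "\<exists>c>0. \<forall>A::mat2. 0 < det A \<longrightarrow>
     C + k * lam\<^sup>2 + m * (trace A - 2 * lam)
       + c * min ((norm (A - lam *\<^sub>R mat 1))\<^sup>2) (norm (A - lam *\<^sub>R mat 1) powr q)
     \<le> norm A powr q + k * det A" (is ?T1)
   and "\<forall>A::mat2. 0 < det A \<longrightarrow>
     C + k * lam\<^sup>2 + m * (trace A - 2 * lam)
       + lam * k * (2 * lam\<^sup>2 * (A$1$2 - A$2$1)\<^sup>2 /
                  (3 * ((A$1$2 - A$2$1)\<^sup>2 + max (4 * lam\<^sup>2) ((trace A)\<^sup>2)) powr (3 / 2)))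
     \<le> norm A powr q + k * det A" (is ?T2)
proof -
  obtain c where c: "c > 0" and c': "\<And>s D. 0 \<le> s \<Longrightarrow> 0 \<le> D \<Longrightarrow> D \<le> s\<^sup>2 \<Longrightarrow>
     C + k * lam\<^sup>2 + m * (s - 2 * lam)
       + c * min ((s - 2 * lam)\<^sup>2 + D) (((s - 2 * lam)\<^sup>2 + D) powr (q / 2))
     \<le> ((s\<^sup>2 + D) / 2) powr (q / 2) + k * (s\<^sup>2 - D) / 4"
    using singular_value_coercivity[OF q k lam bd[unfolded C_def]] unfolding C_def m_def by blast
  have m: "m > k * lam" using q lam by (simp add: m_def C_def)
  have sq: "(s\<^sup>2) powr (q / 2) = s powr q" if "s \<ge> 0" for s :: real
  proof -
    have "s\<^sup>2 = s powr 2" using that by simp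
    then show ?thesis by (simp only: powr_powr) simp
  qed
  \<comment> \<open>Sum and squared difference of the singular values, when \<open>det A > 0\<close>.\<close>
  define s where "s A = sqrt ((trace A)\<^sup>2 + (A$1$2 - A$2$1)\<^sup>2)" for A :: mat2
  define D where "D A = (A$1$1 - A$2$2)\<^sup>2 + (A$1$2 + A$2$1)\<^sup>2" for A :: mat2
  have s0: "s A \<ge> 0" "D A \<ge> 0" for A by (auto simp: s_def D_def)
  have s2: "(s A)\<^sup>2 = (trace A)\<^sup>2 + (A$1$2 - A$2$1)\<^sup>2" for A by (simp add: s_def)
  have st: "trace A \<le> s A" for A by (simp add: s_def real_le_rsqrt)
  have tr: "trace A = A$1$1 + A$2$2" for A :: mat2 by (simp add: trace_def sum_2)
  have dt: "det A = ((s A)\<^sup>2 - D A) / 4" for A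
    unfolding s2 D_def by (simp add: tr det_2 power2_eq_square field_simps)
  have nA: "norm A powr q = (((s A)\<^sup>2 + D A) / 2) powr (q / 2)" for A
  proof -
    have "((s A)\<^sup>2 + D A) / 2 = (norm A)\<^sup>2"
      unfolding s2 D_def norm_mat2_sq by (simp add: tr power2_eq_square field_simps)
    then show ?thesis by (simp add: sq)
  qed
  \<comment> \<open>The first summand is the sum of the squared deviations of the singular values
    from lam; the second vanishes exactly when s equals the trace.\<close>
  have nAl: "(norm (A - lam *\<^sub>R mat 1))\<^sup>2 = ((s A - 2 * lam)\<^sup>2 + D A) / 2 + 2 * lam * (s A - trace A)" for A
    using s2[of A] unfolding D_def norm_mat2_sq
    by (simp add: tr power2_eq_square field_simps mat_def)
  have main: "C + k * lam\<^sup>2 + m * (trace A - 2 * lam) + m * (s A - trace A)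
       + c * min ((s A - 2 * lam)\<^sup>2 + D A) (((s A - 2 * lam)\<^sup>2 + D A) powr (q / 2))
     \<le> norm A powr q + k * det A" if "det A > 0" for A
  proof -
    have "D A \<le> (s A)\<^sup>2" using that dt[of A] by simp
    from c'[OF s0 this] show ?thesis unfolding nA dt by (simp add: algebra_simps)
  qed
  define c1 where "c1 = min c (m / (2 * lam))"
  have mp: "m > 0" using m k lam by (meson less_trans mult_pos_pos)
  have c1: "c1 > 0" "c1 \<le> c" "c1 * (2 * lam) \<le> m" using c lam mp by (auto simp: c1_def field_simps min_def)
  have "c1 * min ((norm (A - lam *\<^sub>R mat 1))\<^sup>2) (norm (A - lam *\<^sub>R mat 1) powr q)
     \<le> m * (s A - trace A) + c * min ((s A - 2 * lam)\<^sup>2 + D A) (((s A - 2 * lam)\<^sup>2 + D A) powr (q / 2))" for A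
  proof -
    define z where "z = (s A - 2 * lam)\<^sup>2 + D A"
    define Y where "Y = 2 * lam * (s A - trace A)"
    have z: "z \<ge> 0" using s0 by (simp add: z_def)
    have Y: "Y \<ge> 0" using st[of A] lam by (simp add: Y_def)
    have "min ((norm (A - lam *\<^sub>R mat 1))\<^sup>2) (norm (A - lam *\<^sub>R mat 1) powr q)
      = min (z / 2 + Y) ((z / 2 + Y) powr (q / 2))"
      unfolding sq[OF norm_ge_zero, symmetric] nAl z_def Y_def ..
    also have "\<dots> \<le> min (z / 2) ((z / 2) powr (q / 2)) + Y"
      using z Y q by (intro min_powr_subadditive) auto
    also have "\<dots> \<le> min z (z powr (q / 2)) + Y"
      using z q by (intro add_right_mono min.mono powr_mono2) auto
    finally have "c1 * min ((norm (A - lam *\<^sub>R mat 1))\<^sup>2) (norm (A - lam *\<^sub>R mat 1) powr q)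
      \<le> c1 * (min z (z powr (q / 2)) + Y)" using c1 by (intro mult_left_mono) auto
    moreover have "c1 * min z (z powr (q / 2)) \<le> c * min z (z powr (q / 2))"
      using c1 z by (intro mult_right_mono) auto
    moreover have "c1 * Y \<le> m * (s A - trace A)"
      using c1(3) st[of A] by (simp add: Y_def mult.assoc[symmetric] mult_right_mono)
    ultimately show ?thesis by (simp add: z_def distrib_left)
  qed
  note lower = this
  show ?T1
  proof (intro exI[of _ c1] conjI allI impI)
    fix A :: mat2 assume A: "0 < det A"
    show "C + k * lam\<^sup>2 + m * (trace A - 2 * lam)
       + c1 * min ((norm (A - lam *\<^sub>R mat 1))\<^sup>2) (norm (A - lam *\<^sub>R mat 1) powr q)
     \<le> norm A powr q + k * det A"
      using main[OF A] lower[of A] by linarith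
  qed (use c1 in auto)
  have curl: "2 * lam\<^sup>2 * (A$1$2 - A$2$1)\<^sup>2 /
      (3 * ((A$1$2 - A$2$1)\<^sup>2 + max (4 * lam\<^sup>2) ((trace A)\<^sup>2)) powr (3 / 2)) \<le> s A - trace A"
    if "det A > 0" for A :: mat2
  proof -
    define w where "w = (A$1$2 - A$2$1)\<^sup>2"
    define N where "N = w + max (4 * lam\<^sup>2) ((trace A)\<^sup>2)"
    have w: "w \<ge> 0" by (simp add: w_def)
    have sp: "s A > 0"
    proof -
      have "4 * det A = (s A)\<^sup>2 - D A" by (simp add: dt)
      then have "(s A)\<^sup>2 > 0" using that s0(2)[of A] by linarith
      then have "s A \<noteq> 0" by auto
      then show ?thesis using s0(1)[of A] by linarith
    qed
    have N1: "4 * lam\<^sup>2 \<le> N" "(s A)\<^sup>2 \<le> N"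
      using w s2[of A] unfolding N_def w_def[symmetric] by linarith+
    have N0: "N > 0" using N1(1) lam by (smt (verit) zero_less_power)
    \<comment> \<open>\<open>N\<close> dominates both 4 lam^2 and s^2, so its power 3/2 bounds a
      multiple of s. The squared curl w factors as (s - tr A)(s + tr A), whose second factor is
      bounded by a multiple of s as well.\<close>
    have "4 * lam\<^sup>2 * s A \<le> N * sqrt N"
      using N1 N0 s0 by (intro mult_mono) (auto simp: real_le_rsqrt)
    also have "N * sqrt N = N powr (3 / 2)"
      using N0 powr_add[of N 1 "1/2"] by (simp add: powr_half_sqrt)
    finally have den: "4 * lam\<^sup>2 * s A \<le> N powr (3 / 2)" .
    have "2 * lam\<^sup>2 * w / (3 * N powr (3 / 2)) \<le> 2 * lam\<^sup>2 * w / (3 * (4 * lam\<^sup>2 * s A))"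
      using den w sp lam N0 by (intro divide_left_mono mult_left_mono mult_pos_pos) auto
    also have "\<dots> = w / (6 * s A)" using lam by (simp add: field_simps)
    also have "\<dots> \<le> s A - trace A"
    proof -
      have "w = (s A - trace A) * (s A + trace A)" using s2[of A] by (simp add: w_def algebra_simps power2_eq_square)
      also have "\<dots> \<le> (s A - trace A) * (6 * s A)"
        using st[of A] sp by (intro mult_left_mono) auto
      finally show ?thesis using sp by (simp add: divide_le_eq)
    qed
    finally show ?thesis by (simp add: w_def N_def)
  qed
  show ?T2
  proof (intro allI impI)
    fix A :: mat2 assume A: "0 < det A"
    let ?Q = "2 * lam\<^sup>2 * (A$1$2 - A$2$1)\<^sup>2 /
      (3 * ((A$1$2 - A$2$1)\<^sup>2 + max (4 * lam\<^sup>2) ((trace A)\<^sup>2)) powr (3 / 2))"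
    have "lam * k * ?Q \<le> lam * k * (s A - trace A)"
      using curl[OF A] lam k by (intro mult_left_mono) auto
    also have "\<dots> \<le> m * (s A - trace A)"
      using m st[of A] by (intro mult_right_mono) (auto simp: mult.commute)
    also have "\<dots> \<le> m * (s A - trace A) + c * min ((s A - 2 * lam)\<^sup>2 + D A) (((s A - 2 * lam)\<^sup>2 + D A) powr (q / 2))"
      using c s0 by auto
    finally show "C + k * lam\<^sup>2 + m * (trace A - 2 * lam) + lam * k * ?Q \<le> norm A powr q + k * det A"
      using main[OF A] by linarith
  qed
qed

subsection \<open>One-dimensional Hausdorff measure\<close>

text \<open>Caratheodory's criterion. It is enough that a closed F splits every X. The part
  \<open>P n\<close> of X at distance at least 1/(n + 1) from F is separated from the part inside F,
  and what \<open>P n\<close> misses of X - F is a union of thin annuli whose total measure tends to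
  0.\<close>

lemma metric_outer_measure_space_borel:
  fixes \<mu> :: "'a::metric_space set \<Rightarrow> ennreal"
  assumes empty: "\<mu> {} = 0"
    and mono: "\<And>A B. A \<subseteq> B \<Longrightarrow> \<mu> A \<le> \<mu> B"
    and subadd: "\<And>A :: nat \<Rightarrow> 'a set. \<mu> (\<Union>i. A i) \<le> (\<Sum>i. \<mu> (A i))"
    and sep: "\<And>A B d. 0 < d \<Longrightarrow> (\<And>a b. a \<in> A \<Longrightarrow> b \<in> B \<Longrightarrow> d \<le> dist a b) \<Longrightarrow> \<mu> A + \<mu> B \<le> \<mu> (A \<union> B)"
  shows "measure_space UNIV (sets borel) \<mu>"
proof -
  have subadd2: "\<mu> (A \<union> B) \<le> \<mu> A + \<mu> B" for A B
  proof -
    have "\<mu> (\<Union>i. (if i = (0::nat) then A else if i = 1 then B else {})) \<le> (\<Sum>i. \<mu> (if i = (0::nat) then A else if i = 1 then B else {}))"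
      by (rule subadd)
    also have "(\<Union>i. (if i = (0::nat) then A else if i = 1 then B else {})) = A \<union> B"
      by (auto split: if_splits)
    also have "(\<Sum>i. \<mu> (if i = (0::nat) then A else if i = 1 then B else {}))
       = (\<Sum>i\<in>{0,1}. \<mu> (if i = (0::nat) then A else if i = 1 then B else {}))"
      by (rule suminf_finite) (auto simp: empty)
    finally show ?thesis by simp
  qed
  have closed_split: "\<mu> (X \<inter> F) + \<mu> (X - F) \<le> \<mu> X" if F: "closed F" "F \<noteq> {}" for F X :: "'a set"
  proof (cases "\<mu> X = \<infinity>")
    case False
    define d where "d x = infdist x F" for x
    define P where "P n = {x \<in> X. 1 / (real n + 1) \<le> d x}" for n
    define D where "D n = {x \<in> X. 1 / (real n + 2) \<le> d x \<and> d x < 1 / (real n + 1)}" for n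
    have dpos: "d x > 0" if "x \<notin> F" for x
      using that F in_closed_iff_infdist_zero[of F x] infdist_nonneg[of x F] unfolding d_def by linarith
    have far: "\<mu> (X \<inter> F) + \<mu> (P n) \<le> \<mu> X" for n
    proof -
      have "\<mu> (X \<inter> F) + \<mu> (P n) \<le> \<mu> ((X \<inter> F) \<union> P n)"
      proof (rule sep[of "1 / (real n + 1)"])
        fix a b assume "a \<in> X \<inter> F" "b \<in> P n"
        then show "1 / (real n + 1) \<le> dist a b"
          using infdist_le[of a F b] by (auto simp: P_def d_def dist_commute)
      qed auto
      also have "\<dots> \<le> \<mu> X" by (rule mono) (auto simp: P_def)
      finally show ?thesis .
    qed
    have cover: "X - F \<subseteq> P N \<union> (\<Union>k. D (k + N))" for N
    proof
      fix x assume x: "x \<in> X - F"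
      show "x \<in> P N \<union> (\<Union>k. D (k + N))"
      proof (cases "x \<in> P N")
        case nP: False
        have dx: "d x > 0" using x dpos by auto
        define n where "n = (LEAST m. 1 / (real m + 2) \<le> d x)"
        obtain m0 :: nat where "1 / d x < real m0" using reals_Archimedean2 by blast
        then have "1 / (real m0 + 2) \<le> d x" using dx by (simp add: field_simps)
        then have n1: "1 / (real n + 2) \<le> d x" unfolding n_def by (rule LeastI)
        have lt: "d x < 1 / (real N + 1)" using nP x by (auto simp: P_def)
        have n2: "d x < 1 / (real n + 1)"
        proof (cases n)
          case 0
          have "1 / (real N + 1) \<le> 1" by simp
          then have "d x < 1" using lt by linarith
          then show ?thesis using 0 by simp
        next
          case (Suc j)
          then have "\<not> 1 / (real j + 2) \<le> d x"
            using not_less_Least[of j "\<lambda>m. 1 / (real m + 2) \<le> d x"] by (simp add: n_def)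
          then show ?thesis using Suc by (simp add: algebra_simps)
        qed
        have "1 / (real n + 2) < 1 / (real N + 1)" using n1 lt by linarith
        then have "real N + 1 < real n + 2" by (simp add: field_simps)
        then have "N \<le> n" by linarith
        then have "x \<in> D ((n - N) + N)" using x n1 n2 by (simp add: D_def)
        then show ?thesis by blast
      qed auto
    qed
    \<comment> \<open>Neighbouring annuli touch, but those with indices of equal parity have
      positive distance, so their measures add up. The first step is separate because the radius 1/r
      requires a positive index.\<close>
    have annuli: "(\<Sum>k<K. \<mu> (D (2 * k + p))) \<le> \<mu> (\<Union>k<K. D (2 * k + p))" for K p
    proof (induction K)
      case (Suc K)
      show ?case
      proof (cases "K = 0")
        case False
        define r where "r = real (2 * K + p)"
        have r: "r > 0" using False by (simp add: r_def)
        have "\<mu> (\<Union>k<K. D (2 * k + p)) + \<mu> (D (2 * K + p)) \<le> \<mu> ((\<Union>k<K. D (2 * k + p)) \<union> D (2 * K + p))"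
        proof (rule sep[of "1 / r - 1 / (r + 1)"])
          show "0 < 1 / r - 1 / (r + 1)" using r frac_less2[of 1 1 r "r + 1"] by simp
          fix a b assume a: "a \<in> (\<Union>k<K. D (2 * k + p))" and b: "b \<in> D (2 * K + p)"
          obtain k where k: "k < K" "a \<in> D (2 * k + p)" using a by auto
          have "1 / r \<le> 1 / (real (2 * k + p) + 2)"
          proof (rule divide_left_mono)
            have "real k + 1 \<le> real K" using k by linarith
            then show "real (2 * k + p) + 2 \<le> r" by (simp add: r_def)
          qed (use r in auto)
          then have "1 / r \<le> d a" using k(2) by (simp add: D_def)
          moreover have "d b < 1 / (r + 1)" using b by (simp add: D_def r_def)
          moreover have "d a \<le> d b + dist a b"
            unfolding d_def by (rule infdist_triangle)
          ultimately show "1 / r - 1 / (r + 1) \<le> dist a b" by linarith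
        qed
        also have "(\<Union>k<K. D (2 * k + p)) \<union> D (2 * K + p) = (\<Union>k<Suc K. D (2 * k + p))"
          by (auto simp: lessThan_Suc)
        finally show ?thesis
          unfolding sum.lessThan_Suc by (rule order.trans[OF add_right_mono[OF Suc.IH]])
      qed (simp add: lessThan_Suc)
    qed simp
    have bound: "(\<Sum>k<K. \<mu> (D (2 * k + p))) \<le> \<mu> X" for K p
      by (rule order.trans[OF annuli mono]) (auto simp: D_def)
    define S where "S = (\<Sum>n. \<mu> (D n))"
    \<comment> \<open>Even and odd annuli contribute at most \<mu> X each; hence the series
      converges and its tails become small.\<close>
    have "S \<le> 2 * \<mu> X"
      unfolding S_def suminf_eq_SUP
    proof (rule SUP_least)
      fix m :: nat
      have "(\<Sum>n<m. \<mu> (D n)) \<le> (\<Sum>n<2 * m. \<mu> (D n))" by (rule sum_mono2) auto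
      also have "\<dots> = (\<Sum>k<m. \<mu> (D (2 * k + 0))) + (\<Sum>k<m. \<mu> (D (2 * k + 1)))"
        by (induction m) (auto simp: algebra_simps)
      also have "\<dots> \<le> \<mu> X + \<mu> X" by (intro add_mono bound)
      finally show "(\<Sum>n<m. \<mu> (D n)) \<le> 2 * \<mu> X" by (simp add: mult_2)
    qed
    then have Sfin: "S < \<infinity>" using False by (simp add: ennreal_mult_less_top less_top order.strict_trans1)
    show ?thesis
    proof (rule ennreal_le_epsilon)
      fix e :: real assume e: "0 < e"
      have "\<exists>N. S < (\<Sum>n<N. \<mu> (D n)) + ennreal e"
      proof (rule ccontr)
        assume "\<not> ?thesis"
        then have "(\<Sum>n<N. \<mu> (D n)) + ennreal e \<le> S" for N by (simp add: not_less)
        then have "(SUP N. (\<Sum>n<N. \<mu> (D n)) + ennreal e) \<le> S" by (intro SUP_least)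
        then have "S + ennreal e \<le> S"
          unfolding S_def suminf_eq_SUP by (simp add: ennreal_SUP_add_left)
        then show False using Sfin e
          by (cases S) (auto simp: ennreal_plus[symmetric] simp del: ennreal_plus)
      qed
      then obtain N where N: "S < (\<Sum>n<N. \<mu> (D n)) + ennreal e" by blast
      have "S = (\<Sum>k. \<mu> (D (k + N))) + (\<Sum>n<N. \<mu> (D n))"
        unfolding S_def by (rule suminf_offset) auto
      then have "(\<Sum>n<N. \<mu> (D n)) + (\<Sum>k. \<mu> (D (k + N))) < (\<Sum>n<N. \<mu> (D n)) + ennreal e"
        using N by (simp add: add.commute)
      then have tail: "(\<Sum>k. \<mu> (D (k + N))) \<le> ennreal e"
        using ennreal_add_left_cancel_less by (metis less_imp_le)
      have "\<mu> (X - F) \<le> \<mu> (P N \<union> (\<Union>k. D (k + N)))" by (rule mono[OF cover])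
      also have "\<dots> \<le> \<mu> (P N) + \<mu> (\<Union>k. D (k + N))" by (rule subadd2)
      also have "\<dots> \<le> \<mu> (P N) + ennreal e"
        by (intro add_left_mono order.trans[OF subadd tail])
      finally have "\<mu> (X \<inter> F) + \<mu> (X - F) \<le> \<mu> (X \<inter> F) + (\<mu> (P N) + ennreal e)"
        by (rule add_left_mono)
      also have "\<dots> \<le> \<mu> X + ennreal e"
        unfolding add.assoc[symmetric] by (intro add_right_mono far)
      finally show "\<mu> (X \<inter> F) + \<mu> (X - F) \<le> \<mu> X + ennreal e" .
    qed
  qed simp
  interpret P: sigma_algebra UNIV "Pow UNIV :: 'a set set" by (rule sigma_algebra_Pow)
  define L where "L = lambda_system UNIV (Pow UNIV) \<mu>"
  have "outer_measure_space (Pow UNIV) \<mu>"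
    unfolding outer_measure_space_def positive_def increasing_def countably_subadditive_def
    using empty mono subadd by auto
  then have L: "measure_space UNIV L \<mu>" unfolding L_def by (rule P.caratheodory_lemma)
  then have saL: "sigma_algebra UNIV L" by (simp add: measure_space_def)
  interpret L: sigma_algebra UNIV L by (rule saL)
  have "F \<in> L" if "closed F" for F
  proof (cases "F = {}")
    case False
    have "\<mu> (X \<inter> F) + \<mu> (X - F) = \<mu> X" for X
    proof (rule antisym)
      have "X = (X \<inter> F) \<union> (X - F)" by blast
      then show "\<mu> X \<le> \<mu> (X \<inter> F) + \<mu> (X - F)" using subadd2 by metis
    qed (rule closed_split[OF that False])
    then show ?thesis unfolding L_def P.lambda_system_eq by simp
  qed simp
  then have "sets borel \<subseteq> L"
    unfolding borel_eq_closed using L.sigma_sets_subset[of "Collect closed"] by auto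
  moreover have "sigma_algebra UNIV (sets (borel :: 'a measure))"
    using sets.sigma_algebra_axioms[of "borel :: 'a measure"] by simp
  ultimately show ?thesis using measure_down[OF L] by blast
qed

section \<open>Coverings by sets of bounded diameter, and arc length as a measure\<close>

lemma hausdorff1_pre_le:
  assumes "A \<subseteq> (\<Union>i. C i)" "\<And>i. bounded (C i)" "\<And>i. diameter (C i) \<le> \<delta>"
  shows "hausdorff1_pre \<delta> A \<le> (\<Sum>i. ennreal (diameter (C i)))"
  unfolding hausdorff1_pre_def using assms by (intro INF_lower) auto

lemma hausdorff1_pre_antimono: "\<delta> \<le> \<delta>' \<Longrightarrow> hausdorff1_pre \<delta>' A \<le> hausdorff1_pre \<delta> A"
  unfolding hausdorff1_pre_def by (intro INF_superset_mono) (auto intro: order_trans)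

lemma hausdorff1_pre_empty: "0 \<le> \<delta> \<Longrightarrow> hausdorff1_pre \<delta> {} = 0"
  using hausdorff1_pre_le[of "{}" "\<lambda>_. {}" \<delta>] by simp

lemma hausdorff1_pre_mono: "A \<subseteq> B \<Longrightarrow> hausdorff1_pre \<delta> A \<le> hausdorff1_pre \<delta> B"
  unfolding hausdorff1_pre_def by (intro INF_superset_mono) auto

lemma hausdorff1_pre_subadditive:
  "hausdorff1_pre \<delta> (\<Union>n. A n) \<le> (\<Sum>n. hausdorff1_pre \<delta> (A n))" for A :: "nat \<Rightarrow> plane set"
proof (cases "(\<Sum>n. hausdorff1_pre \<delta> (A n)) = \<infinity>")
  case False
  have fin: "hausdorff1_pre \<delta> (A n) < \<infinity>" for n
    using False ennreal_suminf_lessD[of "\<lambda>n. hausdorff1_pre \<delta> (A n)" \<infinity> n] by (simp add: less_top)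
  show ?thesis
  proof (rule ennreal_le_epsilon)
    fix e :: real assume e: "0 < e"
    have "\<exists>C. A n \<subseteq> (\<Union>i. C i) \<and> (\<forall>i. bounded (C i) \<and> diameter (C i) \<le> \<delta>) \<and>
       (\<Sum>i. ennreal (diameter (C i))) < hausdorff1_pre \<delta> (A n) + ennreal (e * (1/2) ^ Suc n)" for n
    proof -
      have "hausdorff1_pre \<delta> (A n) < hausdorff1_pre \<delta> (A n) + ennreal (e * (1/2) ^ Suc n)"
        using fin[of n] e
        by (cases "hausdorff1_pre \<delta> (A n)") (auto simp: ennreal_plus[symmetric] simp del: ennreal_plus intro!: ennreal_lessI add_nonneg_pos)
      then show ?thesis unfolding hausdorff1_pre_def[of \<delta> "A n"] INF_less_iff by blast
    qed
    then obtain C where C: "\<And>n. A n \<subseteq> (\<Union>i. C n i)" "\<And>n i. bounded (C n i)" "\<And>n i. diameter (C n i) \<le> \<delta>"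
      "\<And>n. (\<Sum>i. ennreal (diameter (C n i))) < hausdorff1_pre \<delta> (A n) + ennreal (e * (1/2) ^ Suc n)"
      by metis
    define E where "E k = case_prod C (prod_decode k)" for k
    have "(\<Union>n. A n) \<subseteq> (\<Union>k. E k)"
    proof
      fix x assume "x \<in> (\<Union>n. A n)"
      then obtain n i where "x \<in> C n i" using C(1) by blast
      then have "x \<in> E (prod_encode (n, i))" by (simp add: E_def)
      then show "x \<in> (\<Union>k. E k)" by blast
    qed
    then have "hausdorff1_pre \<delta> (\<Union>n. A n) \<le> (\<Sum>k. ennreal (diameter (E k)))"
      by (rule hausdorff1_pre_le) (auto simp: E_def C split: prod.split)
    also have "\<dots> = (\<Sum>k. (\<lambda>(n, i). ennreal (diameter (C n i))) (prod_decode k))"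
      by (intro suminf_cong) (simp add: E_def split: prod.split)
    also have "\<dots> = (\<Sum>n. \<Sum>i. ennreal (diameter (C n i)))"
      by (rule suminf_ennreal_2dimen) auto
    also have "\<dots> \<le> (\<Sum>n. hausdorff1_pre \<delta> (A n) + ennreal (e * (1/2) ^ Suc n))"
      using C(4) by (intro suminf_le) (auto intro: less_imp_le)
    also have "\<dots> = (\<Sum>n. hausdorff1_pre \<delta> (A n)) + (\<Sum>n. ennreal (e * (1/2) ^ Suc n))"
      by (intro suminf_add[symmetric]) auto
    also have "(\<Sum>n. ennreal (e * (1/2) ^ Suc n)) = ennreal e"
    proof -
      have "(\<lambda>n. e * (1/2) ^ Suc n) sums (e * 1)"
        by (intro sums_mult power_half_series)
      then show ?thesis using e by (intro suminf_ennreal_eq) auto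
    qed
    finally show "hausdorff1_pre \<delta> (\<Union>n. A n) \<le> (\<Sum>n. hausdorff1_pre \<delta> (A n)) + ennreal e" .
  qed
qed simp

text \<open>No set of diameter at most \<delta> meets both A and B, so a covering of the union
  splits into coverings of the two parts.\<close>

lemma hausdorff1_pre_separated:
  assumes "\<And>a b. a \<in> A \<Longrightarrow> b \<in> B \<Longrightarrow> \<delta> < dist a b" "0 \<le> \<delta>"
  shows "hausdorff1_pre \<delta> A + hausdorff1_pre \<delta> B \<le> hausdorff1_pre \<delta> (A \<union> B)"
  unfolding hausdorff1_pre_def[of \<delta> "A \<union> B"]
proof (rule INF_greatest, clarify)
  fix C :: "nat \<Rightarrow> plane set"
  assume C: "A \<union> B \<subseteq> (\<Union>i. C i)" "\<forall>i. bounded (C i) \<and> diameter (C i) \<le> \<delta>"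
  define CA where "CA i = (if C i \<inter> A = {} then {} else C i)" for i
  define CB where "CB i = (if C i \<inter> A = {} then C i else {})" for i
  have "C i \<inter> B = {}" if i: "C i \<inter> A \<noteq> {}" for i
  proof (rule ccontr)
    assume "C i \<inter> B \<noteq> {}"
    then obtain a b where ab: "a \<in> A" "a \<in> C i" "b \<in> B" "b \<in> C i" using i by blast
    then have "dist a b \<le> diameter (C i)" using C by (intro diameter_bounded_bound) auto
    then show False using assms(1)[of a b] ab C(2) by (meson less_le_trans not_less order_trans)
  qed
  then have "hausdorff1_pre \<delta> B \<le> (\<Sum>i. ennreal (diameter (CB i)))"
    using C assms(2) by (intro hausdorff1_pre_le) (auto simp: CB_def, blast)
  moreover have "hausdorff1_pre \<delta> A \<le> (\<Sum>i. ennreal (diameter (CA i)))"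
    using C assms(2) by (intro hausdorff1_pre_le) (auto simp: CA_def, blast)
  ultimately have "hausdorff1_pre \<delta> A + hausdorff1_pre \<delta> B \<le> (\<Sum>i. ennreal (diameter (CA i))) + (\<Sum>i. ennreal (diameter (CB i)))"
    by (intro add_mono)
  also have "\<dots> = (\<Sum>i. ennreal (diameter (CA i)) + ennreal (diameter (CB i)))"
    by (intro suminf_add) auto
  also have "\<dots> = (\<Sum>i. ennreal (diameter (C i)))"
    by (intro suminf_cong) (auto simp: CA_def CB_def)
  finally show "hausdorff1_pre \<delta> A + hausdorff1_pre \<delta> B \<le> (\<Sum>i. ennreal (diameter (C i)))" .
qed

lemma hausdorff1_pre_le_outer: "0 < \<delta> \<Longrightarrow> hausdorff1_pre \<delta> A \<le> hausdorff1_outer A"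
  unfolding hausdorff1_outer_def by (intro SUP_upper) auto

text \<open>By default \<open>measure_of\<close> yields the zero measure when its set function is
  not a measure on the generated algebra; this excludes that case for
  \<open>hausdorff1\<close>.\<close>

lemma measure_space_hausdorff1: "measure_space UNIV (sets borel) hausdorff1_outer"
proof (rule metric_outer_measure_space_borel)
  show "hausdorff1_outer {} = 0"
    unfolding hausdorff1_outer_def by (simp add: hausdorff1_pre_empty)
  show "hausdorff1_outer A \<le> hausdorff1_outer B" if "A \<subseteq> B" for A B
    unfolding hausdorff1_outer_def by (intro SUP_mono') (rule hausdorff1_pre_mono[OF that])
  show "hausdorff1_outer (\<Union>i. A i) \<le> (\<Sum>i. hausdorff1_outer (A i))" for A :: "nat \<Rightarrow> plane set"
    unfolding hausdorff1_outer_def[of "\<Union>i. A i"]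
  proof (rule SUP_least)
    fix \<delta> :: real assume "\<delta> \<in> {0<..}"
    then show "hausdorff1_pre \<delta> (\<Union>i. A i) \<le> (\<Sum>i. hausdorff1_outer (A i))"
      by (intro order.trans[OF hausdorff1_pre_subadditive] suminf_le hausdorff1_pre_le_outer) auto
  qed
  fix A B :: "plane set" and d :: real
  assume d: "0 < d" "\<And>a b. a \<in> A \<Longrightarrow> b \<in> B \<Longrightarrow> d \<le> dist a b"
  \<comment> \<open>The two suprema over scales are taken independently, so each pair of scales is
    refined to a common one below the separation d.\<close>
  have *: "hausdorff1_pre \<delta>1 A + hausdorff1_pre \<delta>2 B \<le> hausdorff1_outer (A \<union> B)"
    if "\<delta>1 > 0" "\<delta>2 > 0" for \<delta>1 \<delta>2
  proof -
    define \<delta> where "\<delta> = min (d / 2) (min \<delta>1 \<delta>2)"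
    have \<delta>: "0 < \<delta>" "\<delta> < d" "\<delta> \<le> \<delta>1" "\<delta> \<le> \<delta>2" using that d by (auto simp: \<delta>_def)
    have "hausdorff1_pre \<delta>1 A + hausdorff1_pre \<delta>2 B \<le> hausdorff1_pre \<delta> A + hausdorff1_pre \<delta> B"
      by (intro add_mono hausdorff1_pre_antimono \<delta>)
    also have "\<dots> \<le> hausdorff1_pre \<delta> (A \<union> B)"
      using d(2) \<delta> by (intro hausdorff1_pre_separated) (auto intro: less_le_trans)
    also have "\<dots> \<le> hausdorff1_outer (A \<union> B)" by (rule hausdorff1_pre_le_outer[OF \<delta>(1)])
    finally show ?thesis .
  qed
  have ne: "{0::real<..} \<noteq> {}" by (metis greaterThan_iff empty_iff zero_less_one)
  have "hausdorff1_outer A + hausdorff1_outer B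
    = (SUP \<delta>1\<in>{0<..}. SUP \<delta>2\<in>{0<..}. hausdorff1_pre \<delta>1 A + hausdorff1_pre \<delta>2 B)"
    unfolding hausdorff1_outer_def
    by (subst ennreal_SUP_add_left[OF ne, symmetric], subst ennreal_SUP_add_right[OF ne, symmetric]) simp
  also have "\<dots> \<le> hausdorff1_outer (A \<union> B)" using * by (intro SUP_least) auto
  finally show "hausdorff1_outer A + hausdorff1_outer B \<le> hausdorff1_outer (A \<union> B)" .
qed

lemma sets_hausdorff1 [measurable_cong, simp]: "sets hausdorff1 = sets borel"
  unfolding hausdorff1_def using sets.sigma_sets_eq[of "borel :: plane measure"] by simp

lemma space_hausdorff1 [simp]: "space hausdorff1 = UNIV"
  unfolding hausdorff1_def by simp

lemma emeasure_hausdorff1: "A \<in> sets borel \<Longrightarrow> emeasure hausdorff1 A = hausdorff1_outer A"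
  unfolding hausdorff1_def using measure_space_hausdorff1
  by (intro emeasure_measure_of_sigma) (auto simp: measure_space_def)

text \<open>Projections do not increase distances. The factor 2 arises because each covering set is
  enclosed in an interval centred at the projection of one of its points, with the full diameter on
  either side.\<close>

lemma emeasure_projection_le_hausdorff1:
  fixes A :: "plane set"
  assumes "(\<lambda>x. x $ j) ` A \<in> sets borel"
  shows "emeasure lborel ((\<lambda>x. x $ j) ` A) \<le> 2 * hausdorff1_outer A"
proof -
  have "emeasure lborel ((\<lambda>x. x $ j) ` A) \<le> 2 * (\<Sum>i. ennreal (diameter (C i)))"
    if C: "A \<subseteq> (\<Union>i. C i)" "\<And>i. bounded (C i)" for C :: "nat \<Rightarrow> plane set"
  proof -
    define p where "p i = (SOME x. x \<in> C i)" for i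
    define I where "I i = (if C i = {} then {} else {p i $ j - diameter (C i) .. p i $ j + diameter (C i)})" for i
    have "(\<lambda>x. x $ j) ` A \<subseteq> (\<Union>i. I i)"
    proof clarify
      fix x assume "x \<in> A"
      then obtain i where i: "x \<in> C i" using C by blast
      then have p: "p i \<in> C i" unfolding p_def by (rule someI)
      have "\<bar>x $ j - p i $ j\<bar> \<le> norm (x - p i)" using component_le_norm_cart[of "x - p i" j] by simp
      also have "\<dots> \<le> diameter (C i)" using diameter_bounded_bound[OF C(2) i p] by (simp add: dist_norm)
      finally have "x $ j \<in> I i" using i by (auto simp: I_def)
      then show "x $ j \<in> (\<Union>i. I i)" by blast
    qed
    then have "emeasure lborel ((\<lambda>x. x $ j) ` A) \<le> emeasure lborel (\<Union>i. I i)"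
      by (intro emeasure_mono) (auto simp: I_def)
    also have "\<dots> \<le> (\<Sum>i. emeasure lborel (I i))"
      by (intro emeasure_subadditive_countably) (auto simp: I_def)
    also have "\<dots> \<le> (\<Sum>i. 2 * ennreal (diameter (C i)))"
    proof (intro suminf_le)
      show "emeasure lborel (I i) \<le> 2 * ennreal (diameter (C i))" for i
        using diameter_ge_0[OF C(2)[of i]] by (auto simp: I_def ennreal_mult' simp flip: ennreal_numeral)
    qed auto
    finally show ?thesis by simp
  qed
  then have "emeasure lborel ((\<lambda>x. x $ j) ` A) / 2 \<le> hausdorff1_pre 1 A"
    unfolding hausdorff1_pre_def by (intro INF_greatest divide_le_posI_ennreal) (auto simp: mult.commute)
  then have "2 * (emeasure lborel ((\<lambda>x. x $ j) ` A) / 2) \<le> 2 * hausdorff1_pre 1 A"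
    by (rule mult_left_mono) simp
  moreover have "2 * (x / 2) = x" for x :: ennreal
    using mult_divide_eq_ennreal[of 2 x] by (simp add: ennreal_times_divide mult.commute)
  ultimately have "emeasure lborel ((\<lambda>x. x $ j) ` A) \<le> 2 * hausdorff1_pre 1 A" by simp
  also have "\<dots> \<le> 2 * hausdorff1_outer A"
    by (intro mult_left_mono hausdorff1_pre_le_outer) auto
  finally show ?thesis .
qed

lemma hausdorff1_outer_lipschitz_image:
  fixes f :: "real \<Rightarrow> plane"
  assumes f: "L-lipschitz_on {a..b} f" and ab: "a \<le> b"
  shows "hausdorff1_outer (f ` {a..b}) \<le> ennreal (L * (b - a))"
  unfolding hausdorff1_outer_def
proof (rule SUP_least)
  fix \<delta> :: real assume "\<delta> \<in> {0<..}"
  then have \<delta>: "\<delta> > 0" by simp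
  have L: "L \<ge> 0" using f by (rule lipschitz_on_nonneg)
  obtain N :: nat where "L * (b - a) / \<delta> < real N" using reals_Archimedean2 by blast
  moreover have "0 \<le> L * (b - a) / \<delta>" using L ab \<delta> by auto
  ultimately have N: "real N > 0" by linarith
  then have N2: "L * (b - a) / real N \<le> \<delta>"
    using \<delta> \<open>L * (b - a) / \<delta> < real N\<close> by (simp add: divide_less_eq divide_le_eq mult.commute)
  define h where "h = (b - a) / real N"
  have h: "h \<ge> 0" "h * real N = b - a" using ab N by (auto simp: h_def)
  define J where "J i = (if i < N then {a + real i * h .. a + real (Suc i) * h} else {})" for i
  have J: "J i \<subseteq> {a..b}" for i
  proof (cases "i < N")
    case True
    then have "real (Suc i) * h \<le> real N * h" using h by (intro mult_right_mono) auto
    then have "a + real (Suc i) * h \<le> b" using h by (simp add: mult.commute)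
    moreover have "a \<le> a + real i * h" using h by simp
    ultimately show ?thesis using True by (auto simp: J_def)
  qed (simp add: J_def)
  have diam: "dist x y \<le> L * h" if xy: "x \<in> f ` J i" "y \<in> f ` J i" for x y i
  proof -
    obtain s t where st: "x = f s" "y = f t" "s \<in> J i" "t \<in> J i" using xy by blast
    have "dist x y \<le> L * dist s t"
      unfolding st(1,2) using st J[of i] by (intro lipschitz_onD[OF f]) blast+
    also have "dist s t \<le> h"
      using st(3,4) by (auto simp: J_def dist_real_def algebra_simps split: if_splits)
    finally show ?thesis using L by (simp add: mult_left_mono)
  qed
  have d: "diameter (f ` J i) \<le> (if i < N then L * h else 0)" for i
  proof (cases "i < N")
    case True
    then show ?thesis using diam[of _ i] L h by (auto intro!: diameter_le simp: dist_norm)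
  qed (simp add: J_def)
  have cov: "f ` {a..b} \<subseteq> (\<Union>i. f ` J i)"
  proof clarify
    fix t assume t: "t \<in> {a..b}"
    show "f t \<in> (\<Union>i. f ` J i)"
    \<comment> \<open>At the right endpoint the rounding formula would give the index
      \<open>N\<close>, one too many, and for a degenerate interval it divides by zero; both cases
      use the last piece.\<close>
    proof (cases "t = b \<or> h = 0")
      case True
      then have "t \<in> J (N - 1)"
        using N h t by (auto simp: J_def of_nat_diff algebra_simps)
      then show ?thesis by blast
    next
      case False
      define i where "i = nat \<lfloor>(t - a) / h\<rfloor>"
      have hp: "h > 0" using False h by auto
      have nn: "0 \<le> (t - a) / h" using t hp by auto
      then have i1: "real i \<le> (t - a) / h" unfolding i_def by (simp add: of_nat_nat)
      have i2: "(t - a) / h < real i + 1" unfolding i_def using nn by (simp add: of_nat_nat)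
      have "(t - a) / h < real N" using False t h hp by (simp add: field_simps)
      then have "i < N" using i1 by linarith
      moreover have "real i * h \<le> t - a" "t - a \<le> real (Suc i) * h"
        using i1 i2 hp by (auto simp: field_simps)
      ultimately have "t \<in> J i" by (auto simp: J_def)
      then show ?thesis by blast
    qed
  qed
  have "hausdorff1_pre \<delta> (f ` {a..b}) \<le> (\<Sum>i. ennreal (diameter (f ` J i)))"
  proof (rule hausdorff1_pre_le[OF cov])
    show "bounded (f ` J i)" for i
      unfolding bounded_two_points using diam by blast
    show "diameter (f ` J i) \<le> \<delta>" for i
      using d[of i] N2 \<delta> by (auto simp: h_def split: if_splits)
  qed
  also have "\<dots> = (\<Sum>i<N. ennreal (diameter (f ` J i)))"
    by (rule suminf_finite) (auto simp: J_def)
  also have "\<dots> \<le> (\<Sum>i<N. ennreal (L * h))"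
    using d by (intro sum_mono ennreal_leI) (metis lessThan_iff)
  also have "\<dots> = ennreal (L * (b - a))"
    using L h by (simp add: ennreal_of_nat_eq_real_of_nat ennreal_mult'[symmetric] mult_ac)
  finally show "hausdorff1_pre \<delta> (f ` {a..b}) \<le> ennreal (L * (b - a))" .
qed

subsection \<open>The boundary estimate for integrals of partial derivatives\<close>

text \<open>Fubini's theorem will be applied on lines parallel to the j-axis, for either j; the
  coordinate along the line is therefore made the second factor of the product.\<close>

lemma lborel_plane_eq_distr:
  fixes i j :: 2
  assumes "i \<noteq> j"
  shows "(lborel :: plane measure) =
    distr (lborel \<Otimes>\<^sub>M lborel) borel (\<lambda>(t, s). t *\<^sub>R axis i 1 + s *\<^sub>R axis j 1)"
proof (rule lborel_eqI)
  define \<Phi> :: "real \<times> real \<Rightarrow> plane" where "\<Phi> = (\<lambda>(t, s). t *\<^sub>R axis i 1 + s *\<^sub>R axis j 1)"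
  have K: "k = i \<or> k = j" for k :: 2
    using assms exhaust_2[of i] exhaust_2[of j] exhaust_2[of k] by auto
  then have U: "UNIV = {i, j}" by auto
  have all2: "(\<forall>k. P k) \<longleftrightarrow> P i \<and> P j" for P using K by metis
  have comp: "\<Phi> (t, s) $ i = t" "\<Phi> (t, s) $ j = s" for t s
    using assms by (auto simp: \<Phi>_def axis_def)
  have meas: "\<Phi> \<in> borel_measurable (lborel \<Otimes>\<^sub>M lborel)"
    unfolding \<Phi>_def lborel_prod by (simp add: case_prod_beta' borel_measurable_continuous_onI continuous_intros)
  fix l u :: plane assume lu: "\<And>b. b \<in> Basis \<Longrightarrow> l \<bullet> b \<le> u \<bullet> b"
  have le: "l $ k \<le> u $ k" for k
    using lu[of "axis k 1"] by (simp add: inner_axis)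
  have bx: "x \<in> box l u \<longleftrightarrow> l $ i < x $ i \<and> x $ i < u $ i \<and> l $ j < x $ j \<and> x $ j < u $ j" for x
    unfolding mem_box_cart all2 by blast
  have "emeasure (distr (lborel \<Otimes>\<^sub>M lborel) borel \<Phi>) (box l u)
    = emeasure (lborel \<Otimes>\<^sub>M lborel) ({l $ i<..<u $ i} \<times> {l $ j<..<u $ j})"
  proof (subst emeasure_distr[OF meas])
    show "emeasure (lborel \<Otimes>\<^sub>M lborel) (\<Phi> -` box l u \<inter> space (lborel \<Otimes>\<^sub>M lborel))
      = emeasure (lborel \<Otimes>\<^sub>M lborel) ({l $ i<..<u $ i} \<times> {l $ j<..<u $ j})"
      by (rule arg_cong[of _ _ "emeasure _"]) (auto simp: bx comp space_pair_measure)
  qed simp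
  also have "\<dots> = ennreal ((u $ i - l $ i) * (u $ j - l $ j))"
    using le by (subst lborel.emeasure_pair_measure_Times) (auto simp: ennreal_mult)
  also have "(u $ i - l $ i) * (u $ j - l $ j) = (\<Prod>b\<in>Basis. (u - l) \<bullet> b)"
  proof -
    have B: "(Basis :: plane set) = {axis i 1, axis j 1}"
      unfolding Basis_vec_def using U by auto
    show ?thesis unfolding B using assms by (simp add: inner_axis axis_eq_axis)
  qed
  finally show "emeasure (distr (lborel \<Otimes>\<^sub>M lborel) borel (\<lambda>(t, s). t *\<^sub>R axis i 1 + s *\<^sub>R axis j 1)) (box l u)
    = (\<Prod>b\<in>Basis. (u - l) \<bullet> b)" by (simp add: \<Phi>_def)
qed simp

section \<open>Slices: open sets on a line and the fundamental theorem of calculus\<close>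

lemma component_of_open_bounded_real:
  fixes U :: "real set"
  assumes U: "open U" "bounded U" and c: "c \<in> components U"
  shows "c = {Inf c<..<Sup c}" "Inf c < Sup c" "Inf c \<in> frontier U" "Sup c \<in> frontier U"
proof -
  have ne: "c \<noteq> {}" using c by (rule in_components_nonempty)
  have oc: "open c" using U(1) c by (rule open_components)
  have cU: "c \<subseteq> U" using c by (rule in_components_subset)
  have bd: "bounded c" using U(2) cU by (rule bounded_subset)
  then have bdd: "bdd_above c" "bdd_below c" by (auto simp: bounded_imp_bdd_above bounded_imp_bdd_below)
  have conn: "connected c" using c by (rule in_components_connected)
  have lt: "Inf c < x \<and> x < Sup c" if "x \<in> c" for x
  proof -
    obtain e where e: "e > 0" "ball x e \<subseteq> c" using oc \<open>x \<in> c\<close> by (rule openE)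
    have "x - e / 2 \<in> c" "x + e / 2 \<in> c" using e by (auto simp: dist_real_def intro!: subsetD[OF e(2)])
    then have "Inf c \<le> x - e / 2" "x + e / 2 \<le> Sup c" using bdd by (auto intro: cInf_lower cSup_upper)
    then show ?thesis using e by linarith
  qed
  show ceq: "c = {Inf c<..<Sup c}"
  proof
    show "c \<subseteq> {Inf c<..<Sup c}" using lt by auto
    show "{Inf c<..<Sup c} \<subseteq> c"
    proof
      fix t assume t: "t \<in> {Inf c<..<Sup c}"
      obtain y where y: "y \<in> c" "t < y" using t less_cSup_iff[OF ne bdd(1)] by auto
      obtain x where x: "x \<in> c" "x < t" using t cInf_less_iff[OF ne bdd(2)] by auto
      show "t \<in> c" using connected_contains_Icc[OF conn x(1) y(1)] x y by auto
    qed
  qed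
  obtain x0 where x0: "x0 \<in> c" using ne by blast
  show less: "Inf c < Sup c" using lt[OF x0] by linarith
  have cl: "Inf c \<in> closure U" "Sup c \<in> closure U"
    using closure_contains_Inf[OF ne bdd(2)] closure_contains_Sup[OF ne bdd(1)] closure_mono[OF cU] by auto
  \<comment> \<open>Otherwise adjoining the endpoint gives a larger connected subset of U that meets
    the component, against maximality.\<close>
  have "Inf c \<notin> U"
  proof
    assume I: "Inf c \<in> U"
    have "{Inf c..<Sup c} \<subseteq> insert (Inf c) {Inf c<..<Sup c}" by auto
    then have "{Inf c..<Sup c} \<subseteq> U" using I cU ceq by blast
    moreover have "c \<inter> {Inf c..<Sup c} \<noteq> {}" using x0 lt[OF x0] by auto
    ultimately have "{Inf c..<Sup c} \<subseteq> c" using components_maximal[OF c connected_Ico] by blast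
    moreover have "Inf c \<in> {Inf c..<Sup c}" using less by simp
    ultimately have "Inf c \<in> c" by blast
    then show False using lt by blast
  qed
  moreover have "Sup c \<notin> U"
  proof
    assume I: "Sup c \<in> U"
    have "{Inf c<..Sup c} \<subseteq> insert (Sup c) {Inf c<..<Sup c}" by auto
    then have "{Inf c<..Sup c} \<subseteq> U" using I cU ceq by blast
    moreover have "c \<inter> {Inf c<..Sup c} \<noteq> {}" using x0 lt[OF x0] by auto
    ultimately have "{Inf c<..Sup c} \<subseteq> c" using components_maximal[OF c connected_Ioc] by blast
    moreover have "Sup c \<in> {Inf c<..Sup c}" using less by simp
    ultimately have "Sup c \<in> c" by blast
    then show False using lt by blast
  qed
  ultimately show "Inf c \<in> frontier U" "Sup c \<in> frontier U"
    using cl U(1) by (auto simp: frontier_def interior_open)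
qed

text \<open>Finitely many components carry the integral up to e, and on each the fundamental theorem
  applies. A boundary point may end one component and begin another, whence the factor 2. A finite T
  with an error keeps infinite sums of boundary values out of the statement.\<close>

lemma integral_deriv_open_bounded_real:
  fixes U :: "real set" and f f' :: "real \<Rightarrow> real"
  assumes U: "open U" "bounded U"
    and der: "\<And>x. (f has_real_derivative f' x) (at x)" and cont: "continuous_on UNIV f'"
    and e: "0 < e"
  shows "\<exists>T. finite T \<and> T \<subseteq> frontier U \<and> \<bar>LINT x:U|lborel. f' x\<bar> \<le> 2 * (\<Sum>t\<in>T. \<bar>f t\<bar>) + e"
proof (cases "U = {}")
  case True
  then show ?thesis using e by (intro exI[of _ "{}"]) (auto simp: set_lebesgue_integral_def)
next
  case False
  define C where "C = from_nat_into (components U)"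
  have cnt: "countable (components U)"
  proof (rule countable_disjoint_open_subsets)
    show "\<And>S. S \<in> components U \<Longrightarrow> open S" using open_components[OF U(1)] by blast
    show "disjoint (components U)" using pairwise_disjoint_components[of U] by (simp add: pairwise_def disjnt_def)
  qed
  have rC: "range C = components U" unfolding C_def using cnt False by (intro range_from_nat_into) auto
  have comp: "C n \<in> components U" for n using rC by auto
  note cp = component_of_open_bounded_real[OF U]
  have mem: "x \<in> c \<longleftrightarrow> Inf c < x \<and> x < Sup c" if "c \<in> components U" for c x
    using cp(1)[OF that] by (metis greaterThanLessThan_iff)
  obtain b where ab: "U \<subseteq> {-b..b}" using bounded_subset_cbox_symmetric[OF U(2)] by (metis cbox_interval)
  define a where "a = - b"
  note ab = ab[folded a_def]
  have [measurable]: "f' \<in> borel_measurable borel" using cont by (rule borel_measurable_continuous_onI)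
  have intcb: "set_integrable lborel {a..b} f'"
    unfolding set_integrable_def by (rule borel_integrable_compact) (auto intro: continuous_on_subset[OF cont])
  have int: "set_integrable lborel A f'" if "A \<in> sets borel" "A \<subseteq> U" for A
    by (rule set_integrable_subset[OF intcb]) (use that ab in auto)
  \<comment> \<open>The enumeration \<open>C\<close> repeats components if there are only finitely
    many, so unions and sums run over its image.\<close>
  define V where "V n = (\<Union>c\<in>C ` {..<n}. c)" for n
  have op: "open c" if "c \<in> components U" for c using open_components[OF U(1) that] .
  have Vs: "V n \<in> sets borel" for n unfolding V_def using comp op by (intro borel_open open_UN) auto
  have UV: "(\<Union>n. V n) = U"
  proof -
    have "(\<Union>n. V n) = \<Union>(range C)" unfolding V_def by auto
    then show ?thesis using rC by simp
  qed
  have "(\<lambda>n. LINT x:V n|lborel. f' x) \<longlonglongrightarrow> (LINT x:(\<Union>n. V n)|lborel. f' x)"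
  proof (rule set_integral_cont_up)
    show "incseq V" unfolding incseq_def V_def by (intro allI impI UN_mono image_mono) auto
    show "set_integrable lborel (\<Union>n. V n) f'" unfolding UV using U(1) by (intro int) auto
  qed (use Vs in auto)
  then have "eventually (\<lambda>n. dist (LINT x:V n|lborel. f' x) (LINT x:U|lborel. f' x) < e) sequentially"
    unfolding UV using e by (rule tendstoD)
  then obtain n where n: "\<bar>(LINT x:V n|lborel. f' x) - (LINT x:U|lborel. f' x)\<bar> < e"
    by (auto simp: dist_real_def eventually_sequentially)
  define F where "F = C ` {..<n}"
  have F: "finite F" "F \<subseteq> components U" using comp by (auto simp: F_def)
  have cint: "(LINT x:c|lborel. f' x) = f (Sup c) - f (Inf c)" if "c \<in> components U" for c
  proof -
    have "(LINT x:c|lborel. f' x) = (LINT x:{Inf c<..<Sup c}|lborel. f' x)" using cp(1)[OF that] by simp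
    also have "\<dots> = (LINT x:{Inf c..Sup c}|lborel. f' x)"
    proof (rule set_integral_cong_set)
      have "AE x in lborel. x \<noteq> Inf c" "AE x in lborel. x \<noteq> Sup c" by (rule AE_lborel_singleton)+
      then show "AE x in lborel. (x \<in> {Inf c..Sup c}) = (x \<in> {Inf c<..<Sup c})" by eventually_elim auto
    qed (simp_all add: set_borel_measurable_def)
    also have "\<dots> = f (Sup c) - f (Inf c)"
      unfolding set_lebesgue_integral_def using cp(2)[OF that] der cont
      by (intro integral_FTC_Icc) (auto simp: has_real_derivative_iff_has_vector_derivative[symmetric]
        intro: DERIV_subset continuous_on_subset)
    finally show ?thesis .
  qed
  have disj: "disjoint_family_on (\<lambda>c. c) F"
    using pairwise_disjoint_components[of U] F(2) unfolding disjoint_family_on_def pairwise_def by blast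
  have "(LINT x:V n|lborel. f' x) = (\<Sum>c\<in>F. LINT x:c|lborel. f' x)"
  proof -
    have "c \<in> sets borel" "c \<subseteq> U" if "c \<in> F" for c
      using subsetD[OF F(2) that] op[of c] in_components_subset[of c U] by auto
    then have "set_integrable lborel c f'" "c \<in> sets lborel" if "c \<in> F" for c
      using that int by auto
    then show ?thesis unfolding V_def F_def[symmetric]
      by (intro set_integral_finite_Union[OF F(1) disj])
  qed
  also have "\<dots> = (\<Sum>c\<in>F. f (Sup c) - f (Inf c))" using F by (intro sum.cong cint) auto
  finally have "\<bar>LINT x:V n|lborel. f' x\<bar> \<le> (\<Sum>c\<in>F. \<bar>f (Sup c) - f (Inf c)\<bar>)" by simp
  also have "\<dots> \<le> (\<Sum>c\<in>F. \<bar>f (Sup c)\<bar> + \<bar>f (Inf c)\<bar>)" by (intro sum_mono) auto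
  also have "\<dots> = (\<Sum>c\<in>F. \<bar>f (Sup c)\<bar>) + (\<Sum>c\<in>F. \<bar>f (Inf c)\<bar>)" by (rule sum.distrib)
  also have "(\<Sum>c\<in>F. \<bar>f (Sup c)\<bar>) = (\<Sum>t\<in>Sup ` F. \<bar>f t\<bar>)"
  proof -
    \<comment> \<open>Two components with the same supremum share the points just below it; the
      midpoint between that supremum and the larger infimum is such a point.\<close>
    have "inj_on Sup F"
    proof (rule inj_onI)
      fix c c' assume cc: "c \<in> F" "c' \<in> F" "Sup c = Sup c'"
      then have m: "c \<in> components U" "c' \<in> components U" using F by auto
      have "(max (Inf c) (Inf c') + Sup c) / 2 \<in> c" "(max (Inf c) (Inf c') + Sup c) / 2 \<in> c'"
        unfolding mem[OF m(1)] mem[OF m(2)] using cp(2)[OF m(1)] cp(2)[OF m(2)] cc(3) by auto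
      then show "c = c'" using components_eq[OF m] by blast
    qed
    then show ?thesis by (simp add: sum.reindex)
  qed
  also have "(\<Sum>c\<in>F. \<bar>f (Inf c)\<bar>) = (\<Sum>t\<in>Inf ` F. \<bar>f t\<bar>)"
  proof -
    have "inj_on Inf F"
    proof (rule inj_onI)
      fix c c' assume cc: "c \<in> F" "c' \<in> F" "Inf c = Inf c'"
      then have m: "c \<in> components U" "c' \<in> components U" using F by auto
      have "(min (Sup c) (Sup c') + Inf c) / 2 \<in> c" "(min (Sup c) (Sup c') + Inf c) / 2 \<in> c'"
        unfolding mem[OF m(1)] mem[OF m(2)] using cp(2)[OF m(1)] cp(2)[OF m(2)] cc(3) by auto
      then show "c = c'" using components_eq[OF m] by blast
    qed
    then show ?thesis by (simp add: sum.reindex)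
  qed
  also have "(\<Sum>t\<in>Sup ` F. \<bar>f t\<bar>) + (\<Sum>t\<in>Inf ` F. \<bar>f t\<bar>)
     \<le> (\<Sum>t\<in>Sup ` F \<union> Inf ` F. \<bar>f t\<bar>) + (\<Sum>t\<in>Sup ` F \<union> Inf ` F. \<bar>f t\<bar>)"
    using F by (intro add_mono sum_mono2) auto
  finally have "\<bar>LINT x:V n|lborel. f' x\<bar> \<le> 2 * (\<Sum>t\<in>Sup ` F \<union> Inf ` F. \<bar>f t\<bar>)" by simp
  then have "\<bar>LINT x:U|lborel. f' x\<bar> \<le> 2 * (\<Sum>t\<in>Sup ` F \<union> Inf ` F. \<bar>f t\<bar>) + e" using n by linarith
  moreover have "Sup ` F \<union> Inf ` F \<subseteq> frontier U" using F cp(3,4) by auto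
  ultimately show ?thesis using F by (intro exI[of _ "Sup ` F \<union> Inf ` F"]) auto
qed

text \<open>Continuous images of Borel sets need not be Borel, but a compact set intersected with an
  open one is a countable union of compact sets. Pieces of a compact boundary in half-open squares
  have this form.\<close>

lemma continuous_image_compact_Int_open_borel:
  fixes f :: "'a::euclidean_space \<Rightarrow> 'b::t2_space"
  assumes K: "compact K" and O: "open O'" and f: "continuous_on UNIV f"
  shows "f ` (K \<inter> O') \<in> sets borel"
proof -
  obtain D :: "nat \<Rightarrow> 'a set" where D: "\<And>n. compact (D n)" "\<Union>(range D) = O'"
    using open_Union_compact_subsets[OF O] by metis
  have "f ` (K \<inter> O') = (\<Union>n. f ` (K \<inter> D n))" using D(2) by blast
  moreover have "closed (f ` (K \<inter> D n))" for n
    using K D by (intro compact_imp_closed compact_continuous_image compact_Int continuous_on_subset[OF f]) auto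
  ultimately show ?thesis by (simp add: sets.countable_UN')
qed


text \<open>The index of the half-open square of side 1/(n + 1) containing x; the shift by one
  avoids a zero scale at n = 0. Half-open squares partition the plane, so no boundary point is
  counted twice.\<close>

definition grid_cell :: "nat \<Rightarrow> plane \<Rightarrow> int \<times> int" where
  "grid_cell n x = (\<lfloor>(real n + 1) * x $ 1\<rfloor>, \<lfloor>(real n + 1) * x $ 2\<rfloor>)"

lemma grid_cell_eq_iff:
  "grid_cell n x = (a, b) \<longleftrightarrow> of_int a \<le> (real n + 1) * x $ 1 \<and> (real n + 1) * x $ 1 < of_int a + 1
     \<and> of_int b \<le> (real n + 1) * x $ 2 \<and> (real n + 1) * x $ 2 < of_int b + 1"
  by (auto simp: grid_cell_def floor_eq_iff)

lemma grid_cell_component_dist: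
  assumes "grid_cell n x = grid_cell n y"
  shows "\<bar>x $ j - y $ j\<bar> < 1 / (real n + 1)"
proof -
  obtain a b where ab: "grid_cell n x = (a, b)" by fastforce
  have "\<bar>(real n + 1) * x $ j - (real n + 1) * y $ j\<bar> < 1"
    using ab[unfolded grid_cell_eq_iff] ab[unfolded assms grid_cell_eq_iff] exhaust_2[of j]
    by (auto simp: abs_less_iff)
  then have "(real n + 1) * \<bar>x $ j - y $ j\<bar> < 1"
    by (simp add: abs_mult flip: right_diff_distrib)
  then show ?thesis by (simp add: field_simps)
qed

lemma grid_cell_dist:
  assumes "grid_cell n x = grid_cell n y"
  shows "dist x y < 2 / (real n + 1)"
proof -
  have "dist x y \<le> (\<Sum>j\<in>UNIV. \<bar>(x - y) $ j\<bar>)" unfolding dist_norm by (rule norm_le_l1_cart)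
  also have "\<dots> < 2 / (real n + 1)"
    using grid_cell_component_dist[OF assms, of 1] grid_cell_component_dist[OF assms, of 2]
    by (simp add: sum_2)
  finally show ?thesis .
qed

lemma grid_cell_Int_closed_open:
  obtains F V where "closed F" "open V" "{x. grid_cell n x = i} = F \<inter> V"
proof -
  obtain a b where i: "i = (a, b)" by fastforce
  show thesis
  proof
    show "closed ({x. of_int a \<le> (real n + 1) * x $ 1} \<inter> {x :: plane. of_int b \<le> (real n + 1) * x $ 2})"
      by (intro closed_Int closed_Collect_le continuous_intros)
    show "open ({x. (real n + 1) * x $ 1 < of_int a + 1} \<inter> {x :: plane. (real n + 1) * x $ 2 < of_int b + 1})"
      by (intro open_Int open_Collect_less continuous_intros)
    show "{x. grid_cell n x = i} = ({x. of_int a \<le> (real n + 1) * x $ 1} \<inter> {x. of_int b \<le> (real n + 1) * x $ 2}) \<inter>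
      ({x. (real n + 1) * x $ 1 < of_int a + 1} \<inter> {x. (real n + 1) * x $ 2 < of_int b + 1})"
      unfolding i grid_cell_eq_iff by auto
  qed
qed

lemma finite_grid_cell_image:
  assumes "bounded E"
  shows "finite (grid_cell n ` E)"
proof -
  obtain B where B: "\<And>x. x \<in> E \<Longrightarrow> norm x \<le> B" using assms by (auto simp: bounded_iff)
  define M where "M = (real n + 1) * B"
  have "grid_cell n ` E \<subseteq> {\<lfloor>- M\<rfloor>..\<lfloor>M\<rfloor>} \<times> {\<lfloor>- M\<rfloor>..\<lfloor>M\<rfloor>}"
  proof
    fix c assume "c \<in> grid_cell n ` E"
    then obtain x where x: "x \<in> E" and c: "c = grid_cell n x" by blast
    have "\<bar>(real n + 1) * x $ k\<bar> \<le> M" for k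
      unfolding M_def abs_mult using component_le_norm_cart[of x k] B[OF x] by (intro mult_mono) auto
    then have "- M \<le> (real n + 1) * x $ k \<and> (real n + 1) * x $ k \<le> M" for k
      using abs_le_D1 abs_le_D2 by (metis minus_le_iff)
    then have "\<lfloor>- M\<rfloor> \<le> \<lfloor>(real n + 1) * x $ k\<rfloor> \<and> \<lfloor>(real n + 1) * x $ k\<rfloor> \<le> \<lfloor>M\<rfloor>" for k
      by (meson floor_mono)
    then show "c \<in> {\<lfloor>- M\<rfloor>..\<lfloor>M\<rfloor>} \<times> {\<lfloor>- M\<rfloor>..\<lfloor>M\<rfloor>}"
      unfolding c grid_cell_def mem_Times_iff atLeastAtMost_iff fst_conv snd_conv by blast
  qed
  then show ?thesis by (rule finite_subset) auto
qed

text \<open>A lower Riemann sum, over the cells of a grid, for the sum of \<open>w\<close> over the points of \<open>E\<close>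
  whose \<open>i\<close>-th coordinate is \<open>t\<close>.\<close>

definition grid_sum :: "plane set \<Rightarrow> (plane \<Rightarrow> real) \<Rightarrow> 2 \<Rightarrow> nat \<Rightarrow> real \<Rightarrow> ennreal" where
  "grid_sum E w i n t = (\<Sum>c\<in>grid_cell n ` E.
     ennreal (INF x\<in>{x \<in> E. grid_cell n x = c}. w x) * indicator ((\<lambda>x. x $ i) ` {x \<in> E. grid_cell n x = c}) t)"

text \<open>The projection of each piece has length at most twice its Hausdorff measure, and the
  infimum of w times that measure is at most the integral of w over the piece. The pieces partition
  E.\<close>

lemma grid_sum_measurable_and_integral:
  assumes E: "compact E" and w: "continuous_on UNIV w" "\<And>x. 0 \<le> w x"
  shows "grid_sum E w i n \<in> borel_measurable borel"
    and "(\<integral>\<^sup>+ t. grid_sum E w i n t \<partial>lborel) \<le> 2 * (\<integral>\<^sup>+ x\<in>E. ennreal (w x) \<partial>hausdorff1)"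
proof -
  define A where "A c = {x \<in> E. grid_cell n x = c}" for c
  define I where "I = grid_cell n ` E"
  have finI: "finite I" unfolding I_def using E by (intro finite_grid_cell_image compact_imp_bounded)
  have A: "A c \<in> sets borel" "(\<lambda>x. x $ i) ` A c \<in> sets borel" for c
  proof -
    obtain F V where FV: "closed F" "open V" "{x. grid_cell n x = c} = F \<inter> V"
      by (rule grid_cell_Int_closed_open)
    have "A c = E \<inter> {x. grid_cell n x = c}" unfolding A_def by auto
    then have eq: "A c = (E \<inter> F) \<inter> V" unfolding FV(3) by auto
    show "A c \<in> sets borel" unfolding eq using E FV by (intro sets.Int borel_closed borel_open compact_imp_closed) auto
    show "(\<lambda>x. x $ i) ` A c \<in> sets borel" unfolding eq using E FV
      by (intro continuous_image_compact_Int_open_borel continuous_intros compact_Int_closed) auto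
  qed
  have [measurable]: "(\<lambda>x. x $ i) ` A c \<in> sets borel" "A c \<in> sets borel" for c by (rule A)+
  have wm [measurable]: "w \<in> borel_measurable borel" using w(1) by (rule borel_measurable_continuous_onI)
  have eq: "grid_sum E w i n = (\<lambda>t. \<Sum>c\<in>I. ennreal (INF x\<in>A c. w x) * indicator ((\<lambda>x. x $ i) ` A c) t)"
    unfolding grid_sum_def A_def I_def ..
  show "grid_sum E w i n \<in> borel_measurable borel" unfolding eq by measurable
  have "(\<integral>\<^sup>+ t. grid_sum E w i n t \<partial>lborel)
    = (\<Sum>c\<in>I. ennreal (INF x\<in>A c. w x) * emeasure lborel ((\<lambda>x. x $ i) ` A c))"
    unfolding eq by (subst nn_integral_sum) (auto simp: nn_integral_cmult_indicator)
  also have "\<dots> \<le> (\<Sum>c\<in>I. ennreal (INF x\<in>A c. w x) * (2 * emeasure hausdorff1 (A c)))"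
    using A by (intro sum_mono mult_left_mono) (simp_all add: emeasure_hausdorff1 emeasure_projection_le_hausdorff1)
  also have "\<dots> = 2 * (\<Sum>c\<in>I. ennreal (INF x\<in>A c. w x) * emeasure hausdorff1 (A c))"
    by (simp add: sum_distrib_left mult_ac)
  finally have 1: "(\<integral>\<^sup>+ t. grid_sum E w i n t \<partial>lborel)
    \<le> 2 * (\<Sum>c\<in>I. ennreal (INF x\<in>A c. w x) * emeasure hausdorff1 (A c))" .
  have "(\<Sum>c\<in>I. ennreal (INF x\<in>A c. w x) * emeasure hausdorff1 (A c))
    \<le> (\<Sum>c\<in>I. \<integral>\<^sup>+ x\<in>A c. ennreal (w x) \<partial>hausdorff1)"
  proof (rule sum_mono)
    fix c
    have "ennreal (INF x\<in>A c. w x) * emeasure hausdorff1 (A c) = (\<integral>\<^sup>+ x\<in>A c. ennreal (INF x\<in>A c. w x) \<partial>hausdorff1)"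
      by (simp add: nn_integral_cmult_indicator)
    also have "\<dots> \<le> (\<integral>\<^sup>+ x\<in>A c. ennreal (w x) \<partial>hausdorff1)"
    proof (rule nn_integral_mono)
      fix x
      show "ennreal (INF x\<in>A c. w x) * indicator (A c) x \<le> ennreal (w x) * indicator (A c) x"
        using w(2) by (auto simp: indicator_def intro!: ennreal_leI cINF_lower bdd_belowI[of _ 0])
    qed
    finally show "ennreal (INF x\<in>A c. w x) * emeasure hausdorff1 (A c) \<le> (\<integral>\<^sup>+ x\<in>A c. ennreal (w x) \<partial>hausdorff1)" .
  qed
  also have "\<dots> = (\<integral>\<^sup>+ x. (\<Sum>c\<in>I. ennreal (w x) * indicator (A c) x) \<partial>hausdorff1)"
    by (rule nn_integral_sum[symmetric]) measurable
  also have "\<dots> = (\<integral>\<^sup>+ x\<in>E. ennreal (w x) \<partial>hausdorff1)"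
  proof (rule nn_integral_cong)
    fix x
    show "(\<Sum>c\<in>I. ennreal (w x) * indicator (A c) x) = ennreal (w x) * indicator E x"
    proof (cases "x \<in> E")
      case True
      have "(\<Sum>c\<in>I. ennreal (w x) * indicator (A c) x) = (\<Sum>c\<in>I. if c = grid_cell n x then ennreal (w x) else 0)"
        using True by (intro sum.cong) (auto simp: A_def indicator_def)
      also have "\<dots> = ennreal (w x)" using True finI by (simp add: I_def)
      finally show ?thesis using True by simp
    qed (simp add: A_def indicator_def)
  qed
  finally show "(\<integral>\<^sup>+ t. grid_sum E w i n t \<partial>lborel) \<le> 2 * (\<integral>\<^sup>+ x\<in>E. ennreal (w x) \<partial>hausdorff1)"
    by (intro order.trans[OF 1] mult_left_mono) auto
qed

text \<open>Once the cells are smaller than the least distance between points of T, these points lie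
  in different cells; uniform continuity makes each infimum close to the value at the point. The
  threshold depends on t and T, so only a bound for the lower limit results, which is what Fatou's
  lemma asks for.\<close>

lemma grid_sum_eventually_ge:
  assumes E: "compact E" and w: "continuous_on UNIV w" "\<And>x. 0 \<le> w x"
    and T: "finite T" "T \<subseteq> E" "\<And>x. x \<in> T \<Longrightarrow> x $ i = t" and e: "0 < e"
  shows "eventually (\<lambda>n. ennreal (\<Sum>x\<in>T. w x) \<le> grid_sum E w i n t + ennreal e) sequentially"
proof -
  \<comment> \<open>The error is shared among the points of T; the added 1 covers the empty
    set.\<close>
  define \<epsilon> where "\<epsilon> = e / (real (card T) + 1)"
  have \<epsilon>: "\<epsilon> > 0" "real (card T) * \<epsilon> \<le> e" using e by (auto simp: \<epsilon>_def field_simps)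
  have "uniformly_continuous_on E w"
    using E w(1) by (intro compact_uniformly_continuous) (auto intro: continuous_on_subset)
  then obtain d where d: "d > 0" "\<And>x y. x \<in> E \<Longrightarrow> y \<in> E \<Longrightarrow> dist x y < d \<Longrightarrow> dist (w x) (w y) < \<epsilon>"
    unfolding uniformly_continuous_on_def using \<epsilon>(1) by metis
  obtain r where r: "r > 0" "\<And>x y. x \<in> T \<Longrightarrow> y \<in> T \<Longrightarrow> x \<noteq> y \<Longrightarrow> r \<le> dist x y"
  proof -
    have "\<exists>r>0. \<forall>y\<in>T. y \<noteq> x \<longrightarrow> r \<le> dist x y" for x
      using finite_set_avoid[OF T(1)] by metis
    then obtain \<rho> where \<rho>: "\<And>x. \<rho> x > 0" "\<And>x y. y \<in> T \<Longrightarrow> y \<noteq> x \<Longrightarrow> \<rho> x \<le> dist x y" by metis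
    show thesis
    proof (cases "T = {}")
      case True
      then show ?thesis using that[of 1] by auto
    next
      case False
      show ?thesis
      proof (rule that[of "Min (\<rho> ` T)"])
        show "Min (\<rho> ` T) > 0" using T(1) False \<rho>(1) by simp
        fix x y assume "x \<in> T" "y \<in> T" "x \<noteq> y"
        then have "Min (\<rho> ` T) \<le> \<rho> x" "\<rho> x \<le> dist x y" using \<rho>(2)[of y x] T(1) by auto
        then show "Min (\<rho> ` T) \<le> dist x y" by linarith
      qed
    qed
  qed
  have "eventually (\<lambda>n. 2 / (real n + 1) < min d r) sequentially"
  proof -
    obtain N :: nat where N: "2 / min d r < real N" using reals_Archimedean2 by blast
    have "2 / (real n + 1) < min d r" if "n \<ge> N" for n
    proof -
      define m where "m = min d r"
      have m: "m > 0" using d(1) r(1) by (simp add: m_def)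
      have "2 / m < real n + 1" using N that unfolding m_def by linarith
      then have "2 / (real n + 1) < m" using m by (simp add: divide_less_eq mult.commute)
      then show ?thesis by (simp add: m_def)
    qed
    then show ?thesis by (auto simp: eventually_sequentially)
  qed
  then show ?thesis
  proof eventually_elim
    case (elim n)
    define A where "A c = {x \<in> E. grid_cell n x = c}" for c
    have finI: "finite (grid_cell n ` E)" using E by (intro finite_grid_cell_image compact_imp_bounded)
    have inj: "inj_on (grid_cell n) T"
      using grid_cell_dist[of n] r(2) elim by (intro inj_onI) (smt (verit))
    have lower: "w x - \<epsilon> \<le> (INF y\<in>A (grid_cell n x). w y)" if x: "x \<in> T" for x
    proof (rule cINF_greatest)
      show "A (grid_cell n x) \<noteq> {}" using x T(2) by (auto simp: A_def)
      fix y assume "y \<in> A (grid_cell n x)"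
      then have "y \<in> E" "dist x y < d" using grid_cell_dist[of n x y] elim by (auto simp: A_def)
      then show "w x - \<epsilon> \<le> w y" using d(2)[of x y] x T(2) by (auto simp: dist_real_def)
    qed
    have "(\<Sum>x\<in>T. w x) - e \<le> (\<Sum>x\<in>T. w x) - real (card T) * \<epsilon>" using \<epsilon> by simp
    also have "\<dots> = (\<Sum>x\<in>T. w x - \<epsilon>)" by (simp add: sum_subtractf)
    also have "\<dots> \<le> (\<Sum>x\<in>T. INF y\<in>A (grid_cell n x). w y)" by (intro sum_mono lower)
    finally have "ennreal (\<Sum>x\<in>T. w x) \<le> ennreal ((\<Sum>x\<in>T. INF y\<in>A (grid_cell n x). w y) + e)"
      by (intro ennreal_leI) simp
    also have "\<dots> = (\<Sum>x\<in>T. ennreal (INF y\<in>A (grid_cell n x). w y)) + ennreal e"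
    proof -
      have nn: "0 \<le> (INF y\<in>A (grid_cell n x). w y)" if "x \<in> T" for x
        using that T(2) w(2) by (intro cINF_greatest) (auto simp: A_def)
      then show ?thesis using e by (subst ennreal_plus) (auto intro!: sum_nonneg)
    qed
    also have "(\<Sum>x\<in>T. ennreal (INF y\<in>A (grid_cell n x). w y)) = (\<Sum>c\<in>grid_cell n ` T. ennreal (INF y\<in>A c. w y))"
      using inj by (simp add: sum.reindex)
    also have "\<dots> = (\<Sum>c\<in>grid_cell n ` T. ennreal (INF y\<in>A c. w y) * indicator ((\<lambda>x. x $ i) ` A c) t)"
    proof (rule sum.cong)
      fix c assume "c \<in> grid_cell n ` T"
      then obtain x where "x \<in> T" "c = grid_cell n x" by auto
      then have "t \<in> (\<lambda>x. x $ i) ` A c" using T(2,3) by (force simp: A_def)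
      then show "ennreal (INF y\<in>A c. w y) = ennreal (INF y\<in>A c. w y) * indicator ((\<lambda>x. x $ i) ` A c) t" by simp
    qed simp
    also have "\<dots> \<le> grid_sum E w i n t"
      unfolding grid_sum_def A_def using T(2) finI by (intro sum_mono2) auto
    finally show ?case by (simp add: add_right_mono)
  qed
qed

text \<open>The sum of |w| over the boundary points on a line may be infinite and is not evidently
  measurable in t. It is replaced by the lower limit of the measurable grid sums, which Fatou's
  lemma integrates. The constant 4 combines the double use of endpoints on a line with the factor 2
  of the projection.\<close>

lemma abs_integral_partial_le_boundary:
  fixes w :: "plane \<Rightarrow> real"
  assumes \<Omega>: "open \<Omega>" "bounded \<Omega>"
    and w: "\<And>x. w differentiable at x" and cont: "continuous_on UNIV (partial j w)"
  shows "ennreal \<bar>LINT x:\<Omega>|lebesgue. partial j w x\<bar>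
     \<le> 4 * (\<integral>\<^sup>+ x\<in>frontier \<Omega>. ennreal \<bar>w x\<bar> \<partial>hausdorff1)"
proof -
  obtain i :: 2 where ij: "i \<noteq> j" by (metis one_neq_zero)
  define \<Phi> :: "real \<Rightarrow> real \<Rightarrow> plane" where "\<Phi> t s = t *\<^sub>R axis i 1 + s *\<^sub>R axis j 1" for t s
  define E where "E = frontier \<Omega>"
  have E: "compact E" unfolding E_def using \<Omega>(2) by (rule compact_frontier_bounded)
  have contw: "continuous_on UNIV w"
    using w by (intro continuous_at_imp_continuous_on) (auto intro: differentiable_imp_continuous_within)
  have contaw: "continuous_on UNIV (\<lambda>x. \<bar>w x\<bar>)" using contw by (intro continuous_intros)
  have [measurable]: "partial j w \<in> borel_measurable borel" using cont by (rule borel_measurable_continuous_onI)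
  have \<Omega>m [measurable]: "\<Omega> \<in> sets borel" using \<Omega>(1) by simp
  define g where "g x = indicator \<Omega> x * partial j w x" for x
  have gm [measurable]: "g \<in> borel_measurable borel" unfolding g_def by measurable
  have gint: "integrable lborel g"
  proof -
    have "integrable lborel (\<lambda>x. indicator (closure \<Omega>) x *\<^sub>R partial j w x)"
      using \<Omega>(2) by (intro borel_integrable_compact) (auto intro: continuous_on_subset[OF cont])
    then have "set_integrable lborel (closure \<Omega>) (partial j w)" by (simp add: set_integrable_def)
    then have "set_integrable lborel \<Omega> (partial j w)"
      by (rule set_integrable_subset) (use closure_subset in auto)
    then show ?thesis by (simp add: set_integrable_def g_def[abs_def])
  qed
  have \<Phi>m [measurable]: "(\<lambda>(t, s). \<Phi> t s) \<in> borel_measurable (lborel \<Otimes>\<^sub>M lborel)"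
    unfolding \<Phi>_def lborel_prod by (simp add: case_prod_beta' borel_measurable_continuous_onI continuous_intros)
  have lb: "(lborel :: plane measure) = distr (lborel \<Otimes>\<^sub>M lborel) borel (\<lambda>(t, s). \<Phi> t s)"
    unfolding \<Phi>_def by (rule lborel_plane_eq_distr[OF ij])
  have pint: "integrable (lborel \<Otimes>\<^sub>M lborel) (\<lambda>p. g ((\<lambda>(t, s). \<Phi> t s) p))"
    using gint unfolding lb by (subst (asm) integrable_distr_eq) auto
  define S where "S t = (LINT s|lborel. g (\<Phi> t s))" for t
  have "(LINT x:\<Omega>|lebesgue. partial j w x) = integral\<^sup>L lborel g"
    unfolding set_lebesgue_integral_def by (subst integral_completion) (auto simp: g_def[abs_def])
  also have "\<dots> = integral\<^sup>L (lborel \<Otimes>\<^sub>M lborel) (\<lambda>p. g ((\<lambda>(t, s). \<Phi> t s) p))"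
    by (subst lb, subst integral_distr) auto
  also have "\<dots> = (LINT t|lborel. S t)"
    using lborel_pair.integral_fst'[OF pint] by (simp add: S_def)
  finally have "ennreal \<bar>LINT x:\<Omega>|lebesgue. partial j w x\<bar> = ennreal (norm (LINT t|lborel. S t))" by simp
  also have "\<dots> \<le> (\<integral>\<^sup>+ t. ennreal (norm (S t)) \<partial>lborel)"
    by (rule integral_norm_bound_ennreal) (use lborel_pair.integrable_fst'[OF pint] in \<open>simp add: S_def\<close>)
  also have "\<dots> \<le> (\<integral>\<^sup>+ t. liminf (\<lambda>n. 2 * grid_sum E (\<lambda>x. \<bar>w x\<bar>) i n t) \<partial>lborel)"
  proof (rule nn_integral_mono)
    fix t :: real
    define U where "U = {s. \<Phi> t s \<in> \<Omega>}"
    have cPhi: "continuous_on UNIV (\<Phi> t)" unfolding \<Phi>_def by (intro continuous_intros)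
    have U1: "open U" using open_vimage[OF \<Omega>(1) cPhi] by (simp add: U_def vimage_def)
    have comp: "\<Phi> t s $ j = s" "\<Phi> t s $ i = t" for s using ij by (auto simp: \<Phi>_def axis_def)
    have U2: "bounded U"
    proof -
      obtain B where "\<And>x. x \<in> \<Omega> \<Longrightarrow> norm x \<le> B" using \<Omega>(2) by (auto simp: bounded_iff)
      then have "\<bar>s\<bar> \<le> B" if "s \<in> U" for s
        using that component_le_norm_cart[of "\<Phi> t s" j] by (fastforce simp: U_def comp)
      then show ?thesis by (auto simp: bounded_iff)
    qed
    have front: "\<Phi> t s \<in> E" if "s \<in> frontier U" for s
    proof -
      have "s \<in> closure U" "s \<notin> U" using that U1 by (auto simp: frontier_def interior_open)
      then have "\<Phi> t s \<in> closure (\<Phi> t ` U)"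
        using image_closure_subset[OF continuous_on_subset[OF cPhi] closed_closure closure_subset] by blast
      also have "\<dots> \<subseteq> closure \<Omega>" by (intro closure_mono) (auto simp: U_def)
      finally show ?thesis using \<open>s \<notin> U\<close> \<Omega>(1) by (simp add: E_def frontier_def interior_open U_def)
    qed
    have der: "((\<lambda>s. w (\<Phi> t s)) has_real_derivative partial j w (\<Phi> t s)) (at s)" for s
    proof -
      have "(w has_derivative frechet_derivative w (at (\<Phi> t s))) (at (\<Phi> t s))"
        using w by (simp add: frechet_derivative_works)
      moreover have "(\<Phi> t has_derivative (\<lambda>h. h *\<^sub>R axis j 1)) (at s)"
        unfolding \<Phi>_def by (auto intro!: derivative_eq_intros)
      ultimately have "((\<lambda>s. w (\<Phi> t s)) has_derivative (\<lambda>h. frechet_derivative w (at (\<Phi> t s)) (h *\<^sub>R axis j 1))) (at s)"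
        by (rule has_derivative_compose[rotated])
      moreover have "linear (frechet_derivative w (at (\<Phi> t s)))"
        using w by (rule linear_frechet_derivative)
      ultimately show ?thesis
        unfolding has_field_derivative_def partial_def
        by (elim has_derivative_eq_rhs) (simp add: linear_cmul fun_eq_iff)
    qed
    have cont': "continuous_on UNIV (\<lambda>s. partial j w (\<Phi> t s))"
      using continuous_on_compose2[OF cont cPhi] by auto
    have St: "S t = (LINT s:U|lborel. partial j w (\<Phi> t s))"
      unfolding S_def set_lebesgue_integral_def g_def by (intro Bochner_Integration.integral_cong) (auto simp: U_def indicator_def)
    show "ennreal (norm (S t)) \<le> liminf (\<lambda>n. 2 * grid_sum E (\<lambda>x. \<bar>w x\<bar>) i n t)"
    proof (rule ennreal_le_epsilon)
      fix e :: real assume e: "0 < e"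
      \<comment> \<open>One third of e is spent on the truncation to finitely many endpoints, two
        thirds on the grid error, which enters twice.\<close>
      obtain T where T: "finite T" "T \<subseteq> frontier U" "\<bar>S t\<bar> \<le> 2 * (\<Sum>s\<in>T. \<bar>w (\<Phi> t s)\<bar>) + e / 3"
        using integral_deriv_open_bounded_real[OF U1 U2 der cont', of "e / 3"] e unfolding St by auto
      have inj: "inj_on (\<Phi> t) T" by (rule inj_onI) (metis comp(1))
      have "eventually (\<lambda>n. ennreal (\<Sum>x\<in>\<Phi> t ` T. \<bar>w x\<bar>) \<le> grid_sum E (\<lambda>x. \<bar>w x\<bar>) i n t + ennreal (e / 3)) sequentially"
        using T front e comp(2) by (intro grid_sum_eventually_ge[OF E contaw]) auto
      then have "eventually (\<lambda>n. ennreal (norm (S t)) - ennreal e \<le> 2 * grid_sum E (\<lambda>x. \<bar>w x\<bar>) i n t) sequentially"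
      proof eventually_elim
        case (elim n)
        have "ennreal (norm (S t)) \<le> ennreal (2 * (\<Sum>s\<in>T. \<bar>w (\<Phi> t s)\<bar>) + e / 3)" using T(3) by (intro ennreal_leI) simp
        also have "\<dots> = 2 * ennreal (\<Sum>x\<in>\<Phi> t ` T. \<bar>w x\<bar>) + ennreal (e / 3)"
          using e inj by (simp add: sum.reindex ennreal_mult' sum_nonneg)
        also have "\<dots> \<le> 2 * (grid_sum E (\<lambda>x. \<bar>w x\<bar>) i n t + ennreal (e / 3)) + ennreal (e / 3)"
          using elim by (intro add_right_mono mult_left_mono) auto
        also have "\<dots> = 2 * grid_sum E (\<lambda>x. \<bar>w x\<bar>) i n t + ennreal e"
        proof -
          have "2 * ennreal (e / 3) + ennreal (e / 3) = ennreal (2 * (e / 3) + e / 3)"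
            using e ennreal_mult'[of 2 "e / 3"] by (subst ennreal_plus) auto
          also have "2 * (e / 3) + e / 3 = e" by simp
          finally show ?thesis by (simp add: distrib_left add.assoc)
        qed
        finally show ?case by (simp add: ennreal_minus_le_iff add.commute)
      qed
      then have "ennreal (norm (S t)) - ennreal e \<le> liminf (\<lambda>n. 2 * grid_sum E (\<lambda>x. \<bar>w x\<bar>) i n t)"
        by (rule Liminf_bounded)
      then show "ennreal (norm (S t)) \<le> liminf (\<lambda>n. 2 * grid_sum E (\<lambda>x. \<bar>w x\<bar>) i n t) + ennreal e"
        by (simp add: ennreal_minus_le_iff add.commute)
    qed
  qed
  also have "\<dots> \<le> liminf (\<lambda>n. \<integral>\<^sup>+ t. 2 * grid_sum E (\<lambda>x. \<bar>w x\<bar>) i n t \<partial>lborel)"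
    using grid_sum_measurable_and_integral(1)[OF E contaw] by (intro nn_integral_liminf) auto
  also have "\<dots> \<le> 4 * (\<integral>\<^sup>+ x\<in>E. ennreal \<bar>w x\<bar> \<partial>hausdorff1)"
  proof -
    have "(\<integral>\<^sup>+ t. 2 * grid_sum E (\<lambda>x. \<bar>w x\<bar>) i n t \<partial>lborel) \<le> 4 * (\<integral>\<^sup>+ x\<in>E. ennreal \<bar>w x\<bar> \<partial>hausdorff1)" for n
    proof -
      have "(\<integral>\<^sup>+ t. 2 * grid_sum E (\<lambda>x. \<bar>w x\<bar>) i n t \<partial>lborel) = 2 * (\<integral>\<^sup>+ t. grid_sum E (\<lambda>x. \<bar>w x\<bar>) i n t \<partial>lborel)"
        using grid_sum_measurable_and_integral(1)[OF E contaw] by (intro nn_integral_cmult) auto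
      also have "\<dots> \<le> 2 * (2 * (\<integral>\<^sup>+ x\<in>E. ennreal \<bar>w x\<bar> \<partial>hausdorff1))"
        by (intro mult_left_mono grid_sum_measurable_and_integral(2)[OF E contaw]) auto
      finally show ?thesis by (simp add: mult.assoc[symmetric])
    qed
    then show ?thesis
      by (intro Liminf_le always_eventually) auto
  qed
  finally show ?thesis by (simp add: E_def)
qed

subsection \<open>Boundaries of finite length\<close>

text \<open>A point above the graph belongs to the open set, and a point below it has a
  neighbourhood that misses the set; so a boundary point in the ball lies on the graph.\<close>

lemma frontier_subset_lipschitz_graph:
  fixes \<gamma> :: "real \<Rightarrow> real" and R :: "plane \<Rightarrow> plane"
  assumes \<Omega>: "open \<Omega>" and R: "orthogonal_transformation R" and \<gamma>: "L-lipschitz_on UNIV \<gamma>"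
    and eq: "\<Omega> \<inter> ball p r = {x \<in> ball p r. \<gamma> (R x $ 1) < R x $ 2}"
    and x: "x \<in> frontier \<Omega>" "x \<in> ball p r"
  shows "R x $ 2 = \<gamma> (R x $ 1)"
proof -
  have linR: "linear R" using R by (rule orthogonal_transformation_linear)
  have cR: "continuous_on UNIV R" using linR by (rule linear_continuous_on_compose[OF continuous_on_id, simplified])
  have c\<gamma>: "continuous_on UNIV \<gamma>" using \<gamma> by (rule lipschitz_on_continuous_on)
  have c1: "continuous_on UNIV (\<lambda>y. \<gamma> (R y $ 1))"
    by (rule continuous_on_compose2[OF c\<gamma>]) (auto intro!: continuous_intros cR)
  have c2: "continuous_on UNIV (\<lambda>y. R y $ 2)" by (intro continuous_intros cR)
  have xf: "x \<in> closure \<Omega>" "x \<notin> \<Omega>" using x(1) \<Omega> by (auto simp: frontier_def interior_open)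
  have "\<not> \<gamma> (R x $ 1) < R x $ 2" using xf(2) x(2) eq by blast
  moreover have "\<not> R x $ 2 < \<gamma> (R x $ 1)"
  proof
    assume lt: "R x $ 2 < \<gamma> (R x $ 1)"
    define V where "V = ball p r \<inter> {y. R y $ 2 < \<gamma> (R y $ 1)}"
    have "open V" unfolding V_def by (intro open_Int open_ball open_Collect_less c1 c2)
    moreover have "x \<in> V" using lt x(2) by (simp add: V_def)
    ultimately obtain y where "y \<in> V" "y \<in> \<Omega>" using xf(1) by (meson closure_iff_nhds_not_empty disjoint_iff order_refl)
    then have "y \<in> \<Omega> \<inter> ball p r" "R y $ 2 < \<gamma> (R y $ 1)" by (auto simp: V_def)
    then show False unfolding eq by auto
  qed
  ultimately show ?thesis by linarith
qed

text \<open>Near each boundary point the frontier lies in a rotated graph over an interval, a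
  Lipschitz image with constant 1 + L; compactness leaves finitely many such pieces. Finite length
  turns L^q convergence of boundary values into L^1 convergence.\<close>

lemma emeasure_hausdorff1_frontier_finite:
  assumes "bounded_lipschitz_domain \<Omega>"
  shows "emeasure hausdorff1 (frontier \<Omega>) < \<infinity>"
proof -
  have \<Omega>: "open \<Omega>" "bounded \<Omega>" "lipschitz_boundary \<Omega>"
    using assms by (auto simp: bounded_lipschitz_domain_def)
  have "\<exists>r>0. emeasure hausdorff1 (frontier \<Omega> \<inter> ball p r) < \<infinity>" if p: "p \<in> frontier \<Omega>" for p
  proof -
    obtain r :: real and R :: "plane \<Rightarrow> plane" and \<gamma> :: "real \<Rightarrow> real" and L where r: "r > 0" and R: "orthogonal_transformation R" and \<gamma>: "L-lipschitz_on UNIV \<gamma>"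
      and eq: "\<Omega> \<inter> ball p r = {x \<in> ball p r. \<gamma> (R x $ 1) < R x $ 2}"
      using \<Omega>(3) p unfolding lipschitz_boundary_def by blast
    define S where "S = inv R"
    have S: "orthogonal_transformation S" unfolding S_def using R by (rule orthogonal_transformation_inv)
    have SR: "S (R x) = x" for x unfolding S_def using orthogonal_transformation_bij[OF R] by (simp add: bij_is_inj)
    define g :: "real \<Rightarrow> plane" where "g s = S (vector [s, \<gamma> s])" for s
    define c where "c = R p $ 1"
    have linS: "linear S" using S by (rule orthogonal_transformation_linear)
    have L: "L \<ge> 0" using \<gamma> by (rule lipschitz_on_nonneg)
    have lip: "(1 + L)-lipschitz_on {c - r..c + r} g"
    proof (rule lipschitz_onI)
      fix s t
      have "dist (g s) (g t) = norm (S (vector [s, \<gamma> s] - vector [t, \<gamma> t]))"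
        unfolding g_def dist_norm by (simp add: linear_diff[OF linS])
      also have "\<dots> = norm (vector [s, \<gamma> s] - vector [t, \<gamma> t] :: plane)"
        using S by (simp add: orthogonal_transformation_norm)
      also have "\<dots> \<le> (\<Sum>k\<in>UNIV. \<bar>(vector [s, \<gamma> s] - vector [t, \<gamma> t] :: plane) $ k\<bar>)"
        by (rule norm_le_l1_cart)
      also have "\<dots> = dist s t + dist (\<gamma> s) (\<gamma> t)" by (simp add: sum_2 dist_real_def)
      also have "\<dots> \<le> dist s t + L * dist s t" using lipschitz_onD[OF \<gamma>, of s t] by simp
      finally show "dist (g s) (g t) \<le> (1 + L) * dist s t" by (simp add: algebra_simps)
    qed (use L in auto)
    have "frontier \<Omega> \<inter> ball p r \<subseteq> g ` {c - r..c + r}"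
    proof
      fix x assume x: "x \<in> frontier \<Omega> \<inter> ball p r"
      then have gr: "R x $ 2 = \<gamma> (R x $ 1)"
        using frontier_subset_lipschitz_graph[OF \<Omega>(1) R \<gamma> eq, of x] by auto
      have "vector [R x $ 1, \<gamma> (R x $ 1)] = R x"
        by (simp add: vec_eq_iff forall_2 gr)
      then have "x = g (R x $ 1)" by (simp add: g_def SR)
      moreover have "R x $ 1 \<in> {c - r..c + r}"
      proof -
        have "\<bar>R x $ 1 - c\<bar> \<le> norm (R x - R p)" using component_le_norm_cart[of "R x - R p" 1] by (simp add: c_def)
        also have "\<dots> = norm (x - p)"
          using R by (metis linear_diff orthogonal_transformation_linear orthogonal_transformation_norm)
        also have "\<dots> < r" using x by (simp add: dist_norm norm_minus_commute)
        finally show ?thesis by auto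
      qed
      ultimately show "x \<in> g ` {c - r..c + r}" by blast
    qed
    moreover have gc: "compact (g ` {c - r..c + r})"
      using lipschitz_on_continuous_on[OF lip] by (intro compact_continuous_image) auto
    ultimately have "emeasure hausdorff1 (frontier \<Omega> \<inter> ball p r) \<le> emeasure hausdorff1 (g ` {c - r..c + r})"
      by (intro emeasure_mono) (auto intro: borel_compact)
    also have "\<dots> = hausdorff1_outer (g ` {c - r..c + r})"
      using gc by (intro emeasure_hausdorff1) (auto intro: borel_compact)
    also have "\<dots> \<le> ennreal ((1 + L) * ((c + r) - (c - r)))"
      using lip r by (intro hausdorff1_outer_lipschitz_image) auto
    also have "\<dots> < \<infinity>" by simp
    finally show ?thesis using r by blast
  qed
  then obtain \<rho> where \<rho>: "\<And>p. p \<in> frontier \<Omega> \<Longrightarrow> \<rho> p > 0"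
    "\<And>p. p \<in> frontier \<Omega> \<Longrightarrow> emeasure hausdorff1 (frontier \<Omega> \<inter> ball p (\<rho> p)) < \<infinity>" by metis
  have cpt: "compact (frontier \<Omega>)" using \<Omega>(2) by (rule compact_frontier_bounded)
  obtain F where F: "F \<subseteq> frontier \<Omega>" "finite F" "frontier \<Omega> \<subseteq> (\<Union>p\<in>F. ball p (\<rho> p))"
  proof (rule compactE_image[OF cpt, of "frontier \<Omega>" "\<lambda>p. ball p (\<rho> p)"])
    show "frontier \<Omega> \<subseteq> (\<Union>p\<in>frontier \<Omega>. ball p (\<rho> p))" using \<rho>(1) by force
  qed auto
  have "frontier \<Omega> = (\<Union>p\<in>F. frontier \<Omega> \<inter> ball p (\<rho> p))" using F(3) by blast
  then have "emeasure hausdorff1 (frontier \<Omega>) = emeasure hausdorff1 (\<Union>p\<in>F. frontier \<Omega> \<inter> ball p (\<rho> p))"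
    by simp
  also have "\<dots> \<le> (\<Sum>p\<in>F. emeasure hausdorff1 (frontier \<Omega> \<inter> ball p (\<rho> p)))"
    using F by (intro emeasure_subadditive_finite) (auto simp: borel_closed)
  also have "\<dots> < \<infinity>" using F \<rho>(2) by (auto simp: ennreal_sum_less_top)
  finally show ?thesis .
qed

subsection \<open>Smooth test functions\<close>

text \<open>The classical flat function exp(-1/t), divided by powers of t so that the family is
  closed under differentiation up to linear combinations.\<close>

definition flat_exp :: "nat \<Rightarrow> real \<Rightarrow> real" where
  "flat_exp k t = (if 0 < t then exp (- 1 / t) / t ^ k else 0)"

text \<open>A single term of the exponential series at 1/t, of order k + 2, already beats the pole.
  The spare factor t^2 makes the difference quotient at 0 tend to 0.\<close>

lemma flat_exp_abs_le: "\<bar>flat_exp k t\<bar> \<le> fact (k + 2) * t\<^sup>2"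
proof (cases "t > 0")
  case True
  have "(\<Sum>n\<in>{k + 2}. (1 / t) ^ n /\<^sub>R fact n) \<le> (\<Sum>n. (1 / t) ^ n /\<^sub>R fact n)"
    using True by (intro sum_le_suminf summable_exp_generic) auto
  then have "inverse (exp (1 / t)) \<le> inverse ((1 / t) ^ (k + 2) / fact (k + 2))"
    using True by (intro le_imp_inverse_le) (auto simp: exp_def divide_inverse mult.commute)
  then have le: "exp (- 1 / t) \<le> fact (k + 2) * t ^ (k + 2)"
    using True by (simp add: exp_minus power_divide mult.commute del: fact_Suc power_Suc add_2_eq_Suc')
  have "exp (- 1 / t) / t ^ k \<le> fact (k + 2) * t ^ (k + 2) / t ^ k"
    using True le by (intro divide_right_mono) auto
  also have "\<dots> = fact (k + 2) * t\<^sup>2" using True by (simp add: power_add power2_eq_square)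
  finally show ?thesis using True by (simp add: flat_exp_def)
qed (simp add: flat_exp_def)

lemma has_derivative_flat_exp:
  "(flat_exp k has_real_derivative flat_exp (k + 2) t - real k * flat_exp (k + 1) t) (at t)"
proof -
  consider "t > 0" | "t < 0" | "t = 0" by linarith
  then show ?thesis
  proof cases
    case 1
    have "((\<lambda>t. exp (- 1 / t) / t ^ k) has_real_derivative flat_exp (k + 2) t - real k * flat_exp (k + 1) t) (at t)"
      using 1 by (auto intro!: derivative_eq_intros simp: flat_exp_def field_simps power_add power2_eq_square)
        (cases k; simp add: field_simps)
    then show ?thesis
      by (rule has_field_derivative_transform_within_open[of _ _ _ "{0<..}"]) (use 1 in \<open>auto simp: flat_exp_def\<close>)
  next
    case 2
    have "((\<lambda>t. 0) has_real_derivative 0) (at t)" by simp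
    then have "(flat_exp k has_real_derivative 0) (at t)"
      by (rule has_field_derivative_transform_within_open[of _ _ _ "{..<0}"]) (use 2 in \<open>auto simp: flat_exp_def\<close>)
    then show ?thesis using 2 by (simp add: flat_exp_def)
  next
    case 3
    have "((\<lambda>h. flat_exp k h / h) \<longlongrightarrow> 0) (at 0)"
    proof (rule Lim_null_comparison)
      show "eventually (\<lambda>h. norm (flat_exp k h / h) \<le> fact (k + 2) * \<bar>h\<bar>) (at 0)"
      proof -
        have "norm (flat_exp k h / h) \<le> fact (k + 2) * \<bar>h\<bar>" if "h \<noteq> 0" for h :: real
          using flat_exp_abs_le[of k h] that by (simp add: abs_divide divide_le_eq power2_eq_square mult.assoc)
        then show ?thesis unfolding eventually_at_filter by (intro always_eventually) auto
      qed
      show "((\<lambda>h. fact (k + 2) * \<bar>h\<bar>) \<longlongrightarrow> (0::real)) (at 0)" by (auto intro!: tendsto_eq_intros)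
    qed
    then show ?thesis unfolding 3 DERIV_def by (simp add: flat_exp_def)
  qed
qed

text \<open>This class is closed under \<open>partial\<close>, so that membership yields all orders of
  differentiability at once, without formulas for higher derivatives.\<close>

inductive elementary_smooth :: "(plane \<Rightarrow> real) \<Rightarrow> bool" where
  const: "elementary_smooth (\<lambda>x. c)"
| coord: "elementary_smooth (\<lambda>x. x $ i)"
| flat: "elementary_smooth f \<Longrightarrow> elementary_smooth (\<lambda>x. flat_exp k (f x))"
| exp: "elementary_smooth f \<Longrightarrow> elementary_smooth (\<lambda>x. exp (f x))"
| add: "elementary_smooth f \<Longrightarrow> elementary_smooth g \<Longrightarrow> elementary_smooth (\<lambda>x. f x + g x)"
| mult: "elementary_smooth f \<Longrightarrow> elementary_smooth g \<Longrightarrow> elementary_smooth (\<lambda>x. f x * g x)"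

lemma partial_eqI: "(f has_derivative D) (at x) \<Longrightarrow> partial j f x = D (axis j 1)"
  unfolding partial_def using frechet_derivative_at by metis

lemma has_derivative_frechet:
  "f differentiable at x \<Longrightarrow> (f has_derivative frechet_derivative f (at x)) (at x)"
  by (simp add: frechet_derivative_works)

lemma elementary_smooth_partial:
  assumes "elementary_smooth f"
  shows "(\<forall>x. f differentiable at x) \<and> (\<forall>j. elementary_smooth (partial j f))"
  using assms
proof induction
  case (const c)
  have "partial j (\<lambda>x. c) = (\<lambda>x. 0)" for j
    by (rule ext, rule partial_eqI[THEN trans]) (auto intro: derivative_intros)
  then show ?case by (auto intro: elementary_smooth.const)
next
  case (coord i)
  have d: "((\<lambda>x :: plane. x $ i) has_derivative (\<lambda>h. h $ i)) (at x)" for x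
    by (rule bounded_linear_imp_has_derivative[OF bounded_linear_vec_nth])
  have "partial j (\<lambda>x. x $ i) = (\<lambda>x. axis j 1 $ i)" for j
    by (rule ext) (rule partial_eqI[OF d])
  then show ?case using d by (auto intro: elementary_smooth.const simp: differentiable_def)
next
  case (flat f k)
  have d: "((\<lambda>x. flat_exp k (f x)) has_derivative
     (\<lambda>h. frechet_derivative f (at x) h * (flat_exp (k + 2) (f x) - real k * flat_exp (k + 1) (f x)))) (at x)" for x
    using has_derivative_compose[OF has_derivative_frechet[OF flat.IH[THEN conjunct1, THEN spec]]
        has_derivative_flat_exp[unfolded has_field_derivative_def]]
    by (simp add: mult.commute)
  have p: "partial j (\<lambda>x. flat_exp k (f x)) = (\<lambda>x. partial j f x * (flat_exp (k + 2) (f x) + (- real k) * flat_exp (k + 1) (f x)))" for j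
    by (rule ext) (simp add: partial_eqI[OF d] partial_def)
  show ?case
  proof (intro conjI allI)
    show "(\<lambda>x. flat_exp k (f x)) differentiable at x" for x using d by (auto simp: differentiable_def)
    show "elementary_smooth (partial j (\<lambda>x. flat_exp k (f x)))" for j
      unfolding p by (intro elementary_smooth.intros flat.hyps) (use flat.IH in blast)
  qed
next
  case (exp f)
  have d: "((\<lambda>x. exp (f x)) has_derivative (\<lambda>h. frechet_derivative f (at x) h * exp (f x))) (at x)" for x
    using exp.IH by (auto intro!: derivative_eq_intros has_derivative_frechet)
  have p: "partial j (\<lambda>x. exp (f x)) = (\<lambda>x. partial j f x * exp (f x))" for j
    by (rule ext) (simp add: partial_eqI[OF d] partial_def)
  show ?case unfolding p
    using d exp by (auto intro!: elementary_smooth.intros simp: differentiable_def)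
next
  case (add f g)
  have d: "((\<lambda>x. f x + g x) has_derivative (\<lambda>h. frechet_derivative f (at x) h + frechet_derivative g (at x) h)) (at x)" for x
    using add.IH by (auto intro!: derivative_eq_intros has_derivative_frechet)
  have p: "partial j (\<lambda>x. f x + g x) = (\<lambda>x. partial j f x + partial j g x)" for j
    by (rule ext) (simp add: partial_eqI[OF d] partial_def)
  show ?case unfolding p
    using d add by (auto intro!: elementary_smooth.intros simp: differentiable_def)
next
  case (mult f g)
  have d: "((\<lambda>x. f x * g x) has_derivative (\<lambda>h. f x * frechet_derivative g (at x) h + frechet_derivative f (at x) h * g x)) (at x)" for x
    using mult.IH by (auto intro!: derivative_eq_intros has_derivative_frechet)
  have p: "partial j (\<lambda>x. f x * g x) = (\<lambda>x. f x * partial j g x + partial j f x * g x)" for j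
    by (rule ext) (simp add: partial_eqI[OF d] partial_def)
  show ?case unfolding p
    using d mult by (auto intro!: elementary_smooth.intros simp: differentiable_def)
qed

lemma elementary_smooth_Ck: "elementary_smooth f \<Longrightarrow> Ck k f"
proof (induction k arbitrary: f)
  case 0
  then show ?case using elementary_smooth_partial[OF 0]
    by (auto intro!: continuous_at_imp_continuous_on differentiable_imp_continuous_within)
next
  case (Suc k)
  then show ?case using elementary_smooth_partial[of f] by simp
qed

lemma elementary_smooth_smooth: "elementary_smooth f \<Longrightarrow> smooth f"
  by (simp add: smooth_def elementary_smooth_Ck)

text \<open>Differences are written as sums with constant factors to match the rules of
  \<^const>\<open>elementary_smooth\<close> syntactically.\<close>

definition box_bump :: "plane \<Rightarrow> plane \<Rightarrow> plane \<Rightarrow> real" where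
  "box_bump a b x = flat_exp 0 (x $ 1 + - a $ 1) * flat_exp 0 (b $ 1 + (-1) * x $ 1)
     * (flat_exp 0 (x $ 2 + - a $ 2) * flat_exp 0 (b $ 2 + (-1) * x $ 2))"

lemma flat_exp_0_pos_iff: "0 \<le> flat_exp 0 t" "0 < flat_exp 0 t \<longleftrightarrow> 0 < t" "flat_exp 0 t = 0 \<longleftrightarrow> t \<le> 0"
  by (auto simp: flat_exp_def)

lemma box_bump_nonneg: "0 \<le> box_bump a b x"
  unfolding box_bump_def by (intro mult_nonneg_nonneg flat_exp_0_pos_iff)

lemma box_bump_eq_0_iff: "box_bump a b x = 0 \<longleftrightarrow> x \<notin> box a b"
  unfolding box_bump_def mem_box_cart forall_2 by (auto simp: flat_exp_0_pos_iff)

text \<open>As n grows these functions increase to the indicator of the open box, so testing against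
  them recovers integrals over boxes by dominated convergence.\<close>

lemma smooth_box_approx: "smooth (\<lambda>x. 1 + (-1) * exp ((- real n) * box_bump a b x))"
  unfolding box_bump_def by (intro elementary_smooth_smooth elementary_smooth.intros)

lemma box_approx_test_function:
  assumes "cbox a b \<subseteq> \<Omega>"
  shows "(\<lambda>x. 1 + (-1) * exp ((- real n) * box_bump a b x)) \<in> test_functions \<Omega>"
proof -
  have "1 + (-1) * exp ((- real n) * box_bump a b x) = 0" if "x \<notin> cbox a b" for x
  proof -
    have "x \<notin> box a b" using that box_subset_cbox by blast
    then have "box_bump a b x = 0" by (simp only: box_bump_eq_0_iff simp_thms)
    then show ?thesis by simp
  qed
  then show ?thesis
    unfolding test_functions_def using smooth_box_approx[of n a b] assms
    by (auto intro!: exI[of _ "cbox a b"] compact_cbox)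
qed

subsection \<open>Uniqueness of weak gradients\<close>

lemma smooth_continuous_on: "smooth f \<Longrightarrow> continuous_on UNIV f"
  unfolding smooth_def by (drule spec[of _ 0]) simp

lemma smooth_differentiable: "smooth f \<Longrightarrow> f differentiable at x"
  unfolding smooth_def by (drule spec[of _ "Suc 0"]) simp

lemma smooth_continuous_partial: "smooth f \<Longrightarrow> continuous_on UNIV (partial j f)"
  unfolding smooth_def by (drule spec[of _ "Suc 0"]) simp

lemma measurable_lebesgue_continuous:
  "continuous_on UNIV (f :: plane \<Rightarrow> real) \<Longrightarrow> f \<in> borel_measurable lebesgue"
  by (intro measurable_completion) (simp add: borel_measurable_continuous_onI)

lemma set_integrable_mult_test_function:
  fixes g :: "plane \<Rightarrow> real"
  assumes g: "loc_integrable \<Omega> g" and \<phi>: "\<phi> \<in> test_functions \<Omega>"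
  shows "set_integrable lebesgue \<Omega> (\<lambda>x. g x * \<phi> x)"
proof -
  obtain K where K: "compact K" "K \<subseteq> \<Omega>" "\<And>x. x \<notin> K \<Longrightarrow> \<phi> x = 0" and sm: "smooth \<phi>"
    using \<phi> by (auto simp: test_functions_def)
  have c: "continuous_on UNIV \<phi>" using sm by (rule smooth_continuous_on)
  have m: "\<phi> \<in> borel_measurable lebesgue" using c by (rule measurable_lebesgue_continuous)
  have "compact (\<phi> ` K)" using K c by (intro compact_continuous_image) (auto intro: continuous_on_subset)
  then obtain B where "\<forall>y\<in>\<phi> ` K. norm y \<le> B"
    by (meson compact_imp_bounded bounded_iff)
  then have B: "\<bar>\<phi> x\<bar> \<le> B" if "x \<in> K" for x using that by simp
  have gK: "integrable lebesgue (\<lambda>x. indicator K x *\<^sub>R g x)"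
    using g K by (auto simp: loc_integrable_def set_integrable_def)
  have "integrable lebesgue (\<lambda>x. (indicator K x *\<^sub>R g x) * \<phi> x)"
  proof (rule Bochner_Integration.integrable_bound)
    show "integrable lebesgue (\<lambda>x. B * (indicator K x *\<^sub>R g x))" using gK by (intro integrable_mult_right)
    show "(\<lambda>x. (indicator K x *\<^sub>R g x) * \<phi> x) \<in> borel_measurable lebesgue"
      using gK m by (intro borel_measurable_times) auto
    show "AE x in lebesgue. norm ((indicator K x *\<^sub>R g x) * \<phi> x) \<le> norm (B * (indicator K x *\<^sub>R g x))"
    proof (rule AE_I2)
      fix x
      show "norm ((indicator K x *\<^sub>R g x) * \<phi> x) \<le> norm (B * (indicator K x *\<^sub>R g x))"
      proof (cases "x \<in> K")
        case True
        then have "\<bar>\<phi> x\<bar> \<le> \<bar>B\<bar>" using B[OF True] by linarith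
        then show ?thesis using True by (simp add: abs_mult mult.commute mult_right_mono)
      qed simp
    qed
  qed
  moreover have "(indicator K x *\<^sub>R g x) * \<phi> x = indicator \<Omega> x *\<^sub>R (g x * \<phi> x)" for x
    using K(2) K(3)[of x] by (auto simp: indicator_def)
  ultimately show ?thesis unfolding set_integrable_def by (simp only:)
qed

lemma integral_box_eq_0:
  fixes g :: "plane \<Rightarrow> real"
  assumes g: "loc_integrable \<Omega> g"
    and 0: "\<And>\<phi>. \<phi> \<in> test_functions \<Omega> \<Longrightarrow> (LINT x:\<Omega>|lebesgue. g x * \<phi> x) = 0"
    and ab: "cbox a b \<subseteq> \<Omega>"
  shows "(LINT x:box a b|lebesgue. g x) = 0"
proof -
  define \<phi> where "\<phi> n x = 1 + (-1) * exp ((- real n) * box_bump a b x)" for n x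
  have \<phi>t: "\<phi> n \<in> test_functions \<Omega>" for n unfolding \<phi>_def by (rule box_approx_test_function[OF ab])
  have \<phi>0: "\<phi> n x = 0" if "x \<notin> box a b" for n x
  proof -
    have "box_bump a b x = 0" using that by (simp only: box_bump_eq_0_iff simp_thms)
    then show ?thesis by (simp add: \<phi>_def)
  qed
  have \<phi>b: "\<bar>\<phi> n x\<bar> \<le> 1" for n x
    using box_bump_nonneg[of a b x] by (simp add: \<phi>_def)
  have gC: "integrable lebesgue (\<lambda>x. indicator (cbox a b) x *\<^sub>R g x)"
    using g ab by (auto simp: loc_integrable_def set_integrable_def)
  have "(\<lambda>n. LINT x|lebesgue. indicator \<Omega> x *\<^sub>R (g x * \<phi> n x)) \<longlonglongrightarrow> (LINT x|lebesgue. indicator (box a b) x *\<^sub>R g x)"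
  proof (rule integral_dominated_convergence)
    have "set_integrable lebesgue (box a b) g"
      by (rule set_integrable_subset[of _ "cbox a b"]) (use gC in \<open>auto simp: box_subset_cbox set_integrable_def\<close>)
    then show "(\<lambda>x. indicator (box a b) x *\<^sub>R g x) \<in> borel_measurable lebesgue"
      by (auto simp: set_integrable_def)
    show "(\<lambda>x. indicator \<Omega> x *\<^sub>R (g x * \<phi> n x)) \<in> borel_measurable lebesgue" for n
      using set_integrable_mult_test_function[OF g \<phi>t] by (auto simp: set_integrable_def)
    show "integrable lebesgue (\<lambda>x. \<bar>indicator (cbox a b) x *\<^sub>R g x\<bar>)" using gC by (rule integrable_abs)
    show "AE x in lebesgue. (\<lambda>n. indicator \<Omega> x *\<^sub>R (g x * \<phi> n x)) \<longlonglongrightarrow> indicator (box a b) x *\<^sub>R g x"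
    proof (rule AE_I2)
      fix x
      show "(\<lambda>n. indicator \<Omega> x *\<^sub>R (g x * \<phi> n x)) \<longlonglongrightarrow> indicator (box a b) x *\<^sub>R g x"
      proof (cases "x \<in> box a b")
        case True
        then have x\<Omega>: "x \<in> \<Omega>" using ab box_subset_cbox by blast
        have pos: "box_bump a b x > 0"
          using True box_bump_eq_0_iff[of a b x] box_bump_nonneg[of a b x] by linarith
        have "(\<lambda>n. exp (- box_bump a b x) ^ n) \<longlonglongrightarrow> 0" using pos by (intro LIMSEQ_realpow_zero) auto
        moreover have "exp (- box_bump a b x) ^ n = exp ((- real n) * box_bump a b x)" for n
          by (simp add: exp_of_nat_mult[symmetric])
        ultimately have "(\<lambda>n. \<phi> n x) \<longlonglongrightarrow> 1 + (-1) * 0" unfolding \<phi>_def by (intro tendsto_intros) simp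
        then have "(\<lambda>n. g x * \<phi> n x) \<longlonglongrightarrow> g x * 1" by (intro tendsto_intros) simp
        then show ?thesis using True x\<Omega> by simp
      next
        case False
        then show ?thesis by (simp add: \<phi>0)
      qed
    qed
    show "AE x in lebesgue. norm (indicator \<Omega> x *\<^sub>R (g x * \<phi> n x)) \<le> \<bar>indicator (cbox a b) x *\<^sub>R g x\<bar>" for n
    proof (rule AE_I2)
      fix x
      show "norm (indicator \<Omega> x *\<^sub>R (g x * \<phi> n x)) \<le> \<bar>indicator (cbox a b) x *\<^sub>R g x\<bar>"
      proof (cases "x \<in> box a b")
        case True
        then have "x \<in> \<Omega>" "x \<in> cbox a b" using ab box_subset_cbox by blast+
        then show ?thesis using \<phi>b[of n x] by (simp add: abs_mult mult_left_le)
      qed (simp add: \<phi>0)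
    qed
  qed
  moreover have "(LINT x|lebesgue. indicator \<Omega> x *\<^sub>R (g x * \<phi> n x)) = 0" for n
    using 0[OF \<phi>t] by (simp add: set_lebesgue_integral_def)
  ultimately show ?thesis by (simp add: set_lebesgue_integral_def LIMSEQ_const_iff)
qed

text \<open>Boxes are stable under intersection and generate the Borel sets, so Dynkin's argument
  applies; its complement step is where the vanishing of the total integral enters. Lebesgue sets
  differ from Borel sets by null sets.\<close>

lemma AE_eq_0_if_box_integrals_eq_0:
  fixes f :: "'a::euclidean_space \<Rightarrow> real"
  assumes f: "integrable lebesgue f"
    and univ: "integral\<^sup>L lebesgue f = 0" and box: "\<And>a b. (LINT x:box a b|lebesgue. f x) = 0"
  shows "AE x in lebesgue. f x = 0"
proof (rule density_unique_real[OF f])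
  have borel: "(LINT x:A|lebesgue. f x) = 0" if "A \<in> sets borel" for A
  proof -
    let ?G = "range (\<lambda>(a, b). box a b :: 'a set)"
    have G: "Int_stable ?G" "?G \<subseteq> Pow UNIV" by (auto simp: Int_stable_def box_Int_box)
    have eq: "sigma_sets UNIV ?G = sets borel" by (simp add: borel_eq_box)
    have A: "A \<in> sigma_sets UNIV ?G" using that eq by simp
    have si: "set_integrable lebesgue B f" if "B \<in> sets borel" for B
      unfolding set_integrable_def using f that by (intro integrable_mult_indicator) auto
    from G A show ?thesis
    proof (induction rule: sigma_sets_induct_disjoint)
      case (basic A)
      then show ?case using box by auto
    next
      case empty
      then show ?case by (simp add: set_lebesgue_integral_def)
    next
      case (compl A)
      have Ab: "A \<in> sets borel" using compl eq by simp
      have "(LINT x:UNIV|lebesgue. f x) = (LINT x:A \<union> (UNIV - A)|lebesgue. f x)" by simp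
      also have "\<dots> = (LINT x:A|lebesgue. f x) + (LINT x:UNIV - A|lebesgue. f x)"
        using Ab by (intro set_integral_Un si) auto
      finally show ?case using compl univ by (simp add: set_lebesgue_integral_def)
    next
      case (union A)
      have Ab: "A i \<in> sets borel" for i using union eq by auto
      have "(LINT x:(\<Union>i. A i)|lebesgue. f x) = (\<Sum>i. LINT x:A i|lebesgue. f x)"
        using Ab union(1) by (intro lebesgue_integral_countable_add si) (auto simp: disjoint_family_on_def)
      then show ?case using union by simp
    qed
  qed
  fix A :: "'a set" assume "A \<in> sets lebesgue"
  then obtain S N N' where A: "A = S \<union> N" "N \<subseteq> N'" "N' \<in> null_sets lborel" "S \<in> sets lborel"
    by (rule sets_completionE)
  have "N' \<in> null_sets lebesgue" using A(3) by (rule null_sets_completionI)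
  then have ae: "AE x in lebesgue. x \<notin> N'" by (rule AE_not_in)
  have "(LINT x:A|lebesgue. f x) = (LINT x:S|lebesgue. f x)"
    unfolding set_lebesgue_integral_def
  proof (rule integral_cong_AE)
    show "(\<lambda>x. indicator A x *\<^sub>R f x) \<in> borel_measurable lebesgue"
      using f \<open>A \<in> sets lebesgue\<close> by (intro borel_measurable_scaleR borel_measurable_indicator) auto
    show "(\<lambda>x. indicator S x *\<^sub>R f x) \<in> borel_measurable lebesgue"
      using f A(4) by (intro borel_measurable_scaleR borel_measurable_indicator) auto
    show "AE x in lebesgue. indicator A x *\<^sub>R f x = indicator S x *\<^sub>R f x"
      using ae by eventually_elim (use A in \<open>auto simp: indicator_def\<close>)
  qed
  then show "(LINT x:A|lebesgue. f x) = (LINT x:A|lebesgue. 0)" using borel[of S] A(4) by simp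
qed simp

text \<open>Countably many closed boxes exhaust the open set. On the interior of each, g becomes
  integrable over the whole plane after cutting off, all its box integrals vanish because boxes
  intersect in boxes, and the faces are null.\<close>

lemma fundamental_lemma_calculus_of_variations:
  fixes g :: "plane \<Rightarrow> real"
  assumes \<Omega>: "open \<Omega>" and g: "loc_integrable \<Omega> g"
    and 0: "\<And>\<phi>. \<phi> \<in> test_functions \<Omega> \<Longrightarrow> (LINT x:\<Omega>|lebesgue. g x * \<phi> x) = 0"
  shows "AE x in lebesgue. x \<in> \<Omega> \<longrightarrow> g x = 0"
proof -
  obtain \<D> where \<D>: "countable \<D>" "\<D> \<subseteq> Pow \<Omega>" "\<And>X. X \<in> \<D> \<Longrightarrow> \<exists>a b. X = cbox a b" "\<Union>\<D> = \<Omega>"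
    using open_countable_Union_open_cbox[OF \<Omega>] by metis
  have "AE x in lebesgue. x \<in> X \<longrightarrow> g x = 0" if XD: "X \<in> \<D>" for X
  proof -
    obtain a b where X: "X = cbox a b" using \<D>(3)[OF XD] by blast
    then have ab: "cbox a b \<subseteq> \<Omega>" using \<D>(2) XD by auto
    define f where "f x = indicator (box a b) x * g x" for x
    have gC: "set_integrable lebesgue (cbox a b) g" using g ab by (auto simp: loc_integrable_def)
    have "set_integrable lebesgue (box a b) g"
      by (rule set_integrable_subset[OF gC]) (auto simp: box_subset_cbox)
    then have f: "integrable lebesgue f" by (simp add: set_integrable_def f_def[abs_def])
    have box0: "(LINT x:box c d|lebesgue. g x) = 0" if "box c d \<subseteq> box a b" for c d
    proof (cases "box c d = {}")
      case True
      then show ?thesis by (simp add: set_lebesgue_integral_def)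
    next
      case False
      then have "box a b \<noteq> {}" using that by blast
      then have "cbox c d \<subseteq> cbox a b" using closure_mono[OF that] closure_box[OF False] closure_box by metis
      then show ?thesis using integral_box_eq_0[OF g 0] ab by auto
    qed
    have "AE x in lebesgue. f x = 0"
    proof (rule AE_eq_0_if_box_integrals_eq_0[OF f])
      show "integral\<^sup>L lebesgue f = 0"
        using box0[of a b] by (simp add: f_def[abs_def] set_lebesgue_integral_def)
      fix c d :: plane
      obtain p r where pr: "box c d \<inter> box a b = box p r" using box_Int_box by blast
      have "(LINT x:box c d|lebesgue. f x) = (LINT x:box p r|lebesgue. g x)"
        unfolding set_lebesgue_integral_def pr[symmetric] f_def
        by (intro Bochner_Integration.integral_cong) (auto simp: indicator_def)
      then show "(LINT x:box c d|lebesgue. f x) = 0" using box0[of p r] pr by auto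
    qed
    moreover have "AE x in lebesgue. x \<notin> cbox a b - box a b"
      using AE_not_in[of "cbox a b - box a b" lebesgue] negligible_frontier_interval[of a b]
      by (simp add: negligible_iff_null_sets)
    ultimately show ?thesis
      unfolding X by eventually_elim (auto simp: f_def indicator_def split: if_splits)
  qed
  then have "AE x in lebesgue. \<forall>X\<in>\<D>. x \<in> X \<longrightarrow> g x = 0" unfolding AE_ball_countable[OF \<D>(1)] by blast
  then show ?thesis by eventually_elim (use \<D>(4) in auto)
qed

lemma loc_integrable_bounded_linear:
  fixes T :: "'b::euclidean_space \<Rightarrow> 'c::euclidean_space"
  assumes T: "bounded_linear T" and f: "loc_integrable \<Omega> f"
  shows "loc_integrable \<Omega> (\<lambda>x. T (f x))"
  unfolding loc_integrable_def
proof (intro conjI allI impI)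
  show "(\<lambda>x. T (f x)) \<in> borel_measurable (lebesgue_on \<Omega>)"
    using f borel_measurable_continuous_onI[OF linear_continuous_on[OF T, of UNIV]]
    unfolding loc_integrable_def by (auto intro: measurable_compose)
  fix K assume "compact K \<and> K \<subseteq> \<Omega>"
  then have "integrable lebesgue (\<lambda>x. indicator K x *\<^sub>R f x)" using f by (auto simp: loc_integrable_def set_integrable_def)
  then have "integrable lebesgue (\<lambda>x. T (indicator K x *\<^sub>R f x))" by (rule integrable_bounded_linear[OF T])
  then show "set_integrable lebesgue K (\<lambda>x. T (f x))"
    by (simp add: set_integrable_def linear_cmul[OF bounded_linear.linear[OF T]])
qed

lemma loc_integrable_diff:
  assumes "loc_integrable \<Omega> f" "loc_integrable \<Omega> g"
  shows "loc_integrable \<Omega> (\<lambda>x. f x - g x)"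
  using assms by (auto simp: loc_integrable_def intro!: set_integral_diff borel_measurable_diff)

lemma bounded_linear_mat_entry: "bounded_linear (\<lambda>A :: mat2. A $ i $ j)"
  by (rule bounded_linear_compose[OF bounded_linear_vec_nth bounded_linear_vec_nth])

text \<open>Since \<open>weak_gradient\<close> is an arbitrary choice, the energy of the linear map
  can be computed only after its gradient is known to be determined almost everywhere.\<close>

lemma has_weak_gradient_unique:
  assumes \<Omega>: "open \<Omega>" and G: "has_weak_gradient \<Omega> u G" and G': "has_weak_gradient \<Omega> u G'"
  shows "AE x in lebesgue. x \<in> \<Omega> \<longrightarrow> G x = G' x"
proof -
  have "AE x in lebesgue. x \<in> \<Omega> \<longrightarrow> G x $ i $ j - G' x $ i $ j = 0" for i j
  proof (rule fundamental_lemma_calculus_of_variations[OF \<Omega>])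
    have l: "loc_integrable \<Omega> (\<lambda>x. G x $ i $ j)" "loc_integrable \<Omega> (\<lambda>x. G' x $ i $ j)"
      using G G' by (auto simp: has_weak_gradient_def intro: loc_integrable_bounded_linear[OF bounded_linear_mat_entry])
    then show "loc_integrable \<Omega> (\<lambda>x. G x $ i $ j - G' x $ i $ j)" by (rule loc_integrable_diff)
    fix \<phi> assume \<phi>: "\<phi> \<in> test_functions \<Omega>"
    have "(LINT x:\<Omega>|lebesgue. (G x $ i $ j - G' x $ i $ j) * \<phi> x)
      = (LINT x:\<Omega>|lebesgue. G x $ i $ j * \<phi> x) - (LINT x:\<Omega>|lebesgue. G' x $ i $ j * \<phi> x)"
      unfolding left_diff_distrib
      by (intro set_integral_diff set_integrable_mult_test_function l \<phi>)
    also have "\<dots> = 0"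
    proof -
      have "(LINT x:\<Omega>|lebesgue. u x $ i * partial j \<phi> x) = - (LINT x:\<Omega>|lebesgue. G x $ i $ j * \<phi> x)"
        "(LINT x:\<Omega>|lebesgue. u x $ i * partial j \<phi> x) = - (LINT x:\<Omega>|lebesgue. G' x $ i $ j * \<phi> x)"
        using G G' \<phi> unfolding has_weak_gradient_def by blast+
      then show ?thesis by simp
    qed
    finally show "(LINT x:\<Omega>|lebesgue. (G x $ i $ j - G' x $ i $ j) * \<phi> x) = 0" .
  qed
  then have "AE x in lebesgue. \<forall>i\<in>UNIV. \<forall>j\<in>UNIV. x \<in> \<Omega> \<longrightarrow> G x $ i $ j - G' x $ i $ j = 0"
    by (intro AE_ball_countable[THEN iffD2] ballI) (auto intro: countable_finite)
  then show ?thesis by eventually_elim (simp add: vec_eq_iff)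
qed

subsection \<open>Traces and the excess\<close>

lemma integrable_lebesgue_compact_continuous:
  fixes f :: "plane \<Rightarrow> 'b::euclidean_space"
  assumes "compact K" "continuous_on UNIV f"
  shows "set_integrable lebesgue K f"
proof -
  have "integrable lborel (\<lambda>x. indicator K x *\<^sub>R f x)"
    using assms by (intro borel_integrable_compact) (auto intro: continuous_on_subset)
  then show ?thesis unfolding set_integrable_def
    by (subst integrable_completion) auto
qed

lemma set_integrable_lebesgue_bounded_continuous:
  fixes f :: "plane \<Rightarrow> 'b::euclidean_space"
  assumes "bounded \<Omega>" "open \<Omega>" "continuous_on UNIV f"
  shows "set_integrable lebesgue \<Omega> f"
  by (rule set_integrable_subset[OF integrable_lebesgue_compact_continuous[of "closure \<Omega>"]])
    (use assms closure_subset in auto)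

lemma loc_integrable_continuous:
  fixes f :: "plane \<Rightarrow> 'b::euclidean_space"
  assumes "continuous_on UNIV f"
  shows "loc_integrable \<Omega> f"
proof -
  have "f \<in> borel_measurable lebesgue"
    using assms by (intro measurable_completion) (simp add: borel_measurable_continuous_onI)
  then have "f \<in> borel_measurable (lebesgue_on \<Omega>)" by (rule measurable_restrict_space1)
  then show ?thesis
    unfolding loc_integrable_def using integrable_lebesgue_compact_continuous[OF _ assms] by blast
qed

text \<open>Integration by parts from the boundary estimate: the product of a test function with a
  component of the linear map vanishes on the frontier, so the integral of its partial derivative is
  0.\<close>

lemma has_weak_gradient_u_lin:
  assumes \<Omega>: "open \<Omega>" "bounded \<Omega>"
  shows "has_weak_gradient \<Omega> (u_lin lam) (\<lambda>_. lam *\<^sub>R mat 1)"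
  unfolding has_weak_gradient_def
proof (intro conjI ballI allI)
  show "loc_integrable \<Omega> (u_lin lam)" unfolding u_lin_def
    by (intro loc_integrable_continuous continuous_intros)
  show "loc_integrable \<Omega> (\<lambda>_. lam *\<^sub>R mat 1 :: mat2)"
    by (intro loc_integrable_continuous continuous_intros)
  fix \<phi> and i j :: 2 assume \<phi>: "\<phi> \<in> test_functions \<Omega>"
  then obtain K where K: "K \<subseteq> \<Omega>" "\<And>x. x \<notin> K \<Longrightarrow> \<phi> x = 0" and sm: "smooth \<phi>"
    by (auto simp: test_functions_def)
  define w where "w x = (lam * x $ i) * \<phi> x" for x :: plane
  have d: "(w has_derivative (\<lambda>h. (lam * x $ i) * frechet_derivative \<phi> (at x) h + (lam * h $ i) * \<phi> x)) (at x)" for x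
    unfolding w_def using smooth_differentiable[OF sm]
    by (auto intro!: derivative_eq_intros has_derivative_frechet bounded_linear_imp_has_derivative[OF bounded_linear_vec_nth])
  have p: "partial j w = (\<lambda>x. (lam *\<^sub>R x) $ i * partial j \<phi> x + (lam *\<^sub>R mat 1 :: mat2) $ i $ j * \<phi> x)"
    by (rule ext) (simp add: partial_eqI[OF d] partial_def[of j \<phi>] mat_def axis_def)
  have c1: "continuous_on UNIV (\<lambda>x. (lam *\<^sub>R x) $ i * partial j \<phi> x)"
    and c2: "continuous_on UNIV (\<lambda>x. (lam *\<^sub>R mat 1 :: mat2) $ i $ j * \<phi> x)"
    using smooth_continuous_partial[OF sm] smooth_continuous_on[OF sm] by (auto intro!: continuous_intros)
  have "ennreal \<bar>LINT x:\<Omega>|lebesgue. partial j w x\<bar> \<le> 4 * (\<integral>\<^sup>+ x\<in>frontier \<Omega>. ennreal \<bar>w x\<bar> \<partial>hausdorff1)"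
  proof (rule abs_integral_partial_le_boundary[OF \<Omega>])
    show "w differentiable at x" for x using d by (auto simp: differentiable_def)
    show "continuous_on UNIV (partial j w)" unfolding p using c1 c2 by (rule continuous_on_add)
  qed
  also have "(\<integral>\<^sup>+ x\<in>frontier \<Omega>. ennreal \<bar>w x\<bar> \<partial>hausdorff1) = (\<integral>\<^sup>+ x. 0 \<partial>hausdorff1)"
  proof (rule nn_integral_cong)
    fix x
    have "w x = 0" if "x \<in> frontier \<Omega>"
    proof -
      have "x \<notin> \<Omega>" using that \<Omega>(1) by (simp add: frontier_def interior_open)
      then show ?thesis using K by (auto simp: w_def)
    qed
    then show "ennreal \<bar>w x\<bar> * indicator (frontier \<Omega>) x = 0" by (auto simp: indicator_def)
  qed
  finally have "(LINT x:\<Omega>|lebesgue. partial j w x) = 0" by simp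
  then have "(LINT x:\<Omega>|lebesgue. (lam *\<^sub>R x) $ i * partial j \<phi> x)
     + (LINT x:\<Omega>|lebesgue. (lam *\<^sub>R mat 1 :: mat2) $ i $ j * \<phi> x) = 0"
    unfolding p using \<Omega> c1 c2
    by (subst (asm) set_integral_add) (auto intro!: set_integrable_lebesgue_bounded_continuous)
  then show "(LINT x:\<Omega>|lebesgue. u_lin lam x $ i * partial j \<phi> x)
    = - (LINT x:\<Omega>|lebesgue. (lam *\<^sub>R mat 1 :: mat2) $ i $ j * \<phi> x)"
    unfolding u_lin_def by linarith
qed

lemma weak_gradient_u_lin:
  assumes \<Omega>: "open \<Omega>" "bounded \<Omega>"
  shows "AE x in lebesgue_on \<Omega>. weak_gradient \<Omega> (u_lin lam) x = lam *\<^sub>R mat 1"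
proof -
  have "has_weak_gradient \<Omega> (u_lin lam) (weak_gradient \<Omega> (u_lin lam))"
    unfolding weak_gradient_def using exI[of "has_weak_gradient \<Omega> (u_lin lam)", OF has_weak_gradient_u_lin[OF \<Omega>]]
    by (rule someI_ex)
  from has_weak_gradient_unique[OF \<Omega>(1) this has_weak_gradient_u_lin[OF \<Omega>]]
  show ?thesis using \<Omega>(1) by (simp add: AE_restrict_space_iff)
qed

text \<open>On a finite measure space the splitting r \<le> \<eta> + \<eta>^(1-q) r^q reduces L^1 to
  L^q convergence: below \<eta> the first term suffices, above it the second. It serves both for
  gradients in the domain and for arc length on the boundary.\<close>

lemma nn_integral_norm_tendsto_0:
  fixes f :: "nat \<Rightarrow> 'a \<Rightarrow> 'b::euclidean_space"
  assumes fin: "emeasure M (space M) < \<infinity>" and q: "1 < q"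
    and [measurable]: "\<And>n. f n \<in> borel_measurable M"
    and lim: "(\<lambda>n. \<integral>\<^sup>+ x. ennreal (norm (f n x) powr q) \<partial>M) \<longlonglongrightarrow> 0"
  shows "(\<lambda>n. \<integral>\<^sup>+ x. ennreal (norm (f n x)) \<partial>M) \<longlonglongrightarrow> 0"
proof (rule order_tendstoI)
  fix a :: ennreal assume a: "0 < a"
  define \<mu> where "\<mu> = measure M (space M)"
  have \<mu>: "emeasure M (space M) = ennreal \<mu>" "\<mu> \<ge> 0" using fin by (auto simp: \<mu>_def emeasure_eq_ennreal_measure)
  obtain e where e: "0 < e" "ennreal e < a"
  proof (cases a)
    case (real r)
    then have "r > 0" using a by simp
    then show ?thesis using that[of "r / 2"] real by (simp add: ennreal_less_iff)
  qed (use that[of 1] in simp)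
  define \<eta> where "\<eta> = e / (2 * (\<mu> + 1))"
  have \<eta>: "\<eta> > 0" "\<eta> * \<mu> \<le> e / 2" using e \<mu> by (auto simp: \<eta>_def field_simps)
  define B where "B = \<eta> powr (1 - q)"
  have B: "B > 0" using \<eta> by (simp add: B_def)
  have pt: "r \<le> \<eta> + B * r powr q" if "r \<ge> 0" for r :: real
  proof (cases "r \<le> \<eta>")
    case True
    then show ?thesis using B by (simp add: add_increasing2)
  next
    case False
    then have r: "r > 0" using \<eta> by linarith
    have "r = r powr (1 - q) * r powr q" using r by (simp add: powr_add[symmetric])
    also have "\<dots> \<le> B * r powr q"
      unfolding B_def using False \<eta> q by (intro mult_right_mono powr_mono2') auto
    finally show ?thesis using \<eta> by linarith
  qed
  have "eventually (\<lambda>n. (\<integral>\<^sup>+ x. ennreal (norm (f n x) powr q) \<partial>M) < ennreal (e / (2 * B))) sequentially"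
    using lim by (rule order_tendstoD) (use e B in auto)
  then show "eventually (\<lambda>n. (\<integral>\<^sup>+ x. ennreal (norm (f n x)) \<partial>M) < a) sequentially"
  proof eventually_elim
    case (elim n)
    have "(\<integral>\<^sup>+ x. ennreal (norm (f n x)) \<partial>M) \<le> (\<integral>\<^sup>+ x. ennreal \<eta> + ennreal B * ennreal (norm (f n x) powr q) \<partial>M)"
    proof (rule nn_integral_mono)
      fix x
      have "ennreal (norm (f n x)) \<le> ennreal (\<eta> + B * norm (f n x) powr q)" by (intro ennreal_leI pt) simp
      then show "ennreal (norm (f n x)) \<le> ennreal \<eta> + ennreal B * ennreal (norm (f n x) powr q)"
        using \<eta> B by (simp add: ennreal_mult')
    qed
    also have "\<dots> = ennreal \<eta> * ennreal \<mu> + ennreal B * (\<integral>\<^sup>+ x. ennreal (norm (f n x) powr q) \<partial>M)"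
      by (simp add: nn_integral_add nn_integral_cmult \<mu>)
    also have "\<dots> \<le> ennreal (e / 2) + ennreal B * ennreal (e / (2 * B))"
      using \<eta>(1) \<mu>(2) elim ennreal_leI[OF \<eta>(2)]
      by (intro add_mono mult_left_mono) (auto simp: ennreal_mult intro: less_imp_le)
    also have "\<dots> = ennreal (e / 2 + B * (e / (2 * B)))"
    proof -
      have "0 \<le> e / 2" "0 \<le> B" "0 \<le> e / (2 * B)" "0 \<le> B * (e / (2 * B))" using e B by auto
      then show ?thesis by (simp only: ennreal_plus ennreal_mult)
    qed
    also have "e / 2 + B * (e / (2 * B)) = e" using B by simp
    finally show ?case using e(2) by (rule order.strict_trans1)
  qed
qed simp

lemma jacobian_smooth:
  fixes v :: "plane \<Rightarrow> plane"
  assumes v: "\<And>i. smooth (\<lambda>x. v x $ i)"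
  shows "jacobian v (at x) $ i $ j = partial j (\<lambda>x. v x $ i) x"
proof -
  define D where "D h = (\<chi> i. frechet_derivative (\<lambda>x. v x $ i) (at x) h)" for h
  have "(v has_derivative D) (at x)"
    unfolding has_derivative_componentwise_within[of v D x UNIV]
  proof
    fix b :: plane assume "b \<in> Basis"
    then obtain k where b: "b = axis k 1" by (auto simp: Basis_vec_def)
    show "((\<lambda>x. v x \<bullet> b) has_derivative (\<lambda>h. D h \<bullet> b)) (at x)"
      unfolding b using has_derivative_frechet[OF smooth_differentiable[OF v[of k]]]
      by (simp add: inner_axis D_def)
  qed
  then have "frechet_derivative v (at x) = D" by (metis frechet_derivative_at)
  then show ?thesis by (simp add: jacobian_def matrix_def D_def partial_def)
qed

lemma abs_trace_le: "\<bar>trace (A :: mat2)\<bar> \<le> 2 * norm A"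
proof -
  have "\<bar>A $ i $ i\<bar> \<le> norm A" for i
    using component_le_norm_cart[of "A $ i" i] Finite_Cartesian_Product.norm_nth_le[of A i] by linarith
  from this[of 1] this[of 2] show ?thesis by (simp add: trace_def sum_2)
qed

lemma bounded_linear_trace: "bounded_linear (trace :: mat2 \<Rightarrow> real)"
  unfolding trace_def[abs_def] by (intro bounded_linear_sum bounded_linear_mat_entry)

text \<open>The boundary estimate is applied to the smooth approximants minus the linear map. Their
  boundary values tend to 0 in L^1, and their Jacobians tend to the weak gradient in L^1, so the
  identity holds in the limit.\<close>

lemma integral_trace_weak_gradient:
  assumes \<Omega>: "bounded_lipschitz_domain \<Omega>" and q: "1 < q" and u: "u \<in> admissible \<Omega> q lam"
  defines "M \<equiv> lebesgue_on \<Omega>"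
  shows "weak_gradient \<Omega> u \<in> borel_measurable M"
    and "integrable M (\<lambda>x. trace (weak_gradient \<Omega> u x))"
    and "(LINT x|M. trace (weak_gradient \<Omega> u x)) = 2 * lam * measure M \<Omega>"
proof -
  have \<Omega>o: "open \<Omega>" "bounded \<Omega>" using \<Omega> by (auto simp: bounded_lipschitz_domain_def)
  have \<Omega>m [simp]: "\<Omega> \<in> sets lebesgue" using \<Omega>o by simp
  define G where "G = weak_gradient \<Omega> u"
  have "\<exists>G. has_weak_gradient \<Omega> u G" using u by (auto simp: admissible_def sobolev_W1_def)
  then have wg: "has_weak_gradient \<Omega> u G" unfolding G_def weak_gradient_def by (rule someI_ex)
  then have Gm: "G \<in> borel_measurable M" by (auto simp: has_weak_gradient_def loc_integrable_def M_def)
  then show "weak_gradient \<Omega> u \<in> borel_measurable M" by (simp add: G_def)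
  have finM: "emeasure M (space M) < \<infinity>"
    using emeasure_bounded_finite[OF \<Omega>o(2)] \<Omega>o(1)
    by (simp add: M_def emeasure_restrict_space space_restrict_space main_part_sets)
  have spM: "space M = \<Omega>" by (simp add: M_def space_restrict_space)
  interpret finite_measure M by (rule finite_measureI) (use finM in simp)
  obtain v where v: "\<And>k i. smooth (\<lambda>x. v k x $ i)"
    and vG: "(\<lambda>k. \<integral>\<^sup>+ x\<in>\<Omega>. ennreal (norm (jacobian (v k) (at x) - G x) powr q) \<partial>lebesgue) \<longlonglongrightarrow> 0"
    and vb: "(\<lambda>k. \<integral>\<^sup>+ x\<in>frontier \<Omega>. ennreal (norm (v k x - u_lin lam x) powr q) \<partial>hausdorff1) \<longlonglongrightarrow> 0"
    using u unfolding admissible_def has_trace_def G_def by blast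
  define J where "J k x = jacobian (v k) (at x)" for k x
  have cJ: "continuous_on UNIV (J k)" for k
  proof -
    have "continuous_on UNIV (\<lambda>x. J k x $ i $ j)" for i j
      unfolding J_def jacobian_smooth[OF v] by (rule smooth_continuous_partial[OF v])
    then show ?thesis by (intro continuous_on_vec_lambda[of UNIV "\<lambda>i x. J k x $ i", simplified]
      continuous_on_vec_lambda[of UNIV "\<lambda>j x. J k x $ i $ j" for i, simplified])
  qed
  have Jm: "J k \<in> borel_measurable M" for k
    using loc_integrable_continuous[OF cJ] by (auto simp: loc_integrable_def M_def)
  define X where "X k = (\<integral>\<^sup>+ x. ennreal (norm (J k x - G x)) \<partial>M)" for k
  have X: "X \<longlonglongrightarrow> 0"
    unfolding X_def
  proof (rule nn_integral_norm_tendsto_0[OF finM q])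
    show "(\<lambda>x. J n x - G x) \<in> borel_measurable M" for n using Jm Gm by (rule borel_measurable_diff)
    show "(\<lambda>n. \<integral>\<^sup>+ x. ennreal (norm (J n x - G x) powr q) \<partial>M) \<longlonglongrightarrow> 0"
      using vG by (simp add: M_def J_def nn_integral_restrict_space)
  qed
  define N where "N = restrict_space hausdorff1 (frontier \<Omega>)"
  have frm: "frontier \<Omega> \<in> sets borel" by (simp add: borel_closed)
  have cv: "continuous_on UNIV (\<lambda>x. v k x - u_lin lam x)" for k
  proof -
    have "continuous_on UNIV (v k)"
      using smooth_continuous_on[OF v] by (intro continuous_on_vec_lambda[of UNIV "\<lambda>i x. v k x $ i", simplified])
    then show ?thesis unfolding u_lin_def by (intro continuous_intros)
  qed
  define Y where "Y k = (\<integral>\<^sup>+ x. ennreal (norm (v k x - u_lin lam x)) \<partial>N)" for k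
  have Y: "Y \<longlonglongrightarrow> 0"
    unfolding Y_def
  proof (rule nn_integral_norm_tendsto_0[OF _ q])
    show "emeasure N (space N) < \<infinity>"
      using emeasure_hausdorff1_frontier_finite[OF \<Omega>] frm
      by (simp add: N_def emeasure_restrict_space space_restrict_space)
    show "(\<lambda>x. v n x - u_lin lam x) \<in> borel_measurable N" for n
      unfolding N_def using borel_measurable_continuous_onI[OF cv] by (intro measurable_restrict_space1) simp
    show "(\<lambda>n. \<integral>\<^sup>+ x. ennreal (norm (v n x - u_lin lam x) powr q) \<partial>N) \<longlonglongrightarrow> 0"
      using vb frm by (simp add: N_def nn_integral_restrict_space)
  qed
  have Jint: "integrable M (J k)" for k
    using set_integrable_lebesgue_bounded_continuous[OF \<Omega>o(2,1) cJ]
    by (simp add: M_def set_integrable_def integrable_restrict_space)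
  \<comment> \<open>One approximant at finite L^1 distance gives integrability of the weak gradient,
    because its own Jacobian is continuous on a bounded domain.\<close>
  obtain k0 where "X k0 < 1" using order_tendstoD(2)[OF X, of 1] by (auto simp: eventually_sequentially)
  then have "integrable M (\<lambda>x. J k0 x - G x)"
    using Jm Gm unfolding X_def by (intro integrableI_bounded borel_measurable_diff) (auto intro: less_trans)
  then have "integrable M (\<lambda>x. J k0 x - (J k0 x - G x))" by (rule Bochner_Integration.integrable_diff[OF Jint])
  moreover have "(\<lambda>x. J k0 x - (J k0 x - G x)) = G" by (rule ext) simp
  ultimately have Gint: "integrable M G" by (simp only:)
  then show tr: "integrable M (\<lambda>x. trace (weak_gradient \<Omega> u x))"
    unfolding G_def by (rule integrable_bounded_linear[OF bounded_linear_trace])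
  have Jtr: "integrable M (\<lambda>x. trace (J k x))" for k
    by (rule integrable_bounded_linear[OF bounded_linear_trace Jint])
  have bdry: "ennreal \<bar>(LINT x|M. trace (J k x)) - 2 * lam * measure M \<Omega>\<bar> \<le> 8 * Y k" for k
  proof -
    \<comment> \<open>The i-th partial derivative of this component is the i-th diagonal entry of
      the Jacobian minus lam; the two entries with constant 4 each give the 8.\<close>
    define w where "w i x = v k x $ i + (- lam) * x $ i" for i x
    have d: "(w i has_derivative (\<lambda>h. frechet_derivative (\<lambda>x. v k x $ i) (at x) h + (- lam) * h $ i)) (at x)" for i x
      unfolding w_def using smooth_differentiable[OF v]
      by (auto intro!: derivative_eq_intros has_derivative_frechet bounded_linear_imp_has_derivative[OF bounded_linear_vec_nth])
    have p: "partial i (w i) = (\<lambda>x. J k x $ i $ i - lam)" for i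
      by (rule ext) (simp add: partial_eqI[OF d] partial_def[of i "\<lambda>x. v k x $ i"] J_def jacobian_smooth[OF v] axis_def)
    have ent: "continuous_on UNIV (\<lambda>x. J k x $ i $ i)" for i using cJ by (intro continuous_intros)
    have each: "ennreal \<bar>LINT x|M. J k x $ i $ i - lam\<bar> \<le> 4 * Y k" for i
    proof -
      have "(LINT x|M. J k x $ i $ i - lam) = (LINT x:\<Omega>|lebesgue. partial i (w i) x)"
        unfolding p M_def set_lebesgue_integral_def by (simp add: integral_restrict_space)
      also have "ennreal \<bar>\<dots>\<bar> \<le> 4 * (\<integral>\<^sup>+ x\<in>frontier \<Omega>. ennreal \<bar>w i x\<bar> \<partial>hausdorff1)"
      proof (rule abs_integral_partial_le_boundary[OF \<Omega>o])
        show "w i differentiable at x" for x using d by (auto simp: differentiable_def)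
        show "continuous_on UNIV (partial i (w i))" unfolding p by (intro continuous_on_diff ent continuous_on_const)
      qed
      also have "\<dots> = 4 * (\<integral>\<^sup>+ x. ennreal \<bar>w i x\<bar> \<partial>N)"
        using frm by (simp add: N_def nn_integral_restrict_space)
      also have "\<dots> \<le> 4 * Y k"
      proof -
        have "\<bar>w i x\<bar> \<le> norm (v k x - u_lin lam x)" for x
          using component_le_norm_cart[of "v k x - u_lin lam x" i] by (simp add: w_def u_lin_def)
        then show ?thesis unfolding Y_def by (intro mult_left_mono nn_integral_mono ennreal_leI) auto
      qed
      finally show ?thesis .
    qed
    have ci: "integrable M (\<lambda>x. J k x $ i $ i - lam)" for i
    proof -
      have "set_integrable lebesgue \<Omega> (\<lambda>x. J k x $ i $ i - lam)"
        by (intro set_integrable_lebesgue_bounded_continuous[OF \<Omega>o(2,1)] continuous_on_diff ent continuous_on_const)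
      then show ?thesis by (simp add: M_def set_integrable_def integrable_restrict_space)
    qed
    have "(LINT x|M. trace (J k x)) - 2 * lam * measure M \<Omega> = (LINT x|M. trace (J k x) - 2 * lam)"
      using Jtr[of k] by (simp add: spM)
    also have "\<dots> = (LINT x|M. (J k x $ 1 $ 1 - lam) + (J k x $ 2 $ 2 - lam))"
      by (intro Bochner_Integration.integral_cong) (auto simp: trace_def sum_2)
    also have "\<dots> = (LINT x|M. J k x $ 1 $ 1 - lam) + (LINT x|M. J k x $ 2 $ 2 - lam)"
      by (rule Bochner_Integration.integral_add[OF ci ci])
    finally have "ennreal \<bar>(LINT x|M. trace (J k x)) - 2 * lam * measure M \<Omega>\<bar>
      \<le> ennreal (\<bar>LINT x|M. J k x $ 1 $ 1 - lam\<bar> + \<bar>LINT x|M. J k x $ 2 $ 2 - lam\<bar>)"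
      by (intro ennreal_leI) linarith
    also have "\<dots> = ennreal \<bar>LINT x|M. J k x $ 1 $ 1 - lam\<bar> + ennreal \<bar>LINT x|M. J k x $ 2 $ 2 - lam\<bar>" by simp
    also have "\<dots> \<le> 4 * Y k + 4 * Y k" by (intro add_mono each)
    also have "\<dots> = 8 * Y k" by (simp add: distrib_right[symmetric])
    finally show ?thesis .
  qed
  have inner: "ennreal \<bar>(LINT x|M. trace (G x)) - (LINT x|M. trace (J k x))\<bar> \<le> 2 * X k" for k
  proof -
    have "(LINT x|M. trace (G x)) - (LINT x|M. trace (J k x)) = (LINT x|M. trace (G x) - trace (J k x))"
      using tr Jtr by (simp add: G_def)
    also have "ennreal \<bar>\<dots>\<bar> \<le> (\<integral>\<^sup>+ x. ennreal (norm (trace (G x) - trace (J k x))) \<partial>M)"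
      using integral_norm_bound_ennreal[of M "\<lambda>x. trace (G x) - trace (J k x)"] tr Jtr by (simp add: G_def)
    also have "\<dots> \<le> (\<integral>\<^sup>+ x. 2 * ennreal (norm (J k x - G x)) \<partial>M)"
    proof (rule nn_integral_mono)
      fix x
      have "trace (G x) - trace (J k x) = trace (G x - J k x)" by (simp add: trace_def sum_2)
      then have "norm (trace (G x) - trace (J k x)) \<le> 2 * norm (J k x - G x)"
        using abs_trace_le[of "G x - J k x"] by (simp add: norm_minus_commute)
      then have "ennreal (norm (trace (G x) - trace (J k x))) \<le> ennreal (2 * norm (J k x - G x))" by (rule ennreal_leI)
      then show "ennreal (norm (trace (G x) - trace (J k x))) \<le> 2 * ennreal (norm (J k x - G x))"
        by (simp add: ennreal_mult')
    qed
    also have "\<dots> = 2 * X k" unfolding X_def using Jm Gm by (intro nn_integral_cmult) auto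
    finally show ?thesis .
  qed
  have "ennreal \<bar>(LINT x|M. trace (G x)) - 2 * lam * measure M \<Omega>\<bar> \<le> 2 * X k + 8 * Y k" for k
  proof -
    have "ennreal \<bar>(LINT x|M. trace (G x)) - 2 * lam * measure M \<Omega>\<bar>
      \<le> ennreal (\<bar>(LINT x|M. trace (G x)) - (LINT x|M. trace (J k x))\<bar> + \<bar>(LINT x|M. trace (J k x)) - 2 * lam * measure M \<Omega>\<bar>)"
      by (intro ennreal_leI) linarith
    also have "\<dots> = ennreal \<bar>(LINT x|M. trace (G x)) - (LINT x|M. trace (J k x))\<bar> + ennreal \<bar>(LINT x|M. trace (J k x)) - 2 * lam * measure M \<Omega>\<bar>"
      by simp
    also have "\<dots> \<le> 2 * X k + 8 * Y k" by (intro add_mono inner bdry)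
    finally show ?thesis .
  qed
  moreover have "(\<lambda>k. 2 * X k + 8 * Y k) \<longlonglongrightarrow> 2 * 0 + 8 * 0"
    by (intro tendsto_add ennreal_tendsto_cmult X Y) auto
  ultimately have "ennreal \<bar>(LINT x|M. trace (G x)) - 2 * lam * measure M \<Omega>\<bar> \<le> 2 * 0 + 8 * 0"
    by (intro tendsto_lowerbound) auto
  then show "(LINT x|M. trace (weak_gradient \<Omega> u x)) = 2 * lam * measure M \<Omega>" by (simp add: G_def)
qed

section \<open>From the pointwise bound to the excess\<close>

lemma admissible_h_tangent:
  assumes h: "admissible_h h" and s: "0 < s" and t: "0 < t"
  shows "(enn2real \<circ> h) s + deriv (enn2real \<circ> h) s * (t - s) \<le> (enn2real \<circ> h) t"
proof -
  have "(enn2real \<circ> h) differentiable (at s within {0<..})"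
    using h s by (auto simp: admissible_h_def C1_on_pos_def differentiable_on_def)
  then have "(enn2real \<circ> h) differentiable (at s)"
    using s by (simp add: at_within_open[of s "{0<..}"])
  then have "((enn2real \<circ> h) has_real_derivative deriv (enn2real \<circ> h) s) (at s)"
    using DERIV_deriv_iff_real_differentiable by blast
  then have "((enn2real \<circ> h) has_real_derivative deriv (enn2real \<circ> h) s) (at s within {0<..})"
    by (rule has_field_derivative_at_within)
  then have "deriv (enn2real \<circ> h) s * (t - s) \<le> (enn2real \<circ> h) t - (enn2real \<circ> h) s"
    using h s t unfolding admissible_h_def
    by (intro convex_on_imp_above_tangent[of "{0<..}"]) (simp_all only: interior_open open_greaterThan greaterThan_iff connected_Ioi)
  then show ?thesis by linarith
qed

text \<open>As \<open>enn2real\<close> sends infinity to 0, the real version of h is 0 on the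
  nonpositive axis and continuous on the positive one.\<close>

lemma admissible_h_measurable:
  assumes h: "admissible_h h"
  shows "(enn2real \<circ> h) \<in> borel_measurable borel"
proof -
  have "(\<lambda>t. if t \<in> {0<..} then (enn2real \<circ> h) t else 0) \<in> borel_measurable borel"
  proof (rule borel_measurable_continuous_on_if)
    show "continuous_on {0<..} (enn2real \<circ> h)"
      using h unfolding admissible_h_def C1_on_pos_def by (blast intro: differentiable_imp_continuous_on)
  qed auto
  moreover have "(\<lambda>t. if t \<in> {0<..} then (enn2real \<circ> h) t else 0) = enn2real \<circ> h"
    using h by (auto simp: admissible_h_def fun_eq_iff not_less)
  ultimately show ?thesis by simp
qed

text \<open>Abstracting the remainder as F lets both assertions of the theorem follow from the same
  integration. The tangent of h at lam^2 reduces the energy to |A|^q plus a multiple of the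
  determinant, and the term linear in the trace integrates to 0.\<close>

lemma excess_lower_bound:
  fixes h :: "real \<Rightarrow> ennreal" and F :: "mat2 \<Rightarrow> real" and m c q lam :: real
  defines "H \<equiv> enn2real \<circ> h"
  assumes \<Omega>: "bounded_lipschitz_domain \<Omega>" and q: "1 < q" and h: "admissible_h h" and lam: "0 < lam"
    and c: "0 < c" and u: "u \<in> admissible \<Omega> q lam" and F0: "\<And>A. 0 \<le> F A"
    and F: "\<And>A. 0 < det A \<Longrightarrow> (2 * lam\<^sup>2) powr (q / 2) + deriv H (lam\<^sup>2) * lam\<^sup>2 + m * (trace A - 2 * lam) + c * F A
        \<le> norm A powr q + deriv H (lam\<^sup>2) * det A"
  shows "ereal c * enn2ereal (\<integral>\<^sup>+ x\<in>\<Omega>. ennreal (F (weak_gradient \<Omega> u x)) \<partial>lebesgue) \<le> excess \<Omega> q h lam u"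
proof -
  have \<Omega>o: "open \<Omega>" "bounded \<Omega>" using \<Omega> by (auto simp: bounded_lipschitz_domain_def)
  have \<Omega>m [simp]: "\<Omega> \<in> sets lebesgue" using \<Omega>o by simp
  define M where "M = lebesgue_on \<Omega>"
  have finM: "emeasure M \<Omega> < \<infinity>"
    using emeasure_bounded_finite[OF \<Omega>o(2)] \<Omega>o(1)
    by (simp add: M_def emeasure_restrict_space main_part_sets)
  have spM: "space M = \<Omega>" by (simp add: M_def space_restrict_space)
  interpret finite_measure M by (rule finite_measureI) (use finM in \<open>simp add: spM\<close>)
  have res: "(\<integral>\<^sup>+ x\<in>\<Omega>. f x \<partial>lebesgue) = (\<integral>\<^sup>+ x. f x \<partial>M)" for f :: "plane \<Rightarrow> ennreal"
    by (simp add: M_def nn_integral_restrict_space)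
  define G where "G = weak_gradient \<Omega> u"
  note tr = integral_trace_weak_gradient[OF \<Omega> q u, folded M_def G_def]
  have detpos: "AE x in M. det (G x) > 0" using u unfolding admissible_def M_def G_def by blast
  define W0 where "W0 = (2 * lam\<^sup>2) powr (q / 2) + H (lam\<^sup>2)"
  define \<mu> where "\<mu> = measure M \<Omega>"
  have H0: "H t \<ge> 0" for t by (simp add: H_def)
  have hH: "h t = ennreal (H t)" if "t > 0" for t
    using h that by (auto simp: H_def admissible_h_def)
  have W0: "W0 \<ge> 0" using H0 by (simp add: W0_def)
  have E0: "energy \<Omega> q h (u_lin lam) = ennreal (W0 * \<mu>)"
  proof -
    have nm: "norm (lam *\<^sub>R mat 1 :: mat2) powr q = (2 * lam\<^sup>2) powr (q / 2)"
    proof -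
      have "(norm (lam *\<^sub>R mat 1 :: mat2))\<^sup>2 = 2 * lam\<^sup>2"
        unfolding norm_mat2_sq by (simp add: mat_def)
      then have "norm (lam *\<^sub>R mat 1 :: mat2) = sqrt (2 * lam\<^sup>2)" by (metis norm_ge_zero real_sqrt_unique)
      also have "\<dots> = (2 * lam\<^sup>2) powr (1/2)" by (simp add: powr_half_sqrt)
      finally show ?thesis by (simp add: powr_powr)
    qed
    have dt: "det (lam *\<^sub>R mat 1 :: mat2) = lam\<^sup>2" by (simp add: det_2 mat_def power2_eq_square)
    have "energy \<Omega> q h (u_lin lam) = (\<integral>\<^sup>+ x. stored_energy q h (weak_gradient \<Omega> (u_lin lam) x) \<partial>M)"
      unfolding energy_def by (rule res)
    also have "\<dots> = (\<integral>\<^sup>+ x. ennreal W0 \<partial>M)"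
    proof (rule nn_integral_cong_AE)
      show "AE x in M. stored_energy q h (weak_gradient \<Omega> (u_lin lam) x) = ennreal W0"
        using weak_gradient_u_lin[OF \<Omega>o, of lam, folded M_def]
        by eventually_elim (use lam H0 in \<open>simp add: stored_energy_def nm dt hH W0_def del: norm_scaleR\<close>)
    qed
    also have "\<dots> = ennreal (W0 * \<mu>)"
      using W0 by (simp add: spM \<mu>_def emeasure_eq_measure ennreal_mult)
    finally show ?thesis .
  qed
  define W where "W x = norm (G x) powr q + H (det (G x))" for x
  have [measurable]: "G \<in> borel_measurable M" by (rule tr(1))
  have W0': "W x \<ge> 0" for x using H0 by (simp add: W_def)
  have Wm [measurable]: "W \<in> borel_measurable M"
  proof -
    have [measurable]: "H \<in> borel_measurable borel" unfolding H_def by (rule admissible_h_measurable[OF h])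
    have "(det :: mat2 \<Rightarrow> real) \<in> borel_measurable borel"
      unfolding det_2[abs_def] by (intro borel_measurable_continuous_onI continuous_intros)
    then have [measurable]: "(\<lambda>x. det (G x)) \<in> borel_measurable M"
      using tr(1) by (rule measurable_compose[rotated])
    show ?thesis unfolding W_def by measurable
  qed
  have E: "energy \<Omega> q h u = (\<integral>\<^sup>+ x. ennreal (W x) \<partial>M)"
    unfolding energy_def res G_def[symmetric]
    using detpos by (intro nn_integral_cong_AE, eventually_elim)
      (use H0 in \<open>simp add: stored_energy_def W_def hH\<close>)
  show ?thesis
  proof (cases "energy \<Omega> q h u = \<infinity>")
    \<comment> \<open>The energy of the linear map is finite, so the excess is infinite
      here.\<close>
    case True
    then show ?thesis by (simp add: excess_def E0)
  next
    case False
    then have Wi: "integrable M W"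
      unfolding E using W0' by (intro integrableI_nonneg) (auto simp: less_top)
    \<comment> \<open>A density of the excess: subtracting the trace term makes it nonnegative
      almost everywhere and leaves its integral unchanged.\<close>
    define R where "R x = W x - W0 - m * (trace (G x) - 2 * lam)" for x
    have Ri: "integrable M R"
      unfolding R_def using Wi tr(2) by (intro Bochner_Integration.integrable_diff integrable_mult_right integrable_const)
    have "integral\<^sup>L M R = integral\<^sup>L M W - W0 * \<mu> - m * (2 * lam * \<mu> - 2 * lam * \<mu>)"
      unfolding R_def using Wi tr(2,3)
      by (simp add: spM \<mu>_def)
    then have Rint: "integral\<^sup>L M R = integral\<^sup>L M W - W0 * \<mu>" by simp
    have FR: "AE x in M. c * F (G x) \<le> R x"
      using detpos
    proof eventually_elim
      case (elim x)
      have "H (lam\<^sup>2) + deriv H (lam\<^sup>2) * (det (G x) - lam\<^sup>2) \<le> H (det (G x))"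
        unfolding H_def using elim lam by (intro admissible_h_tangent[OF h]) auto
      then show ?case using F[OF elim] by (simp add: R_def W_def W0_def algebra_simps)
    qed
    have Rpos: "AE x in M. 0 \<le> R x"
      using FR
    proof eventually_elim
      case (elim x)
      have "0 \<le> c * F (G x)" using c F0[of "G x"] by simp
      then show ?case using elim by linarith
    qed
    have "(\<integral>\<^sup>+ x. ennreal (F (G x)) \<partial>M) \<le> (\<integral>\<^sup>+ x. ennreal (R x / c) \<partial>M)"
      using FR by (intro nn_integral_mono_AE, eventually_elim) (use c in \<open>auto intro!: ennreal_leI simp: field_simps\<close>)
    also have "\<dots> = ennreal (integral\<^sup>L M (\<lambda>x. R x / c))"
    proof (rule nn_integral_eq_integral)
      show "AE x in M. 0 \<le> R x / c" using Rpos by eventually_elim (use c in simp)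
    qed (use Ri in auto)
    finally have "(\<integral>\<^sup>+ x. ennreal (F (G x)) \<partial>M) \<le> ennreal (integral\<^sup>L M R / c)" by simp
    moreover have R0: "0 \<le> integral\<^sup>L M R"
      using Rpos by (rule integral_nonneg_AE)
    ultimately have "enn2ereal (\<integral>\<^sup>+ x. ennreal (F (G x)) \<partial>M) \<le> ereal (integral\<^sup>L M R / c)"
      using c by (metis divide_nonneg_pos enn2ereal_ennreal less_eq_ennreal.rep_eq)
    then have "ereal c * enn2ereal (\<integral>\<^sup>+ x. ennreal (F (G x)) \<partial>M) \<le> ereal c * ereal (integral\<^sup>L M R / c)"
      using c by (intro ereal_mult_left_mono) auto
    also have "\<dots> = ereal (integral\<^sup>L M W) - ereal (W0 * \<mu>)" using c Rint by simp
    also have "\<dots> = excess \<Omega> q h lam u"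
    proof -
      have "energy \<Omega> q h u = ennreal (integral\<^sup>L M W)"
        unfolding E using Wi W0' by (intro nn_integral_eq_integral) auto
      moreover have "0 \<le> integral\<^sup>L M W" using W0' by (intro integral_nonneg_AE) auto
      moreover have "0 \<le> W0 * \<mu>" using W0 by (simp add: \<mu>_def)
      ultimately show ?thesis by (simp add: excess_def E0 enn2ereal_ennreal)
    qed
    finally show ?thesis by (simp add: res G_def)
  qed
qed

theorem theorem2p11:
  fixes \<Omega> :: "(real ^ 2) set" and q lam :: real and h :: "real \<Rightarrow> ennreal"
  assumes "bounded_lipschitz_domain \<Omega>"
    and "1 < q" and "q < 2"
    and "admissible_h h"
    and "lam > 0"
    and "deriv (enn2real \<circ> h) (lam\<^sup>2) > 0"
    and "1 / (2 powr (3 - q) * deriv (enn2real \<circ> h) (lam\<^sup>2) * lam powr (2 - q))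
           > (q - 1) powr ((q - 1) / 2) * q powr (- q / 2)"
  shows "(\<exists>c > 0. \<forall>u \<in> admissible \<Omega> q lam.
            enn2ereal (\<integral>\<^sup>+ x\<in>\<Omega>. ennreal
                (min ((norm (weak_gradient \<Omega> u x - lam *\<^sub>R mat 1))\<^sup>2)
                     (norm (weak_gradient \<Omega> u x - lam *\<^sub>R mat 1) powr q)) \<partial>lebesgue)
              \<le> ereal c * excess \<Omega> q h lam u)
       \<and> (\<forall>u \<in> admissible \<Omega> q lam.
            ereal (lam * deriv (enn2real \<circ> h) (lam\<^sup>2)) *
              enn2ereal (\<integral>\<^sup>+ x\<in>\<Omega>. ennreal
                (2 * lam\<^sup>2 * (curl \<Omega> u x)\<^sup>2 /
                  (3 * ((curl \<Omega> u x)\<^sup>2 + max (4 * lam\<^sup>2) ((divergence \<Omega> u x)\<^sup>2)) powr (3 / 2)))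
                \<partial>lebesgue)
              \<le> excess \<Omega> q h lam u)"
proof -
  define k where "k = deriv (enn2real \<circ> h) (lam\<^sup>2)"
  have k: "k > 0" using assms(6) by (simp add: k_def)
  have bd: "k * lam\<^sup>2 < (1/5 + 19/50 * (q - 1)) * (2 * lam\<^sup>2) powr (q / 2)"
    using derivative_bound[OF assms(2,3) k assms(5)] assms(7) by (simp add: k_def)
  define m where "m = q * (2 * lam\<^sup>2) powr (q / 2) / (2 * lam) + k * lam"
  note lower = stored_energy_lower_bound[OF assms(2,3) k assms(5) bd, folded m_def]
  define F where "F A = min ((norm (A - lam *\<^sub>R mat 1))\<^sup>2) (norm (A - lam *\<^sub>R mat 1) powr q)" for A :: mat2
  obtain c where c: "c > 0" and cF: "\<And>A. 0 < det A \<Longrightarrow>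
      (2 * lam\<^sup>2) powr (q / 2) + k * lam\<^sup>2 + m * (trace A - 2 * lam) + c * F A \<le> norm A powr q + k * det A"
    using lower(1) unfolding F_def by blast
  define Q where "Q A = 2 * lam\<^sup>2 * (A$1$2 - A$2$1)\<^sup>2 /
      (3 * ((A$1$2 - A$2$1)\<^sup>2 + max (4 * lam\<^sup>2) ((trace A)\<^sup>2)) powr (3 / 2))" for A :: mat2
  have cQ: "(2 * lam\<^sup>2) powr (q / 2) + k * lam\<^sup>2 + m * (trace A - 2 * lam) + (lam * k) * Q A \<le> norm A powr q + k * det A"
    if "0 < det A" for A using lower(2) that unfolding Q_def by blast
  have "enn2ereal (\<integral>\<^sup>+ x\<in>\<Omega>. ennreal (F (weak_gradient \<Omega> u x)) \<partial>lebesgue) \<le> ereal (1 / c) * excess \<Omega> q h lam u"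
    if u: "u \<in> admissible \<Omega> q lam" for u
  proof -
    have "ereal c * enn2ereal (\<integral>\<^sup>+ x\<in>\<Omega>. ennreal (F (weak_gradient \<Omega> u x)) \<partial>lebesgue) \<le> excess \<Omega> q h lam u"
      using cF unfolding k_def by (intro excess_lower_bound[OF assms(1,2,4,5) c u]) (auto simp: F_def)
    then have "ereal (1 / c) * (ereal c * enn2ereal (\<integral>\<^sup>+ x\<in>\<Omega>. ennreal (F (weak_gradient \<Omega> u x)) \<partial>lebesgue))
      \<le> ereal (1 / c) * excess \<Omega> q h lam u" using c by (intro ereal_mult_left_mono) auto
    moreover have "ereal (1 / c) * (ereal c * y) = y" for y
      using c by (simp add: mult.assoc[symmetric] one_ereal_def[symmetric])
    ultimately show ?thesis by simp
  qed
  \<comment> \<open>Here the role of the constant c is played by \<open>lam * k\<close>, and that of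
    F by the curl integrand.\<close>
  moreover have "ereal (lam * k) * enn2ereal (\<integral>\<^sup>+ x\<in>\<Omega>. ennreal (Q (weak_gradient \<Omega> u x)) \<partial>lebesgue) \<le> excess \<Omega> q h lam u"
    if u: "u \<in> admissible \<Omega> q lam" for u
    using cQ k assms(5) unfolding k_def
    by (intro excess_lower_bound[OF assms(1,2,4,5) _ u]) (auto simp: Q_def)
  ultimately show ?thesis
    unfolding F_def Q_def k_def curl_def divergence_def using c by (intro conjI exI[of _ "1 / c"]) auto
qed


end
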